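(* Let $\mathfrak g$ be a simple Lie algebra over $\Bbbk$. For an outer periodic automorphism $\vartheta=\vartheta(\boldsymbol p)$ of $\mathfrak g$ with associated diagram automorphism $\sigma$ and Kac labels $\boldsymbol p=(p_0,p_1,\dots,p_r)$, the Lie algebra $\mathfrak g_{(0)}$ depends only on the set $\mathcal L(\vartheta)=\{i\mid 0\le i\le r,\ p_i\neq0\}$. That is, if $\boldsymbol p$ and $\boldsymbol p'$ are two tuples of Kac labels for the same $\sigma$ (and the same $\mathfrak b,\mathfrak t$) with $\{i\mid p_i\ne0\}=\{i\mid p_i'\ne0\}$, then the $\vartheta(\boldsymbol p)$-contraction and the $\vartheta(\boldsymbol p')$-contraction define the same Lie algebra structure on the vector space $\mathfrak g$.
   Context: $\Bbbk$ is an algebraically closed field of characteristic $0$. Kac labels of outer periodic automorphisms. Let $\mathfrak g$ be simple of type $A_n$ ($n\ge2$), $D_n$ ($n\ge4$) or $E_6$, with a Borel subalgebra $\mathfrak b$, a Cartan subalgebra $\mathfrak t\subset\mathfrak b$ and Chevalley generators, and let $\sigma$ be a nontrivial diagram automorphism, i.e., the automorphism of $\mathfrak g$ induced by a nontrivial symmetry of the Dynkin diagram via the corresponding permutation of the Chevalley generators. Its order $\mathsf{ord}(\sigma)$ is $2$ or $3$, the latter only for some $\sigma$ in type $D_4$. Let $\mathfrak g=\bigoplus_{i=0}^{\mathsf{ord}(\sigma)-1}\mathfrak g^{(\sigma)}_i$ be the decomposition into eigenspaces of $\sigma$ ($\mathfrak g_i^{(\sigma)}$ has eigenvalue $\omega^i$,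 $\omega$ a primitive $\mathsf{ord}(\sigma)$-th root of unity). Then $\mathfrak g^\sigma=\mathfrak g_0^{(\sigma)}$ is simple, of rank denoted by $r$, with Cartan subalgebra $\mathfrak t^\sigma$ and Borel subalgebra $\mathfrak b^\sigma$; each $\mathfrak g_i^{(\sigma)}$ is a simple $\mathfrak g^\sigma$-module. Let $\nu_1,\dots,\nu_r$ be the simple roots of $\mathfrak g^\sigma$ with respect to $\mathfrak b^\sigma$, let $-\delta_1$ be the lowest weight of the $\mathfrak g^\sigma$-module $\mathfrak g_1^{(\sigma)}$, write $\delta_1=\sum_{i=1}^r a_i'\nu_i$, and set $a'_0=1$. For $\gamma$ in the root lattice of $\mathfrak g^\sigma$, $[\gamma:\nu_i]$ denotes the coefficient of $\nu_i$ in $\gamma$. Let $\boldsymbol p=(p_0,\dots,p_r)\ne(0,\dots,0)$ be nonnegative integers with $\gcd(p_0,\dots,p_r)=1$, and set $m=\mathsf{ord}(\sigma)\sum_{i=0}^r a_i'p_i$. For a $\mathfrak t^\sigma$-weight $\gamma$ (possibly zero) of $\mathfrak g_j^{(\sigma)}$, put $d_j(\gamma)=jp_0+\sum_{i=1}^r[\gamma+j\delta_1:\nu_i]\,p_i$, $j=0,1,2$. The automorphism $\vartheta(\boldsymbol p)$, of order $m$, acts on the $\mathfrak t^\sigma$-weight space $(\mathfrak g_j^{(\sigma)})^\gamma$ as multiplication by $\zeta^{d_j(\gamma)}$, where $\zeta$ is a fixed primitive $m$-th root of unity; every outer automorphism of finite order is conjugate to one of this form. Periodic contraction. Let $\vartheta$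 be an automorphism of $\mathfrak g$ of order $m$, and let $\mathfrak g=\bigoplus_{i=0}^{m-1}\mathfrak g_i$, where $\mathfrak g_i$ is the $\zeta^i$-eigenspace of $\vartheta$. The $\vartheta$-contraction $\mathfrak g_{(0)}$ is the vector space $\mathfrak g$ with the Lie bracket $[\ ,\,]_{(0)}$ defined for $x\in\mathfrak g_i$, $y\in\mathfrak g_j$ ($0\le i,j\le m-1$) by $[x,y]_{(0)}=[x,y]$ if $i+j\le m-1$ and $[x,y]_{(0)}=0$ if $i+j>m-1$. *)

theory Defs
  imports
    "HOL-Combinatorics.Permutations"
    "HOL-Computational_Algebra.Polynomial"
begin

section \<open>Lie algebras\<close>

text \<open>
  A Lie algebra is carried by a whole type; \<open>sc\<close> is the scalar multiplication and
  \<open>br\<close> the bracket. Subalgebras, ideals and submodules are subsets of the type.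
\<close>

locale lie_algebra = vector_space sc
  for sc :: "'k::field \<Rightarrow> 'g::ab_group_add \<Rightarrow> 'g" +
  fixes br :: "'g \<Rightarrow> 'g \<Rightarrow> 'g"
  assumes br_add_left: "br (x + y) z = br x z + br y z"
    and br_add_right: "br x (y + z) = br x y + br x z"
    and br_scale_left: "br (sc a x) y = sc a (br x y)"
    and br_scale_right: "br x (sc a y) = sc a (br x y)"
    and br_self: "br x x = 0"
    and jacobi: "br x (br y z) + br y (br z x) + br z (br x y) = 0"

definition lie_subalgebra ::
    "('k::field \<Rightarrow> 'g::ab_group_add \<Rightarrow> 'g) \<Rightarrow> ('g \<Rightarrow> 'g \<Rightarrow> 'g) \<Rightarrow> 'g set \<Rightarrow> bool" where
  "lie_subalgebra sc br S \<longleftrightarrow>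
     module.subspace sc S \<and> (\<forall>x\<in>S. \<forall>y\<in>S. br x y \<in> S)"

definition lie_ideal ::
    "('k::field \<Rightarrow> 'g::ab_group_add \<Rightarrow> 'g) \<Rightarrow> ('g \<Rightarrow> 'g \<Rightarrow> 'g) \<Rightarrow> 'g set \<Rightarrow> bool" where
  "lie_ideal sc br I \<longleftrightarrow>
     module.subspace sc I \<and> (\<forall>x. \<forall>y\<in>I. br x y \<in> I)"

definition simple_lie_algebra ::
    "('k::field \<Rightarrow> 'g::ab_group_add \<Rightarrow> 'g) \<Rightarrow> ('g \<Rightarrow> 'g \<Rightarrow> 'g) \<Rightarrow> bool" where
  "simple_lie_algebra sc br \<longleftrightarrow>
     lie_algebra sc br \<and>
     (\<exists>B. finite B \<and> module.span sc B = UNIV) \<and>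
     (\<exists>x y. br x y \<noteq> 0) \<and>
     (\<forall>I. lie_ideal sc br I \<longrightarrow> I = {0} \<or> I = UNIV)"

definition lie_automorphism ::
    "('k::field \<Rightarrow> 'g::ab_group_add \<Rightarrow> 'g) \<Rightarrow> ('g \<Rightarrow> 'g \<Rightarrow> 'g) \<Rightarrow> ('g \<Rightarrow> 'g) \<Rightarrow> bool" where
  "lie_automorphism sc br \<theta> \<longleftrightarrow>
     Vector_Spaces.linear sc sc \<theta> \<and> bij \<theta> \<and> (\<forall>x y. \<theta> (br x y) = br (\<theta> x) (\<theta> y))"

definition aut_order :: "('g \<Rightarrow> 'g) \<Rightarrow> nat" where
  "aut_order \<theta> = (LEAST k. 0 < k \<and> \<theta> ^^ k = id)"

definition bracket_span ::
    "('k::field \<Rightarrow> 'g::ab_group_add \<Rightarrow> 'g) \<Rightarrow> ('g \<Rightarrow> 'g \<Rightarrow> 'g) \<Rightarrow> 'g set \<Rightarrow> 'g set \<Rightarrow> 'g set" where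
  "bracket_span sc br U V = module.span sc {br x y | x y. x \<in> U \<and> y \<in> V}"

definition solvable_subalgebra ::
    "('k::field \<Rightarrow> 'g::ab_group_add \<Rightarrow> 'g) \<Rightarrow> ('g \<Rightarrow> 'g \<Rightarrow> 'g) \<Rightarrow> 'g set \<Rightarrow> bool" where
  "solvable_subalgebra sc br S \<longleftrightarrow>
     lie_subalgebra sc br S \<and> (\<exists>k. ((\<lambda>U. bracket_span sc br U U) ^^ k) S = {0})"

definition nilpotent_subalgebra ::
    "('k::field \<Rightarrow> 'g::ab_group_add \<Rightarrow> 'g) \<Rightarrow> ('g \<Rightarrow> 'g \<Rightarrow> 'g) \<Rightarrow> 'g set \<Rightarrow> bool" where
  "nilpotent_subalgebra sc br S \<longleftrightarrow>
     lie_subalgebra sc br S \<and> (\<exists>k. ((\<lambda>U. bracket_span sc br S U) ^^ k) S = {0})"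

definition cartan_subalgebra ::
    "('k::field \<Rightarrow> 'g::ab_group_add \<Rightarrow> 'g) \<Rightarrow> ('g \<Rightarrow> 'g \<Rightarrow> 'g) \<Rightarrow> 'g set \<Rightarrow> bool" where
  "cartan_subalgebra sc br t \<longleftrightarrow>
     nilpotent_subalgebra sc br t \<and> {x. \<forall>h\<in>t. br x h \<in> t} = t"

definition borel_subalgebra ::
    "('k::field \<Rightarrow> 'g::ab_group_add \<Rightarrow> 'g) \<Rightarrow> ('g \<Rightarrow> 'g \<Rightarrow> 'g) \<Rightarrow> 'g set \<Rightarrow> bool" where
  "borel_subalgebra sc br b \<longleftrightarrow>
     solvable_subalgebra sc br b \<and>
     (\<forall>c. solvable_subalgebra sc br c \<and> b \<subseteq> c \<longrightarrow> c = b)"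


section \<open>Weights and roots\<close>

text \<open>
  Linear functionals on a subspace \<open>t\<close> are functions on the whole type that are linear on
  \<open>t\<close> and vanish outside \<open>t\<close>. With this normalisation, equality of functionals on \<open>t\<close> is
  equality of functions, and pointwise sums, negatives and multiples stay in the dual.
\<close>

definition dual_on ::
    "('k::field \<Rightarrow> 'g::ab_group_add \<Rightarrow> 'g) \<Rightarrow> 'g set \<Rightarrow> ('g \<Rightarrow> 'k) set" where
  "dual_on sc t =
     {\<gamma>. (\<forall>x\<in>t. \<forall>y\<in>t. \<gamma> (x + y) = \<gamma> x + \<gamma> y) \<and>
         (\<forall>a. \<forall>x\<in>t. \<gamma> (sc a x) = a * \<gamma> x) \<and>
         (\<forall>x. x \<notin> t \<longrightarrow> \<gamma> x = 0)}"

definition weight_space ::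
    "('k::field \<Rightarrow> 'g::ab_group_add \<Rightarrow> 'g) \<Rightarrow> ('g \<Rightarrow> 'g \<Rightarrow> 'g) \<Rightarrow> 'g set \<Rightarrow> 'g set
      \<Rightarrow> ('g \<Rightarrow> 'k) \<Rightarrow> 'g set" where
  "weight_space sc br V t \<gamma> = {x \<in> V. \<forall>h\<in>t. br h x = sc (\<gamma> h) x}"

text \<open>The zero functional may be a weight.\<close>

definition weights ::
    "('k::field \<Rightarrow> 'g::ab_group_add \<Rightarrow> 'g) \<Rightarrow> ('g \<Rightarrow> 'g \<Rightarrow> 'g) \<Rightarrow> 'g set \<Rightarrow> 'g set
      \<Rightarrow> ('g \<Rightarrow> 'k) set" where
  "weights sc br V t = {\<gamma> \<in> dual_on sc t. weight_space sc br V t \<gamma> \<noteq> {0}}"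

text \<open>Roots of a subalgebra \<open>l\<close> with Cartan subalgebra \<open>t\<close> and Borel subalgebra \<open>b\<close>.\<close>

definition roots ::
    "('k::field \<Rightarrow> 'g::ab_group_add \<Rightarrow> 'g) \<Rightarrow> ('g \<Rightarrow> 'g \<Rightarrow> 'g) \<Rightarrow> 'g set \<Rightarrow> 'g set
      \<Rightarrow> ('g \<Rightarrow> 'k) set" where
  "roots sc br l t = weights sc br l t - {\<lambda>_. 0}"

definition positive_roots ::
    "('k::field \<Rightarrow> 'g::ab_group_add \<Rightarrow> 'g) \<Rightarrow> ('g \<Rightarrow> 'g \<Rightarrow> 'g) \<Rightarrow> 'g set \<Rightarrow> 'g set \<Rightarrow> 'g set
      \<Rightarrow> ('g \<Rightarrow> 'k) set" where
  "positive_roots sc br l t b = {\<gamma> \<in> roots sc br l t. weight_space sc br l t \<gamma> \<subseteq> b}"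

definition simple_roots ::
    "('k::field \<Rightarrow> 'g::ab_group_add \<Rightarrow> 'g) \<Rightarrow> ('g \<Rightarrow> 'g \<Rightarrow> 'g) \<Rightarrow> 'g set \<Rightarrow> 'g set \<Rightarrow> 'g set
      \<Rightarrow> ('g \<Rightarrow> 'k) set" where
  "simple_roots sc br l t b =
     {\<gamma> \<in> positive_roots sc br l t b.
        \<not> (\<exists>\<mu>\<in>positive_roots sc br l t b. \<exists>\<kappa>\<in>positive_roots sc br l t b.
              \<gamma> = (\<lambda>h. \<mu> h + \<kappa> h))}"

text \<open>
  The lowest weight is the least weight for the usual partial order, in which
  \<open>\<gamma> \<le> \<mu>\<close> iff \<open>\<mu> - \<gamma>\<close> is a nonnegative integral combination of the simple roots
  \<open>\<nu> 1, \<dots>, \<nu> r\<close>.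
\<close>

definition is_lowest_weight ::
    "('k::field \<Rightarrow> 'g::ab_group_add \<Rightarrow> 'g) \<Rightarrow> ('g \<Rightarrow> 'g \<Rightarrow> 'g) \<Rightarrow> 'g set \<Rightarrow> 'g set
      \<Rightarrow> nat \<Rightarrow> (nat \<Rightarrow> 'g \<Rightarrow> 'k) \<Rightarrow> ('g \<Rightarrow> 'k) \<Rightarrow> bool" where
  "is_lowest_weight sc br V t r \<nu> \<gamma> \<longleftrightarrow>
     \<gamma> \<in> weights sc br V t \<and>
     (\<forall>\<mu>\<in>weights sc br V t. \<exists>c::nat \<Rightarrow> nat.
        \<mu> = (\<lambda>h. \<gamma> h + (\<Sum>i=1..r. of_nat (c i) * \<nu> i h)))"

text \<open>The coefficient $[\gamma:\nu_i]$ of an element of the root lattice.\<close>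

definition root_coeff ::
    "nat \<Rightarrow> (nat \<Rightarrow> 'g \<Rightarrow> 'k::field) \<Rightarrow> ('g \<Rightarrow> 'k) \<Rightarrow> nat \<Rightarrow> int" where
  "root_coeff r \<nu> \<gamma> =
     (THE c. (\<forall>i. i \<notin> {1..r} \<longrightarrow> c i = 0) \<and> \<gamma> = (\<lambda>h. \<Sum>i=1..r. of_int (c i) * \<nu> i h))"


section \<open>Dynkin types and Chevalley generators\<close>

text \<open>Simply laced Dynkin diagrams, with the numbering of Bourbaki.\<close>

datatype dynkin_type = Type_A nat | Type_D nat | Type_E6

fun outer_type :: "dynkin_type \<Rightarrow> bool" where
  "outer_type (Type_A n) = (2 \<le> n)"
| "outer_type (Type_D n) = (4 \<le> n)"
| "outer_type Type_E6 = True"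

fun dynkin_rank :: "dynkin_type \<Rightarrow> nat" where
  "dynkin_rank (Type_A n) = n"
| "dynkin_rank (Type_D n) = n"
| "dynkin_rank Type_E6 = 6"

fun dynkin_edges :: "dynkin_type \<Rightarrow> nat set set" where
  "dynkin_edges (Type_A n) = {{i, i + 1} | i. 1 \<le> i \<and> i < n}"
| "dynkin_edges (Type_D n) = insert {n - 2, n} {{i, i + 1} | i. 1 \<le> i \<and> i < n - 1}"
| "dynkin_edges Type_E6 = {{1, 3}, {3, 4}, {4, 5}, {5, 6}, {2, 4}}"

definition cartan_matrix :: "dynkin_type \<Rightarrow> nat \<Rightarrow> nat \<Rightarrow> int" where
  "cartan_matrix X i j = (if i = j then 2 else if {i, j} \<in> dynkin_edges X then - 1 else 0)"

text \<open>
  A simple Lie algebra has type \<open>X\<close> iff, for some numbering of its simple roots \<open>\<alpha> i\<close>,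
  the numbers \<open>\<alpha> j (h i)\<close> with \<open>h i = br (e i) (f i)\<close> form the Cartan matrix of \<open>X\<close>.
  The predicate fixes such a numbering together with Chevalley generators.
\<close>

definition chevalley_generators ::
    "('k::field \<Rightarrow> 'g::ab_group_add \<Rightarrow> 'g) \<Rightarrow> ('g \<Rightarrow> 'g \<Rightarrow> 'g) \<Rightarrow> 'g set \<Rightarrow> 'g set
      \<Rightarrow> dynkin_type \<Rightarrow> (nat \<Rightarrow> 'g \<Rightarrow> 'k) \<Rightarrow> (nat \<Rightarrow> 'g) \<Rightarrow> (nat \<Rightarrow> 'g) \<Rightarrow> bool" where
  "chevalley_generators sc br t b X \<alpha> e f \<longleftrightarrow>
     bij_betw \<alpha> {1..dynkin_rank X} (simple_roots sc br UNIV t b) \<and>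
     (\<forall>i\<in>{1..dynkin_rank X}.
        e i \<in> weight_space sc br UNIV t (\<alpha> i) \<and>
        f i \<in> weight_space sc br UNIV t (\<lambda>h. - \<alpha> i h) \<and>
        br (e i) (f i) \<in> t) \<and>
     (\<forall>i\<in>{1..dynkin_rank X}. \<forall>j\<in>{1..dynkin_rank X}.
        \<alpha> j (br (e i) (f i)) = of_int (cartan_matrix X i j) \<and>
        (i \<noteq> j \<longrightarrow> br (e i) (f j) = 0)) \<and>
     (\<forall>S. lie_subalgebra sc br S \<and> e ` {1..dynkin_rank X} \<union> f ` {1..dynkin_rank X} \<subseteq> S
        \<longrightarrow> S = UNIV)"

definition diagram_symmetry :: "dynkin_type \<Rightarrow> (nat \<Rightarrow> nat) \<Rightarrow> bool" where
  "diagram_symmetry X \<pi> \<longleftrightarrow>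
     \<pi> permutes {1..dynkin_rank X} \<and>
     (\<forall>i\<in>{1..dynkin_rank X}. \<forall>j\<in>{1..dynkin_rank X}.
        cartan_matrix X (\<pi> i) (\<pi> j) = cartan_matrix X i j)"

definition nontrivial_diagram_automorphism ::
    "('k::field \<Rightarrow> 'g::ab_group_add \<Rightarrow> 'g) \<Rightarrow> ('g \<Rightarrow> 'g \<Rightarrow> 'g)
      \<Rightarrow> dynkin_type \<Rightarrow> (nat \<Rightarrow> 'g) \<Rightarrow> (nat \<Rightarrow> 'g) \<Rightarrow> ('g \<Rightarrow> 'g) \<Rightarrow> bool" where
  "nontrivial_diagram_automorphism sc br X e f \<sigma> \<longleftrightarrow>
     lie_automorphism sc br \<sigma> \<and>
     (\<exists>\<pi>. diagram_symmetry X \<pi> \<and> \<pi> \<noteq> id \<and>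
        (\<forall>i\<in>{1..dynkin_rank X}. \<sigma> (e i) = e (\<pi> i) \<and> \<sigma> (f i) = f (\<pi> i)))"


section \<open>Periodic automorphisms and contractions\<close>

definition primitive_root_of_unity :: "nat \<Rightarrow> 'k::field \<Rightarrow> bool" where
  "primitive_root_of_unity n z \<longleftrightarrow> 0 < n \<and> z ^ n = 1 \<and> (\<forall>k. 0 < k \<and> k < n \<longrightarrow> z ^ k \<noteq> 1)"

definition eigenspace ::
    "('k::field \<Rightarrow> 'g::ab_group_add \<Rightarrow> 'g) \<Rightarrow> ('g \<Rightarrow> 'g) \<Rightarrow> 'k \<Rightarrow> 'g set" where
  "eigenspace sc \<theta> c = {x. \<theta> x = sc c x}"

text \<open>
  Components of \<open>x\<close> in the decomposition of the space into the \<open>\<zeta> ^ i\<close>-eigenspaces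
  of \<open>\<theta>\<close>, \<open>i < m\<close>.
\<close>

definition eigen_component ::
    "('k::field \<Rightarrow> 'g::ab_group_add \<Rightarrow> 'g) \<Rightarrow> ('g \<Rightarrow> 'g) \<Rightarrow> nat \<Rightarrow> 'k \<Rightarrow> 'g \<Rightarrow> nat \<Rightarrow> 'g" where
  "eigen_component sc \<theta> m \<zeta> x =
     (THE c. (\<forall>i<m. c i \<in> eigenspace sc \<theta> (\<zeta> ^ i)) \<and> (\<forall>i\<ge>m. c i = 0) \<and> x = (\<Sum>i<m. c i))"

text \<open>
  The bracket of the \<open>\<theta>\<close>-contraction of \<open>br\<close>, for \<open>\<theta>\<close> of order \<open>m\<close> and a primitive
  \<open>m\<close>-th root of unity \<open>\<zeta>\<close>: the bilinear extension of the rule on homogeneous elements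
  given in \<open>contraction_homogeneous\<close> below.
\<close>

definition contraction ::
    "('k::field \<Rightarrow> 'g::ab_group_add \<Rightarrow> 'g) \<Rightarrow> ('g \<Rightarrow> 'g \<Rightarrow> 'g) \<Rightarrow> ('g \<Rightarrow> 'g) \<Rightarrow> nat \<Rightarrow> 'k
      \<Rightarrow> 'g \<Rightarrow> 'g \<Rightarrow> 'g" where
  "contraction sc br \<theta> m \<zeta> x y =
     (\<Sum>i<m. \<Sum>j<m.
        if i + j \<le> m - 1
        then br (eigen_component sc \<theta> m \<zeta> x i) (eigen_component sc \<theta> m \<zeta> y j)
        else 0)"

lemma eigenvectors_sum_zero:
  fixes sc :: "'k::field \<Rightarrow> 'g::ab_group_add \<Rightarrow> 'g" and m :: nat
  assumes "Vector_Spaces.linear sc sc \<theta>" "inj_on z {..<m}"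
    and "\<And>i. i < m \<Longrightarrow> c i \<in> eigenspace sc \<theta> (z i)" "(\<Sum>i<m. c i) = 0" "i < m"
  shows "c i = 0"
  using assms(2-)
proof (induction m arbitrary: c i)
  case 0
  then show ?case by simp
next
  case (Suc m)
  interpret L: Vector_Spaces.linear sc sc \<theta> by fact
  let ?d = "\<lambda>i. sc (z i - z m) (c i)"
  have ev: "\<theta> (c j) = sc (z j) (c j)" if "j < Suc m" for j
    using Suc.prems(2)[OF that] by (simp add: eigenspace_def)
  have "(\<Sum>j<Suc m. ?d j) = \<theta> (\<Sum>j<Suc m. c j) - sc (z m) (\<Sum>j<Suc m. c j)"
    unfolding L.sum L.vs1.scale_sum_right sum_subtractf[symmetric]
    by (rule sum.cong) (auto simp: ev L.vs1.scale_left_diff_distrib)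
  then have s: "(\<Sum>j<m. ?d j) = 0"
    using Suc.prems(3) by (simp add: L.zero L.vs1.scale_zero_right)
  have d0: "?d j = 0" if "j < m" for j
  proof (rule Suc.IH[OF _ _ s that])
    show "inj_on z {..<m}" using Suc.prems(1) by (rule inj_on_subset) auto
    show "?d k \<in> eigenspace sc \<theta> (z k)" if "k < m" for k
      using that ev[of k] by (simp add: eigenspace_def L.scale mult.commute)
  qed
  have c0: "c j = 0" if "j < m" for j
  proof -
    have "z j - z m \<noteq> 0"
      using Suc.prems(1) that by (auto simp: inj_on_def)
    with d0[OF that] show ?thesis by simp
  qed
  moreover have "c m = 0"
    using Suc.prems(3) c0 by simp
  ultimately show ?case
    using Suc.prems(4) less_Suc_eq by auto
qed

lemma primitive_root_inj_on:
  assumes "primitive_root_of_unity m (\<zeta>::'k::field)"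
  shows "inj_on (\<lambda>i. \<zeta> ^ i) {..<m}"
proof (rule linorder_inj_onI)
  fix i j assume ij: "i < j" "i \<in> {..<m}" "j \<in> {..<m}"
  have nz: "\<zeta> \<noteq> 0"
    using assms by (auto simp: primitive_root_of_unity_def power_0_left)
  show "\<zeta> ^ i \<noteq> \<zeta> ^ j"
  proof
    assume "\<zeta> ^ i = \<zeta> ^ j"
    moreover have "\<zeta> ^ j = \<zeta> ^ i * \<zeta> ^ (j - i)"
      using ij by (simp flip: power_add)
    ultimately have "\<zeta> ^ (j - i) = 1" using nz by simp
    with assms ij show False by (auto simp: primitive_root_of_unity_def)
  qed
qed auto

lemma eigen_component_unique:
  fixes sc :: "'k::field \<Rightarrow> 'g::ab_group_add \<Rightarrow> 'g"
  assumes lin: "Vector_Spaces.linear sc sc \<theta>" and prim: "primitive_root_of_unity m \<zeta>"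
    and c: "\<And>i. i < m \<Longrightarrow> c i \<in> eigenspace sc \<theta> (\<zeta> ^ i)" "\<And>i. i \<ge> m \<Longrightarrow> c i = 0"
  shows "eigen_component sc \<theta> m \<zeta> (\<Sum>i<m. c i) = c"
  unfolding eigen_component_def
proof (rule the_equality)
  interpret L: Vector_Spaces.linear sc sc \<theta> by fact
  fix d
  assume d: "(\<forall>i<m. d i \<in> eigenspace sc \<theta> (\<zeta> ^ i)) \<and> (\<forall>i\<ge>m. d i = 0) \<and> (\<Sum>i<m. c i) = (\<Sum>i<m. d i)"
  show "d = c"
  proof
    fix i
    show "d i = c i"
    proof (cases "i < m")
      case True
      have "(\<lambda>i. d i - c i) i = 0"
      proof (rule eigenvectors_sum_zero[OF lin primitive_root_inj_on[OF prim] _ _ True])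
        show "d k - c k \<in> eigenspace sc \<theta> (\<zeta> ^ k)" if "k < m" for k
          using d c(1)[OF that] that
          by (simp add: eigenspace_def L.diff L.vs1.scale_right_diff_distrib)
        show "(\<Sum>k<m. d k - c k) = 0" using d by (simp add: sum_subtractf)
      qed
      then show ?thesis by simp
    qed (use d c in auto)
  qed
qed (use c in auto)

lemma contraction_homogeneous:
  assumes lie: "lie_algebra sc br"
    and lin: "Vector_Spaces.linear sc sc \<theta>" and prim: "primitive_root_of_unity m \<zeta>"
    and ij: "i \<le> m - 1" "j \<le> m - 1"
    and xy: "x \<in> eigenspace sc \<theta> (\<zeta> ^ i)" "y \<in> eigenspace sc \<theta> (\<zeta> ^ j)"
  shows "contraction sc br \<theta> m \<zeta> x y = (if i + j \<le> m - 1 then br x y else 0)"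
proof -
  interpret lie_algebra sc br by fact
  interpret L: Vector_Spaces.linear sc sc \<theta> by fact
  have m: "0 < m" using prim by (simp add: primitive_root_of_unity_def)
  have comp: "eigen_component sc \<theta> m \<zeta> v = (\<lambda>l. if l = k then v else 0)"
    if "k < m" "v \<in> eigenspace sc \<theta> (\<zeta> ^ k)" for k v
  proof -
    have "eigen_component sc \<theta> m \<zeta> (\<Sum>l<m. if l = k then v else 0) = (\<lambda>l. if l = k then v else 0)"
      by (rule eigen_component_unique[OF lin prim])
        (use that in \<open>auto simp: eigenspace_def L.zero\<close>)
    then show ?thesis using that by simp
  qed
  have br0: "br 0 u = 0" "br u 0 = 0" for u
    using br_scale_left[of 0 0 u] br_scale_right[of u 0 0] by simp_all
  have im: "i < m" "j < m" using ij m by auto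
  have "contraction sc br \<theta> m \<zeta> x y =
      (\<Sum>k<m. \<Sum>l<m. if k = i then (if l = j then (if i + j \<le> m - 1 then br x y else 0) else 0) else 0)"
    unfolding contraction_def comp[OF im(1) xy(1)] comp[OF im(2) xy(2)]
    by (intro sum.cong refl) (auto simp: br0)
  also have "\<dots> = (\<Sum>k<m. if k = i then (\<Sum>l<m. if l = j then (if i + j \<le> m - 1 then br x y else 0) else 0) else 0)"
    by (intro sum.cong refl) auto
  finally show ?thesis using im by simp
qed


section \<open>Kac labels of outer automorphisms\<close>

definition kac_labels :: "nat \<Rightarrow> (nat \<Rightarrow> nat) \<Rightarrow> bool" where
  "kac_labels r p \<longleftrightarrow> (\<exists>i\<in>{0..r}. p i \<noteq> 0) \<and> Gcd (p ` {0..r}) = 1"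

text \<open>The numbers $a'_i$, where $\delta = \sum_{i=1}^r a'_i \nu_i$ and $a'_0 = 1$.\<close>

definition kac_mark :: "nat \<Rightarrow> (nat \<Rightarrow> 'g \<Rightarrow> 'k::field) \<Rightarrow> ('g \<Rightarrow> 'k) \<Rightarrow> nat \<Rightarrow> int" where
  "kac_mark r \<nu> \<delta> i = (if i = 0 then 1 else root_coeff r \<nu> \<delta> i)"

definition kac_order ::
    "nat \<Rightarrow> nat \<Rightarrow> (nat \<Rightarrow> 'g \<Rightarrow> 'k::field) \<Rightarrow> ('g \<Rightarrow> 'k) \<Rightarrow> (nat \<Rightarrow> nat) \<Rightarrow> int" where
  "kac_order s r \<nu> \<delta> p = int s * (\<Sum>i=0..r. kac_mark r \<nu> \<delta> i * int (p i))"

definition kac_degree ::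
    "nat \<Rightarrow> (nat \<Rightarrow> 'g \<Rightarrow> 'k::field) \<Rightarrow> ('g \<Rightarrow> 'k) \<Rightarrow> (nat \<Rightarrow> nat) \<Rightarrow> nat \<Rightarrow> ('g \<Rightarrow> 'k) \<Rightarrow> int" where
  "kac_degree r \<nu> \<delta> p j \<gamma> =
     int j * int (p 0) +
     (\<Sum>i=1..r. root_coeff r \<nu> (\<lambda>h. \<gamma> h + of_nat j * \<delta> h) i * int (p i))"

text \<open>
  \<open>\<theta>\<close> is the automorphism with Kac labels \<open>p\<close>. Here \<open>V j\<close> (\<open>j < s\<close>) are the eigenspaces of
  the diagram automorphism, of order \<open>s\<close>, and \<open>t\<close> is the Cartan subalgebra of its fixed
  points. The exponents may be negative.
\<close>

definition is_kac_automorphism ::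
    "('k::field \<Rightarrow> 'g::ab_group_add \<Rightarrow> 'g) \<Rightarrow> ('g \<Rightarrow> 'g \<Rightarrow> 'g) \<Rightarrow> nat \<Rightarrow> (nat \<Rightarrow> 'g set) \<Rightarrow> 'g set
      \<Rightarrow> nat \<Rightarrow> (nat \<Rightarrow> 'g \<Rightarrow> 'k) \<Rightarrow> ('g \<Rightarrow> 'k) \<Rightarrow> (nat \<Rightarrow> nat) \<Rightarrow> 'k \<Rightarrow> ('g \<Rightarrow> 'g) \<Rightarrow> bool" where
  "is_kac_automorphism sc br s V t r \<nu> \<delta> p \<zeta> \<theta> \<longleftrightarrow>
     lie_automorphism sc br \<theta> \<and>
     (\<forall>j<s. \<forall>\<gamma>\<in>weights sc br (V j) t. \<forall>x\<in>weight_space sc br (V j) t \<gamma>.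
        \<theta> x = sc (\<zeta> powi kac_degree r \<nu> \<delta> p j \<gamma>) x)"

end

theory Submission
  imports Defs
begin

text \<open>
  A weight \<open>\<gamma>\<close> of \<open>g j\<close> has coordinates \<open>N\<close> with respect to the affine simple roots, namely \<open>j\<close> and the
  coefficients of \<open>\<gamma> + j \<delta>\<close>. Up to a multiple of the vector \<open>M\<close> of the imaginary root, which has
  pairing \<open>m\<close> with \<open>p\<close>, these satisfy \<open>0 \<le> N \<le> M\<close>. The exponent of the eigenvalue is then the pairing of
  \<open>N\<close> with \<open>p\<close>, unless this equals \<open>m\<close> and the exponent is \<open>0\<close>. For weight vectors with nonzero bracket the
  three coordinate vectors satisfy \<open>N'' = N + N' - k M\<close> with \<open>k\<close> independent of \<open>p\<close>. Whether the sum of the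
  two exponents exceeds \<open>m - 1\<close> thus depends on \<open>k\<close> and on whether \<open>M - N\<close>, \<open>M - N'\<close> and \<open>M - N''\<close> pair to zero with
  \<open>p\<close>. As these differences are nonnegative, only the support of \<open>p\<close> matters.

  The inequality \<open>0 \<le> N \<le> M\<close> rests on the lowest weight of \<open>g 1\<close>, on the duality between \<open>g j\<close> and
  \<open>g (s - j)\<close> under the Killing form, and on the fact that the centraliser in \<open>g 0\<close> of all other \<open>g j\<close>
  is an ideal. The Killing form is nondegenerate because its radical is an ideal that does not contain the
  coroots, whose adjoint action has integral eigenvalues.
\<close>

section \<open>Brackets, weights and traces\<close>

text \<open>How the ingredients of the inequality combine: let D be the coefficients of \<delta>.
  The lowest weight bounds the weights of \<open>gr 1\<close> from below by -D. Duality turns a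
  lower bound for \<open>gr (s - j)\<close> into an upper bound for \<open>gr j\<close>, so that for
  0 < j < s all weights of \<open>gr j\<close> lie between -jD and (s - j)D; for triality the lower
  bound -2D on \<open>gr 2\<close> takes an argument of its own. These intervals have length sD, and
  this is what the centraliser is for: a nonzero weight vector of \<open>gr 0\<close> acts
  nontrivially on some \<open>gr j\<close> with 0 < j < s, so its weight is a difference of two
  weights of that \<open>gr j\<close> and has size at most sD. To speak of coefficients at all, the
  given \<nu> must be recognised as the restrictions of the simple roots of the whole algebra, which
  is where the Borel subalgebra and the rank enter. For this, weights are handled as integer vectors
  on the vertices of the diagram. Restriction to \<open>ts\<close> is not injective on such vectors;
  the sums over the powers of the diagram symmetry are what it remembers.\<close>

context lie_algebra
begin

lemma br_zero [simp]: "br 0 x = 0" "br x 0 = 0"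
  using br_scale_left[of 0 0 x] br_scale_right[of x 0 0] by simp_all

lemma br_minus: "br (- x) y = - br x y" "br x (- y) = - br x y"
  using br_scale_left[of "- 1" x y] br_scale_right[of x "- 1" y] by simp_all

lemma br_diff: "br (x - y) z = br x z - br y z" "br x (y - z) = br x y - br x z"
  using br_add_left[of x "- y" z] br_add_right[of x y "- z"] by (simp_all add: br_minus)

lemma br_anticomm: "br y x = - br x y"
proof -
  have "br (x + y) (x + y) = br x x + br y x + (br x y + br y y)"
    by (simp only: br_add_left br_add_right)
  then have "br y x + br x y = 0" by (simp add: br_self)
  then show ?thesis by (simp only: eq_neg_iff_add_eq_0)
qed

lemma br_derivation: "br x (br y z) = br (br x y) z + br y (br x z)"
proof -
  have "br y (br z x) = - br y (br x z)" "br z (br x y) = - br (br x y) z"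
    by (simp_all add: br_anticomm[of z x] br_anticomm[of z "br x y"] br_minus)
  then show ?thesis using jacobi[of x y z] by (simp add: algebra_simps)
qed

lemma br_sum: "br (\<Sum>i\<in>A. u i) y = (\<Sum>i\<in>A. br (u i) y)" "br y (\<Sum>i\<in>A. u i) = (\<Sum>i\<in>A. br y (u i))"
  by (induction A rule: infinite_finite_induct) (simp_all add: br_add_left br_add_right)

lemma linear_ad: "Vector_Spaces.linear sc sc (br x)"
  by unfold_locales (simp_all add: br_add_right br_scale_right)

lemma linear_ad': "Vector_Spaces.linear sc sc (\<lambda>x. br x y)"
  by unfold_locales (simp_all add: br_add_left br_scale_left)

lemma linear_image_span:
  assumes "Vector_Spaces.linear sc sc T" "x \<in> span A" "\<And>a. a \<in> A \<Longrightarrow> T a \<in> S" "subspace S"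
  shows "T x \<in> S"
proof -
  interpret L: Vector_Spaces.linear sc sc T by fact
  show ?thesis
    using assms(2)
  proof (induction rule: span_induct_alt)
    case base
    then show ?case using assms(4) by (simp add: L.zero subspace_0)
  next
    case (step c x y)
    then show ?case using assms(3,4) by (simp add: L.add L.scale subspace_add subspace_scale)
  qed
qed

text \<open>A form of the Jacobi identity. It reduces stability of \<open>S\<close> under the whole
  algebra to stability under the Chevalley generators.\<close>

lemma normalizer_subalgebra:
  assumes S: "subspace S"
  shows "lie_subalgebra sc br {y. \<forall>x\<in>S. br y x \<in> S}"
proof -
  have "br (br y z) x = br y (br z x) - br z (br y x)" for x y z
    using br_derivation[of y z x] by simp
  then show ?thesis
    unfolding lie_subalgebra_def
    using S by (auto simp: subspace_def br_add_left br_scale_left subspace_diff[OF S])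
qed

end

text \<open>If \<open>T l\<close> has different eigenvalues on \<open>x k\<close> and
  \<open>x k0\<close>, then subtracting the eigenvalue \<open>w k0 l\<close> removes the summand
  \<open>x k0\<close> and multiplies \<open>x k\<close> by a nonzero scalar. Induction on the number
  of summands does the rest. For \<open>S = {0}\<close> this is the linear independence of weight
  vectors.\<close>

lemma (in vector_space) weight_components_in_subspace:
  assumes "finite K" and S: "subspace S"
    and T: "\<And>l. l \<in> L \<Longrightarrow> Vector_Spaces.linear scale scale (T l)"
    and stable: "\<And>l x. l \<in> L \<Longrightarrow> x \<in> S \<Longrightarrow> T l x \<in> S"
    and weight: "\<And>k l. k \<in> K \<Longrightarrow> l \<in> L \<Longrightarrow> T l (x k) = scale (w k l) (x k)"
    and separated: "\<And>k k'. k \<in> K \<Longrightarrow> k' \<in> K \<Longrightarrow> k \<noteq> k' \<Longrightarrow> \<exists>l\<in>L. w k l \<noteq> w k' l"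
    and sum: "(\<Sum>k\<in>K. x k) \<in> S" and "k \<in> K"
  shows "x k \<in> S"
  using assms(1) weight separated sum \<open>k \<in> K\<close>
proof (induction K arbitrary: x k rule: finite_induct)
  case empty
  then show ?case by simp
next
  case (insert k0 K)
  have *: "x k \<in> S" if k: "k \<in> K" for k
  proof -
    have "k \<noteq> k0" using insert.hyps k by auto
    then obtain l where l: "l \<in> L" "w k l \<noteq> w k0 l"
      using insert.prems(2)[of k k0] k by auto
    interpret L: Vector_Spaces.linear scale scale "T l" by (rule T[OF l(1)])
    let ?y = "\<lambda>k. scale (w k l - w k0 l) (x k)"
    have tl: "T l (x k) = scale (w k l) (x k)" if "k \<in> insert k0 K" for k
      using insert.prems(1)[OF that l(1)] .
    have "T l (\<Sum>k\<in>insert k0 K. x k) - scale (w k0 l) (\<Sum>k\<in>insert k0 K. x k)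
        = (\<Sum>k\<in>insert k0 K. ?y k)"
      unfolding L.sum scale_sum_right sum_subtractf[symmetric]
      by (rule sum.cong) (auto simp: tl scale_left_diff_distrib)
    also have "\<dots> = (\<Sum>k\<in>K. ?y k)" using insert.hyps by simp
    finally have "(\<Sum>k\<in>K. ?y k) \<in> S"
      using stable[OF l(1) insert.prems(3)] S insert.prems(3)
      by (metis subspace_diff subspace_scale)
    moreover have "T l' (?y k) = scale (w k l') (?y k)" if "k \<in> K" "l' \<in> L" for k l'
    proof -
      interpret L': Vector_Spaces.linear scale scale "T l'" by (rule T[OF that(2)])
      show ?thesis using insert.prems(1)[of k l'] that by (simp add: L'.scale mult.commute)
    qed
    ultimately have "?y k \<in> S"
      using insert.IH[of ?y k] insert.prems(2) k by blast
    then have "scale (inverse (w k l - w k0 l)) (?y k) \<in> S" using S by (rule subspace_scale[rotated])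
    then show ?thesis using l by simp
  qed
  have "x k0 = (\<Sum>k\<in>insert k0 K. x k) - (\<Sum>k\<in>K. x k)" using insert.hyps by simp
  also have "\<dots> \<in> S"
    by (rule subspace_diff[OF S insert.prems(3)]) (rule subspace_sum[OF S *])
  finally show ?case using * insert.prems(4) by auto
qed

section \<open>Traces with respect to a basis\<close>

definition trace_on ::
    "('k::field \<Rightarrow> 'g::ab_group_add \<Rightarrow> 'g) \<Rightarrow> 'g set \<Rightarrow> ('g \<Rightarrow> 'g) \<Rightarrow> 'k" where
  "trace_on sc B T = (\<Sum>b\<in>B. module.representation sc B (T b) b)"

context vector_space
begin

lemma trace_on_add:
  assumes "independent B" "span B = UNIV"
  shows "trace_on scale B (\<lambda>x. S x + T x) = trace_on scale B S + trace_on scale B T"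
  using assms by (simp add: trace_on_def representation_add sum.distrib)

lemma trace_on_scale:
  assumes "independent B" "span B = UNIV"
  shows "trace_on scale B (\<lambda>x. scale c (T x)) = c * trace_on scale B T"
  using assms by (simp add: trace_on_def representation_scale sum_distrib_left)

lemma trace_on_diff:
  assumes "independent B" "span B = UNIV"
  shows "trace_on scale B (\<lambda>x. S x - T x) = trace_on scale B S - trace_on scale B T"
  using assms by (simp add: trace_on_def representation_diff sum_subtractf)

text \<open>Symmetry, invariance and \<sigma>-invariance of the Killing form all come from this
  identity, within one fixed basis.\<close>

lemma trace_on_comp_commute:
  assumes B: "finite B" "independent B" "span B = UNIV"
    and "Vector_Spaces.linear scale scale S" "Vector_Spaces.linear scale scale T"
  shows "trace_on scale B (\<lambda>x. S (T x)) = trace_on scale B (\<lambda>x. T (S x))"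
proof -
  let ?R = "representation B"
  have R: "?R (S (T b)) b = (\<Sum>c\<in>B. ?R (T b) c * ?R (S c) b)"
    if S: "Vector_Spaces.linear scale scale S" for S T b
  proof -
    interpret L: Vector_Spaces.linear scale scale S by fact
    have "T b = (\<Sum>c\<in>B. scale (?R (T b) c) c)"
      using B by (simp add: sum_representation_eq)
    then have "S (T b) = (\<Sum>c\<in>B. scale (?R (T b) c) (S c))"
      by (metis (no_types, lifting) L.sum L.scale sum.cong)
    then show ?thesis using B by (simp add: representation_sum representation_scale)
  qed
  show ?thesis
    unfolding trace_on_def sum.cong[OF refl R[OF assms(4), of T]] sum.cong[OF refl R[OF assms(5), of S]]
    by (subst sum.swap) (simp add: mult.commute)
qed

lemma trace_on_diagonal:
  assumes "independent B" "\<And>b. b \<in> B \<Longrightarrow> T b = scale (d b) b"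
  shows "trace_on scale B T = (\<Sum>b\<in>B. d b)"
  unfolding trace_on_def
  by (rule sum.cong)
    (use assms in \<open>auto simp: representation_scale span_base representation_basis\<close>)

lemma span_UN_decompose:
  assumes "x \<in> span (\<Union>c. G c)"
  obtains C y where "finite C" "x = (\<Sum>c\<in>C. y c)" "\<And>c. y c \<in> span (G c)"
proof -
  have "\<exists>C y. finite C \<and> x = (\<Sum>c\<in>C. y c) \<and> (\<forall>c. y c \<in> span (G c))"
    using assms
  proof (induction rule: span_induct_alt)
    case base
    show ?case by (rule exI[of _ "{}"], rule exI[of _ "\<lambda>_. 0"]) (simp add: span_zero)
  next
    case (step a g z)
    then obtain C y c where *: "finite C" "z = (\<Sum>c\<in>C. y c)" "\<forall>c. y c \<in> span (G c)" "g \<in> G c"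
      by blast
    let ?y = "\<lambda>d. (if d = c then scale a g else 0) + (if d \<in> C then y d else 0)"
    have "(\<Sum>d\<in>insert c C. if d \<in> C then y d else 0) = (\<Sum>d\<in>C. y d)"
      using *(1) by (intro sum.mono_neutral_cong_right) auto
    then have "(\<Sum>d\<in>insert c C. ?y d) = scale a g + z"
      using * by (simp add: sum.distrib)
    moreover have "\<forall>d. ?y d \<in> span (G d)"
      using * by (auto intro: span_add span_scale span_base span_zero)
    ultimately show ?case using *(1) by (intro exI[of _ "insert c C"] exI[of _ ?y]) auto
  qed
  then show ?thesis using that by blast
qed

end

lemma sum_cyclic:
  fixes F :: "nat \<Rightarrow> 'x::ab_group_add"
  assumes "F n = F 0"
  shows "(\<Sum>k<n. F (Suc k)) = (\<Sum>k<n. F k)"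
proof -
  have "F 0 + (\<Sum>k<n. F (Suc k)) = (\<Sum>k<n. F k) + F n"
    using sum.lessThan_Suc_shift[of F n] sum.lessThan_Suc[of F n] by simp
  then show ?thesis using assms by (simp add: add.commute)
qed

section \<open>Symmetries of Dynkin diagrams\<close>

lemma cartan_matrix_sym: "cartan_matrix X i j = cartan_matrix X j i"
  by (simp add: cartan_matrix_def insert_commute)

lemma cartan_matrix_diag [simp]: "cartan_matrix X i i = 2"
  by (simp add: cartan_matrix_def)

lemma edge_A: "{i, j} \<in> dynkin_edges (Type_A n) \<longleftrightarrow>
    (1 \<le> i \<and> i < n \<and> j = i + 1) \<or> (1 \<le> j \<and> j < n \<and> i = j + 1)"
  by (auto simp: doubleton_eq_iff)

lemma edge_D: "{i, j} \<in> dynkin_edges (Type_D n) \<longleftrightarrow>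
    (i = n - 2 \<and> j = n) \<or> (j = n - 2 \<and> i = n) \<or>
    (1 \<le> i \<and> i < n - 1 \<and> j = i + 1) \<or> (1 \<le> j \<and> j < n - 1 \<and> i = j + 1)"
  by (auto simp: doubleton_eq_iff)

lemma edge_E6: "{i, j} \<in> dynkin_edges Type_E6 \<longleftrightarrow>
    (i, j) \<in> {(1,3),(3,4),(4,5),(5,6),(2,4),(3,1),(4,3),(5,4),(6,5),(4,2)}"
  by (auto simp: doubleton_eq_iff)

definition nbs :: "dynkin_type \<Rightarrow> nat \<Rightarrow> nat set" where
  "nbs X i = {j \<in> {1..dynkin_rank X}. j \<noteq> i \<and> {i, j} \<in> dynkin_edges X}"

lemma nbs_A:
  "2 \<le> n \<Longrightarrow> nbs (Type_A n) 1 = {2}"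
  "2 \<le> n \<Longrightarrow> nbs (Type_A n) n = {n - 1}"
  "2 \<le> k \<Longrightarrow> k < n \<Longrightarrow> nbs (Type_A n) k = {k - 1, k + 1}"
  unfolding nbs_def edge_A by auto

lemma nbs_D:
  "4 \<le> n \<Longrightarrow> nbs (Type_D n) 1 = {2}"
  "2 \<le> k \<Longrightarrow> k < n - 2 \<Longrightarrow> nbs (Type_D n) k = {k - 1, k + 1}"
  "4 \<le> n \<Longrightarrow> nbs (Type_D n) (n - 2) = {n - 3, n - 1, n}"
  "4 \<le> n \<Longrightarrow> nbs (Type_D n) (n - 1) = {n - 2}"
  "4 \<le> n \<Longrightarrow> nbs (Type_D n) n = {n - 2}"
  unfolding nbs_def edge_D by auto

lemma nbs_E6:
  "nbs Type_E6 1 = {3}" "nbs Type_E6 2 = {4}" "nbs Type_E6 3 = {1, 4}"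
  "nbs Type_E6 4 = {2, 3, 5}" "nbs Type_E6 5 = {4, 6}" "nbs Type_E6 6 = {5}"
  unfolding nbs_def edge_E6 by auto

lemma cartan_sum_nbs:
  fixes c :: "nat \<Rightarrow> 'k::field_char_0"
  assumes "i \<in> {1..dynkin_rank X}"
  shows "(\<Sum>j\<in>{1..dynkin_rank X}. of_int (cartan_matrix X i j) * c j) = 2 * c i - (\<Sum>j\<in>nbs X i. c j)"
proof -
  let ?I = "{1..dynkin_rank X}"
  have "(\<Sum>j\<in>?I. of_int (cartan_matrix X i j) * c j)
      = (\<Sum>j\<in>?I. (if j = i then 2 * c i else 0) - (if j \<in> nbs X i then c j else 0))"
    using assms by (intro sum.cong) (auto simp: cartan_matrix_def nbs_def)
  also have "\<dots> = 2 * c i - (\<Sum>j\<in>?I. if j \<in> nbs X i then c j else 0)"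
    using assms(1) by (simp add: sum_subtractf)
  also have "(\<Sum>j\<in>?I. if j \<in> nbs X i then c j else 0) = (\<Sum>j\<in>nbs X i. c j)"
    using assms by (intro sum.mono_neutral_cong_right) (auto simp: nbs_def)
  finally show ?thesis .
qed

text \<open>Along a chain that starts at a leaf, the kernel equations of the Cartan matrix say that
  second differences vanish and that the value before the leaf would be 0.\<close>

lemma arithmetic_progression:
  fixes c :: "nat \<Rightarrow> 'k::field_char_0"
  assumes "c 2 = 2 * c 1" "\<And>k. 2 \<le> k \<Longrightarrow> k < N \<Longrightarrow> 2 * c k = c (k - 1) + c (k + 1)"
    and "1 \<le> k" "k \<le> N"
  shows "c k = of_nat k * c 1"
  using assms(3,4)
proof (induction k rule: less_induct)
  case (less k)
  consider "k = 1" | "k = 2" | "3 \<le> k" using less.prems by linarith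
  then show ?case
  proof cases
    case 3
    then have "c k = 2 * c (k - 1) - c (k - 2)"
      using assms(2)[of "k - 1"] less.prems by (simp add: numeral_2_eq_2)
    moreover have "c (k - 1) = of_nat (k - 1) * c 1" "c (k - 2) = of_nat (k - 2) * c 1"
      using less.IH[of "k - 1"] less.IH[of "k - 2"] less.prems 3 by auto
    ultimately have "c k = 2 * (of_nat (k - 1) * c 1) - of_nat (k - 2) * c 1" by simp
    also have "\<dots> = of_nat k * c 1" using 3 by (simp add: of_nat_diff algebra_simps)
    finally show ?thesis .
  qed (use assms(1) in auto)
qed

text \<open>The equations along a chain express every entry through the one at its leaf. The
  equation at the far end, or at the branch vertex, then forces a nonzero integral multiple of that
  entry to vanish. As a result a weight is determined by its values on the simple coroots.\<close>

lemma cartan_matrix_nonsingular: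
  fixes c :: "nat \<Rightarrow> 'k::field_char_0"
  assumes X: "outer_type X"
    and c: "\<And>i. i \<in> {1..dynkin_rank X} \<Longrightarrow>
      (\<Sum>j\<in>{1..dynkin_rank X}. of_int (cartan_matrix X i j) * c j) = 0"
    and i: "i \<in> {1..dynkin_rank X}"
  shows "c i = 0"
proof -
  have eq: "2 * c i = (\<Sum>j\<in>nbs X i. c j)" if "i \<in> {1..dynkin_rank X}" for i
    using cartan_sum_nbs[OF that, of c] c[OF that] by simp
  show ?thesis
  proof (cases X)
    case [simp]: (Type_A n)
    have n: "2 \<le> n" using X by simp
    have 1: "2 * c 1 = c 2" using eq[of 1] n nbs_A(1) by simp
    have 2: "2 * c k = c (k - 1) + c (k + 1)" if "2 \<le> k" "k < n" for k
      using eq[of k] that nbs_A(3) by simp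
    have 3: "2 * c n = c (n - 1)" using eq[of n] n nbs_A(2) by simp
    have k: "c k = of_nat k * c 1" if "1 \<le> k" "k \<le> n" for k
      by (rule arithmetic_progression[of c n]) (use 1 2 that in auto)
    have "2 * (of_nat n * c 1) = of_nat (n - 1) * c 1"
      using 3 k[of n] k[of "n - 1"] n by simp
    \<comment> \<open>The factor \<open>n + 1\<close> is the determinant of the Cartan
      matrix.\<close>
    then have "of_nat (n + 1) * c 1 = 0"
      using n by (simp add: of_nat_diff algebra_simps)
    then have "c 1 = 0"
      by (metis mult_eq_0_iff of_nat_eq_0_iff Suc_eq_plus1 nat.distinct(2))
    then show ?thesis using k i by simp
  next
    case [simp]: (Type_D n)
    have n: "4 \<le> n" using X by simp
    have 1: "2 * c 1 = c 2" using eq[of 1] n nbs_D(1) by simp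
    have 2: "2 * c k = c (k - 1) + c (k + 1)" if "2 \<le> k" "k < n - 2" for k
      using eq[of k] that nbs_D(2) by simp
    have 3: "2 * c n = c (n - 2)" using eq[of n] n nbs_D(5) by simp
    have 4: "2 * c (n - 1) = c (n - 2)" using eq[of "n - 1"] n nbs_D(4) by simp
    have "n - 3 \<noteq> n - 1" "n - 3 \<noteq> n" "n - 1 \<noteq> n" using n by auto
    then have 5: "2 * c (n - 2) = c (n - 3) + (c (n - 1) + c n)"
      using eq[of "n - 2"] n nbs_D(3) by simp
    have k: "c k = of_nat k * c 1" if "1 \<le> k" "k \<le> n - 2" for k
      by (rule arithmetic_progression[of c "n - 2"]) (use 1 2 that in auto)
    \<comment> \<open>Each of the two leaves carries half the value at the branch vertex, so the
      progression is constant in its last step and its difference \<open>c 1\<close> is 0.\<close>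
    have "2 * (2 * c (n - 2)) = 2 * c (n - 3) + 2 * c (n - 2)"
      using 3 4 5 by (simp add: algebra_simps)
    then have "c (n - 2) = c (n - 3)" by simp
    then have "of_nat (n - 2) * c 1 = of_nat (n - 3) * c 1"
      using k[of "n - 2"] k[of "n - 3"] n by simp
    then have c1: "c 1 = 0" using n by (simp add: of_nat_diff algebra_simps)
    consider "i \<le> n - 2" | "i = n - 1" | "i = n" using i by fastforce
    then show ?thesis using k[of i] k[of "n - 2"] c1 i 3 4 n by cases auto
  next
    case [simp]: Type_E6
    have N: "2 * c 1 = c 3" "2 * c 2 = c 4" "2 * c 3 = c 1 + c 4" "2 * c 4 = c 2 + (c 3 + c 5)"
        "2 * c 5 = c 4 + c 6" "2 * c 6 = c 5"
      using eq[of 1] eq[of 2] eq[of 3] eq[of 4] eq[of 5] eq[of 6]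
      by (simp_all add: nbs_E6 del: One_nat_def)
    have c4: "c 4 = 3 * c 1" using N(3) by (simp add: algebra_simps flip: N(1))
    have "c 4 = 3 * c 6" using N(5) by (simp add: algebra_simps flip: N(6))
    with c4 have c6: "c 6 = c 1" by simp
    have "c 2 = 2 * c 1" using N(4) c6 c4 by (simp add: algebra_simps flip: N(1) N(6))
    with N(2) c4 have c1: "c 1 = 0" by (simp add: algebra_simps)
    with N c4 c6 have "c 2 = 0" "c 3 = 0" "c 4 = 0" "c 5 = 0" "c 6 = 0" by simp_all
    moreover have "i \<in> {1,2,3,4,5,6}" using i by auto
    ultimately show ?thesis using c1 by auto
  qed
qed

section \<open>Orders of diagram symmetries\<close>

lemma diagram_symmetry_nbs:
  assumes "diagram_symmetry X \<pi>" "i \<in> {1..dynkin_rank X}"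
  shows "nbs X (\<pi> i) = \<pi> ` nbs X i"
proof -
  let ?I = "{1..dynkin_rank X}"
  have p: "\<pi> permutes ?I" using assms(1) by (simp add: diagram_symmetry_def)
  have iff: "\<pi> j \<in> nbs X (\<pi> i) \<longleftrightarrow> j \<in> nbs X i" if "j \<in> ?I" for j
  proof -
    have "cartan_matrix X (\<pi> i) (\<pi> j) = cartan_matrix X i j"
      using assms that by (simp add: diagram_symmetry_def)
    moreover have "\<pi> i = \<pi> j \<longleftrightarrow> i = j" using p by (metis permutes_def)
    ultimately show ?thesis
      using that permutes_in_image[OF p, of j] unfolding nbs_def cartan_matrix_def
      by (auto split: if_splits)
  qed
  have "x \<in> \<pi> ` nbs X i" if "x \<in> nbs X (\<pi> i)" for x
  proof -
    have "x \<in> ?I" using that by (simp add: nbs_def)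
    then obtain j where "j \<in> ?I" "x = \<pi> j" using permutes_image[OF p] by blast
    then show ?thesis using iff that by auto
  qed
  moreover have "nbs X i \<subseteq> ?I" by (auto simp: nbs_def)
  ultimately show ?thesis using iff by blast
qed

lemma diagram_symmetry_card_nbs:
  assumes "diagram_symmetry X \<pi>" "i \<in> {1..dynkin_rank X}"
  shows "card (nbs X (\<pi> i)) = card (nbs X i)"
proof -
  have "inj \<pi>" using assms(1) by (auto simp: diagram_symmetry_def permutes_inj)
  then show ?thesis
    unfolding diagram_symmetry_nbs[OF assms] by (simp add: card_image inj_on_subset)
qed

lemma diagram_symmetry_comp:
  assumes "diagram_symmetry X \<pi>" "diagram_symmetry X \<rho>"
  shows "diagram_symmetry X (\<pi> \<circ> \<rho>)"
proof -
  have "\<rho> i \<in> {1..dynkin_rank X}" if "i \<in> {1..dynkin_rank X}" for i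
    using assms(2) that by (simp add: diagram_symmetry_def permutes_in_image del: atLeastAtMost_iff)
  then show ?thesis
    using assms unfolding diagram_symmetry_def
    by (simp add: permutes_compose del: atLeastAtMost_iff)
qed

text \<open>A symmetry permutes the neighbours of a fixed vertex. Along a chain, being fixed thus
  passes on from two adjacent vertices to the next one.\<close>

lemma diagram_symmetry_propagates:
  assumes "diagram_symmetry X \<pi>" "i \<in> {1..dynkin_rank X}" "\<pi> i = i" "nbs X i = {j, k}" "\<pi> j = j"
  shows "\<pi> k = k"
proof (cases "k = j")
  case False
  have "inj \<pi>" using assms(1) by (auto simp: diagram_symmetry_def permutes_inj)
  then have "\<pi> k \<noteq> j" using False assms(5) by (metis injD)
  moreover have "\<pi> k \<in> {j, k}"
  proof -
    have "\<pi> k \<in> nbs X (\<pi> i)"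
      unfolding diagram_symmetry_nbs[OF assms(1,2)] by (rule imageI) (simp add: assms(4))
    then show ?thesis by (simp only: assms(3,4))
  qed
  ultimately show ?thesis by simp
qed (use assms(5) in simp)

text \<open>Valences are preserved, which pins down the ends of a chain as a set and each branch
  vertex as a point. From there \<open>diagram_symmetry_propagates\<close> reaches further vertices;
  it is often applied to the square of \<open>\<pi>\<close>, since \<open>\<pi>\<close> itself may
  interchange two legs. Three legs of equal length occur only for D4.\<close>

lemma diagram_symmetry_order:
  assumes X: "outer_type X" and sym: "diagram_symmetry X \<pi>"
  shows "(\<forall>i. \<pi> (\<pi> i) = i) \<or>
    (X = Type_D 4 \<and> \<pi> 2 = 2 \<and> \<pi> 1 \<noteq> 1 \<and> \<pi> 3 \<noteq> 3 \<and> \<pi> 4 \<noteq> 4 \<and> (\<forall>i. \<pi> (\<pi> (\<pi> i)) = i))"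
proof -
  let ?I = "{1..dynkin_rank X}"
  have p: "\<pi> permutes ?I" using sym by (simp add: diagram_symmetry_def)
  have out: "\<pi> i = i" if "i \<notin> ?I" for i using p that by (simp add: permutes_not_in)
  have I: "\<pi> i \<in> ?I \<longleftrightarrow> i \<in> ?I" for i using permutes_in_image[OF p] .
  have inj: "\<pi> i = \<pi> j \<longleftrightarrow> i = j" for i j using p by (metis permutes_def)
  have nb: "\<pi> j \<in> nbs X (\<pi> i)" if "i \<in> ?I" "j \<in> nbs X i" for i j
    using diagram_symmetry_nbs[OF sym that(1)] that(2) by simp
  have cd: "card (nbs X (\<pi> i)) = card (nbs X i)" if "i \<in> ?I" for i
    by (rule diagram_symmetry_card_nbs[OF sym that])
  have sym2: "diagram_symmetry X (\<lambda>i. \<pi> (\<pi> i))"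
    using diagram_symmetry_comp[OF sym sym] by (simp add: comp_def)
  show ?thesis
  proof (cases X)
    case [simp]: (Type_A n)
    have n: "2 \<le> n" using X by simp
    have ends: "\<pi> i \<in> {1, n}" if "i \<in> {1, n}" for i
    proof (rule ccontr)
      assume "\<pi> i \<notin> {1, n}"
      moreover have "\<pi> i \<in> ?I" using I[of i] that n by auto
      ultimately have "card (nbs X (\<pi> i)) = 2" using nbs_A(3)[of "\<pi> i" n] by auto
      moreover have "card (nbs X i) = 1" using that nbs_A(1,2) n by auto
      ultimately show False using cd[of i] that n by auto
    qed
    have 1: "\<pi> (\<pi> 1) = 1"
      using ends[of 1] ends[of n] inj[of 1 n] inj[of "\<pi> 1" 1] n by auto
    \<comment> \<open>The square of \<open>\<pi>\<close> fixes \<open>1\<close> and hence its only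
      neighbour.\<close>
    have 2: "\<pi> (\<pi> 2) = 2"
      by (rule diagram_symmetry_propagates[OF sym2, of 1 2]) (use 1 n nbs_A(1) nb[of "\<pi> 1" "\<pi> 2"] nb[of 1 2] I[of 1] in auto)
    have "\<pi> (\<pi> k) = k" if "1 \<le> k" "k \<le> n" for k
      using that
    proof (induction k rule: less_induct)
      case (less k)
      show ?case
      proof (cases "k \<le> 2")
        case True
        then have "k = 1 \<or> k = 2" using less.prems by auto
        then show ?thesis using 1 2 by auto
      next
        case False
        show ?thesis
          by (rule diagram_symmetry_propagates[OF sym2, of "k - 1" "k - 2"])
            (use less False nbs_A(3)[of "k - 1" n] in auto)
      qed
    qed
    then have "\<pi> (\<pi> i) = i" for i using out[of i] by (cases "i \<in> ?I") auto
    then show ?thesis by blast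
  next
    case [simp]: (Type_D n)
    have n: "4 \<le> n" using X by simp
    \<comment> \<open>This is the only vertex of valence 3.\<close>
    have br: "\<pi> (n - 2) = n - 2"
    proof (rule ccontr)
      assume *: "\<pi> (n - 2) \<noteq> n - 2"
      have "\<pi> (n - 2) \<in> ?I" using I[of "n - 2"] n by auto
      then have "1 \<le> \<pi> (n - 2)" "\<pi> (n - 2) \<le> n" by auto
      then consider "\<pi> (n - 2) = 1" | "2 \<le> \<pi> (n - 2)" "\<pi> (n - 2) < n - 2" | "\<pi> (n - 2) = n - 1" | "\<pi> (n - 2) = n"
        using * by linarith
      then have "card (nbs X (\<pi> (n - 2))) \<le> 2"
        using nbs_D(1,2,4,5) n by cases (auto simp: card_insert_if)
      moreover have "card (nbs X (n - 2)) = 3" using nbs_D(3) n by (auto simp: card_insert_if)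
      moreover have "n - 2 \<in> ?I" using n by auto
      ultimately show False using cd[of "n - 2"] by auto
    qed
    have perm: "\<pi> i \<in> {n - 3, n - 1, n}" if "i \<in> {n - 3, n - 1, n}" for i
      using nb[of "n - 2" i] that br nbs_D(3) n by auto
    show ?thesis
    proof (cases "n = 4")
      case [simp]: True
      have P: "\<pi> 1 \<in> {1,3,4}" "\<pi> 3 \<in> {1,3,4}" "\<pi> 4 \<in> {1,3,4}" "\<pi> 2 = 2"
        using perm[of 1] perm[of 3] perm[of 4] br by auto
      have four: "i = 1 \<or> i = 2 \<or> i = 3 \<or> i = 4 \<or> \<pi> i = i" for i
      proof -
        have "i = 1 \<or> i = 2 \<or> i = 3 \<or> i = 4" if "1 \<le> i" "i \<le> 4" using that by linarith
        then show ?thesis using out[of i] by auto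
      qed
      \<comment> \<open>The two 3-cycles of the leaves in this list are the triality symmetries; the
        other four permutations are involutions or trivial.\<close>
      have "(\<pi> 1, \<pi> 3, \<pi> 4) \<in> {(1,3,4),(1,4,3),(3,1,4),(3,4,1),(4,1,3),(4,3,1)}"
      proof -
        have "\<pi> 1 \<noteq> \<pi> 3" "\<pi> 1 \<noteq> \<pi> 4" "\<pi> 3 \<noteq> \<pi> 4" using inj by simp_all
        with P(1-3) show ?thesis by (elim insertE emptyE) (simp_all del: One_nat_def)
      qed
      then consider
          "\<pi> (\<pi> 1) = 1 \<and> \<pi> (\<pi> 2) = 2 \<and> \<pi> (\<pi> 3) = 3 \<and> \<pi> (\<pi> 4) = 4"
        | "\<pi> 1 \<noteq> 1 \<and> \<pi> 3 \<noteq> 3 \<and> \<pi> 4 \<noteq> 4"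
          "\<pi> (\<pi> (\<pi> 1)) = 1 \<and> \<pi> (\<pi> (\<pi> 2)) = 2 \<and> \<pi> (\<pi> (\<pi> 3)) = 3 \<and> \<pi> (\<pi> (\<pi> 4)) = 4"
        using P(4) by (elim insertE) (simp_all del: One_nat_def)
      then show ?thesis
      proof cases
        case 1
        have "\<pi> (\<pi> i) = i" for i using four[of i] by (elim disjE) (use 1 in simp_all)
        then show ?thesis by blast
      next
        case 2
        have "\<pi> (\<pi> (\<pi> i)) = i" for i using four[of i] by (elim disjE) (use 2 in simp_all)
        with 2(1) P(4) show ?thesis by simp
      qed
    next
      case False
      then have n5: "5 \<le> n" using n by simp
      have 3: "\<pi> (n - 3) = n - 3"
      proof (rule ccontr)
        assume "\<pi> (n - 3) \<noteq> n - 3"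
        then have "\<pi> (n - 3) \<in> {n - 1, n}" using perm[of "n - 3"] by auto
        then have "card (nbs X (\<pi> (n - 3))) = 1" using nbs_D(4,5) n by auto
        moreover have "card (nbs X (n - 3)) = 2" using nbs_D(2)[of "n - 3" n] n5 by auto
        moreover have "n - 3 \<in> ?I" using n5 by auto
        ultimately show False using cd[of "n - 3"] by simp
      qed
      \<comment> \<open>Descent along the chain, starting from the edge that joins
        \<open>n - 3\<close> to the branch vertex.\<close>
      have *: "\<pi> k = k \<and> \<pi> (Suc k) = Suc k" if "k \<le> n - 3" "1 \<le> k" for k
        using that(1)
      proof (induction rule: inc_induct)
        case base
        have "Suc (n - 3) = n - 2" using n5 by simp
        then show ?case using br 3 by simp
      next
        case (step m)
        have m: "1 \<le> m" "m < n - 3" using step that by simp_all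
        then have "nbs X (Suc m) = {Suc (Suc m), m}"
          using nbs_D(2)[of "Suc m" n] by (simp add: insert_commute)
        moreover have "Suc m \<in> ?I" using m by simp
        ultimately have "\<pi> m = m"
          using step.IH by (metis diagram_symmetry_propagates[OF sym])
        then show ?case using step.IH by simp
      qed
      have fixed: "\<pi> k = k" if "1 \<le> k" "k \<le> n - 2" for k
      proof (cases "k = n - 2")
        case False
        then have "k \<le> n - 3" using that by simp
        then show ?thesis using * that by blast
      qed (use br in simp)
      have last: "\<pi> i \<in> {n - 1, n}" if "i \<in> {n - 1, n}" for i
        using perm[of i] that 3 inj[of i "n - 3"] n by auto
      have l2: "\<pi> (\<pi> i) = i" if "i \<in> {n - 1, n}" for i
        using that last[of "n - 1"] last[of n] inj[of "n - 1" n] n by auto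
      have "\<pi> (\<pi> i) = i" for i
      proof -
        have "1 \<le> i \<and> i \<le> n - 2 \<or> i = n - 1 \<or> i = n" if "1 \<le> i" "i \<le> n" using that by linarith
        then consider "i \<notin> ?I" | "1 \<le> i" "i \<le> n - 2" | "i \<in> {n - 1, n}" by auto
        then show ?thesis
        proof cases
          case 2
          then show ?thesis using fixed by simp
        qed (use out[of i] l2 in auto)
      qed
      then show ?thesis by blast
    qed
  next
    case [simp]: Type_E6
    have six: "i = 1 \<or> i = 2 \<or> i = 3 \<or> i = 4 \<or> i = 5 \<or> i = 6" if "i \<in> ?I" for i
    proof -
      have "1 \<le> i" "i \<le> 6" using that by simp_all
      then show ?thesis by linarith
    qed
    have c: "card (nbs X 1) = 1" "card (nbs X 2) = 1" "card (nbs X 3) = 2"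
        "card (nbs X 4) = 3" "card (nbs X 5) = 2" "card (nbs X 6) = 1"
      by (simp_all add: nbs_E6 del: One_nat_def)
    have deg3: "x = 4" if "x \<in> ?I" "card (nbs X x) = 3" for x
      using six[OF that(1)] that(2) c by (elim disjE) (simp_all del: One_nat_def)
    have deg2: "x = 3 \<or> x = 5" if "x \<in> ?I" "card (nbs X x) = 2" for x
      using six[OF that(1)] that(2) c by (elim disjE) (simp_all del: One_nat_def)
    have 4: "\<pi> 4 = 4" using deg3[of "\<pi> 4"] I[of 4] cd[of 4] c by simp
    have 35: "\<pi> 3 = 3 \<or> \<pi> 3 = 5" "\<pi> 5 = 3 \<or> \<pi> 5 = 5"
      using deg2[of "\<pi> 3"] I[of 3] cd[of 3] deg2[of "\<pi> 5"] I[of 5] cd[of 5] c by simp_all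
    \<comment> \<open>Of the neighbours \<open>2\<close>, \<open>3\<close>, \<open>5\<close> of the
      fixed vertex \<open>4\<close> only \<open>2\<close> is a leaf.\<close>
    have 2: "\<pi> 2 = 2"
    proof -
      have "\<pi> 2 \<in> {2, 3, 5}" using nb[of 4 2] 4 by (simp add: nbs_E6)
      moreover have "card (nbs X (\<pi> 2)) = 1" using cd[of 2] c by simp
      ultimately show ?thesis using c by (elim insertE emptyE) (simp_all del: One_nat_def)
    qed
    have "\<pi> 3 \<noteq> \<pi> 5" using inj by simp
    with 35 have 3: "\<pi> (\<pi> 3) = 3" "\<pi> (\<pi> 5) = 5" by (elim disjE; simp)+
    have 1: "\<pi> (\<pi> 1) = 1"
      by (rule diagram_symmetry_propagates[OF sym2, of 3 4]) (simp_all add: 3 4 nbs_E6 insert_commute)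
    have 6: "\<pi> (\<pi> 6) = 6"
      by (rule diagram_symmetry_propagates[OF sym2, of 5 4]) (simp_all add: 3 4 nbs_E6)
    have "\<pi> (\<pi> i) = i" for i
    proof (cases "i \<in> ?I")
      case True
      from six[OF this] show ?thesis
        by (elim disjE) (simp_all only: 1 2 3 4 6)
    next
      case False
      then show ?thesis using out[of i] by simp
    qed
    then show ?thesis by simp
  qed
qed

section \<open>Triangular decomposition\<close>

locale chevalley_algebra = lie_algebra sc br
  for sc :: "'k::field_char_0 \<Rightarrow> 'g::ab_group_add \<Rightarrow> 'g" and br :: "'g \<Rightarrow> 'g \<Rightarrow> 'g" +
  fixes t b :: "'g set" and X :: dynkin_type
    and \<alpha> :: "nat \<Rightarrow> 'g \<Rightarrow> 'k" and e f :: "nat \<Rightarrow> 'g"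
  assumes simple: "simple_lie_algebra sc br"
    and borel: "borel_subalgebra sc br b"
    and cartan: "cartan_subalgebra sc br t"
    and t_subset_b: "t \<subseteq> b"
    and outer: "outer_type X"
    and chevalley: "chevalley_generators sc br t b X \<alpha> e f"
begin

definition I :: "nat set" where "I = {1..dynkin_rank X}"

lemma finite_I [simp]: "finite I"
  by (simp add: I_def)

abbreviation a :: "nat \<Rightarrow> nat \<Rightarrow> int" where "a \<equiv> cartan_matrix X"

definition hh :: "nat \<Rightarrow> 'g" where "hh i = br (e i) (f i)"

lemma subspace_t: "subspace t"
  using cartan by (simp add: cartan_subalgebra_def nilpotent_subalgebra_def lie_subalgebra_def)

lemma subalgebra_b: "lie_subalgebra sc br b"
  using borel by (simp add: borel_subalgebra_def solvable_subalgebra_def)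

lemma subspace_b: "subspace b"
  using subalgebra_b by (simp add: lie_subalgebra_def)

lemma br_in_b: "x \<in> b \<Longrightarrow> y \<in> b \<Longrightarrow> br x y \<in> b"
  using subalgebra_b by (simp add: lie_subalgebra_def)

lemma ideal_trivial: "lie_ideal sc br J \<Longrightarrow> J = {0} \<or> J = UNIV"
  using simple by (simp add: simple_lie_algebra_def)

lemma simple_root: "i \<in> I \<Longrightarrow> \<alpha> i \<in> simple_roots sc br UNIV t b"
  using chevalley by (auto simp: chevalley_generators_def bij_betw_def I_def)

lemma alpha_dual: "i \<in> I \<Longrightarrow> \<alpha> i \<in> dual_on sc t"
  using simple_root by (auto simp: simple_roots_def positive_roots_def roots_def weights_def)

lemma alpha_add: "i \<in> I \<Longrightarrow> x \<in> t \<Longrightarrow> y \<in> t \<Longrightarrow> \<alpha> i (x + y) = \<alpha> i x + \<alpha> i y"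
  using alpha_dual by (auto simp: dual_on_def)

lemma alpha_scale: "i \<in> I \<Longrightarrow> x \<in> t \<Longrightarrow> \<alpha> i (sc c x) = c * \<alpha> i x"
  using alpha_dual by (auto simp: dual_on_def)

lemma simple_weight_space_b: "i \<in> I \<Longrightarrow> weight_space sc br UNIV t (\<alpha> i) \<subseteq> b"
  using simple_root by (auto simp: simple_roots_def positive_roots_def)

lemma e_weight: "i \<in> I \<Longrightarrow> h \<in> t \<Longrightarrow> br h (e i) = sc (\<alpha> i h) (e i)"
  and f_weight: "i \<in> I \<Longrightarrow> h \<in> t \<Longrightarrow> br h (f i) = sc (- \<alpha> i h) (f i)"
  and hh_in_t: "i \<in> I \<Longrightarrow> hh i \<in> t"
  and alpha_hh: "i \<in> I \<Longrightarrow> j \<in> I \<Longrightarrow> \<alpha> j (hh i) = of_int (a i j)"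
  and e_f_zero: "i \<in> I \<Longrightarrow> j \<in> I \<Longrightarrow> i \<noteq> j \<Longrightarrow> br (e i) (f j) = 0"
  and generated: "lie_subalgebra sc br S \<Longrightarrow> e ` I \<union> f ` I \<subseteq> S \<Longrightarrow> S = UNIV"
  using chevalley unfolding chevalley_generators_def hh_def weight_space_def I_def by blast+

lemma e_in_b: "i \<in> I \<Longrightarrow> e i \<in> b"
  using simple_weight_space_b[of i] e_weight[of i] by (auto simp: weight_space_def)

lemma I_nonempty: "1 \<in> I"
  unfolding I_def using outer by (cases X) auto

lemma hh_nonzero: "i \<in> I \<Longrightarrow> hh i \<noteq> 0"
proof
  assume i: "i \<in> I" "hh i = 0"
  have "\<alpha> i (hh i) = 0"
    using alpha_scale[OF i(1) subspace_0[OF subspace_t], of 0] i by simp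
  then show False using alpha_hh[of i i] i by simp
qed

lemma e_nonzero: "i \<in> I \<Longrightarrow> e i \<noteq> 0" and f_nonzero: "i \<in> I \<Longrightarrow> f i \<noteq> 0"
  using hh_nonzero[of i] by (auto simp: hh_def)

lemma t_hh_commute: "i \<in> I \<Longrightarrow> h \<in> t \<Longrightarrow> br h (hh i) = 0"
  using br_derivation[of h "e i" "f i"]
  by (simp add: hh_def e_weight f_weight br_scale_left br_scale_right br_minus flip: scale_left_distrib)

section \<open>Weights as integer vectors on the diagram\<close>

definition wt :: "(nat \<Rightarrow> int) \<Rightarrow> 'g \<Rightarrow> 'k" where
  "wt c h = (\<Sum>i\<in>I. of_int (c i) * \<alpha> i h)"

text \<open>Indexing by integer vectors instead of functionals makes signs and heights of weights
  directly visible. Entries outside \<open>I\<close> do not affect \<open>W c\<close>; where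
  uniqueness of \<open>c\<close> matters they are required to be 0.\<close>

definition W :: "(nat \<Rightarrow> int) \<Rightarrow> 'g set" where
  "W c = {x. \<forall>h\<in>t. br h x = sc (wt c h) x}"

definition unit :: "nat \<Rightarrow> nat \<Rightarrow> int" where
  "unit i j = (if j = i then 1 else 0)"

lemma wt_add: "wt (\<lambda>j. c j + d j) h = wt c h + wt d h"
  by (simp add: wt_def sum.distrib algebra_simps)

lemma wt_minus: "wt (\<lambda>j. - c j) h = - wt c h"
  by (simp add: wt_def sum_negf)

lemma wt_zero [simp]: "wt (\<lambda>_. 0) h = 0"
  by (simp add: wt_def)

lemma wt_unit: assumes "i \<in> I" shows "wt (unit i) h = \<alpha> i h"
proof -
  have "wt (unit i) h = (\<Sum>j\<in>I. if j = i then \<alpha> i h else 0)"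
    unfolding wt_def by (rule sum.cong) (auto simp: unit_def)
  then show ?thesis using assms by simp
qed

lemma wt_linear_add: "x \<in> t \<Longrightarrow> y \<in> t \<Longrightarrow> wt c (x + y) = wt c x + wt c y"
  by (simp add: wt_def alpha_add algebra_simps sum.distrib)

lemma wt_linear_scale: "x \<in> t \<Longrightarrow> wt c (sc s x) = s * wt c x"
  by (simp add: wt_def alpha_scale algebra_simps sum_distrib_left)

lemma wt_hh: "i \<in> I \<Longrightarrow> wt c (hh i) = of_int (\<Sum>j\<in>I. a i j * c j)"
  by (simp add: wt_def alpha_hh mult.commute)

lemma wt_inj:
  assumes "\<And>i. i \<in> I \<Longrightarrow> wt c (hh i) = wt d (hh i)" "i \<in> I"
  shows "c i = d i"
proof -
  have "of_int (c i - d i) = (0::'k)"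
  proof (rule cartan_matrix_nonsingular[OF outer _ assms(2)[unfolded I_def],
        where c = "\<lambda>j. of_int (c j - d j)", folded I_def])
    fix i assume i: "i \<in> I"
    have "(\<Sum>j\<in>I. of_int (a i j) * of_int (c j - d j)) = wt c (hh i) - wt d (hh i)"
      using i by (simp add: wt_hh sum_subtractf algebra_simps)
    then show "(\<Sum>j\<in>I. of_int (a i j) * of_int (c j - d j)) = (0::'k)"
      using assms(1)[OF i] by simp
  qed
  then show ?thesis by simp
qed

lemma wt_eq_imp_eq:
  assumes "\<And>h. h \<in> t \<Longrightarrow> wt c h = wt d h" "\<And>j. j \<notin> I \<Longrightarrow> c j = 0" "\<And>j. j \<notin> I \<Longrightarrow> d j = 0"
  shows "c = d"
proof
  fix j
  show "c j = d j"
    using wt_inj[of c d j] assms hh_in_t by (cases "j \<in> I") auto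
qed

lemma subspace_W: "subspace (W c)"
  by (auto simp: subspace_def W_def br_add_right br_scale_right scale_right_distrib mult.commute)

lemma W_br: "x \<in> W c \<Longrightarrow> y \<in> W d \<Longrightarrow> br x y \<in> W (\<lambda>j. c j + d j)"
  by (auto simp: W_def wt_add br_derivation[of _ x y] br_scale_left br_scale_right scale_left_distrib)

lemma e_W: "i \<in> I \<Longrightarrow> e i \<in> W (unit i)"
  by (simp add: W_def e_weight wt_unit)

lemma f_W: "i \<in> I \<Longrightarrow> f i \<in> W (\<lambda>j. - unit i j)"
  by (simp add: W_def f_weight wt_unit wt_minus)

lemma hh_W: "i \<in> I \<Longrightarrow> hh i \<in> W (\<lambda>_. 0)"
  by (simp add: W_def t_hh_commute)

text \<open>Right-nested brackets of the generators \<open>u\<close>, used with \<open>u = e\<close>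
  and with \<open>u = f\<close>. The vector counts the occurrences of each generator, so for
  \<open>f\<close> the weight is its negative.\<close>

inductive nested :: "(nat \<Rightarrow> 'g) \<Rightarrow> (nat \<Rightarrow> int) \<Rightarrow> 'g \<Rightarrow> bool" for u where
  base: "i \<in> I \<Longrightarrow> nested u (unit i) (u i)"
| step: "i \<in> I \<Longrightarrow> nested u c x \<Longrightarrow> nested u (\<lambda>j. unit i j + c j) (br (u i) x)"

lemma nested_e_W: "nested e c x \<Longrightarrow> x \<in> W c"
proof (induction rule: nested.induct)
  case (step i c x)
  then show ?case using W_br[OF e_W[of i], of x c] by simp
qed (use e_W in auto)

lemma nested_f_W: "nested f c x \<Longrightarrow> x \<in> W (\<lambda>j. - c j)"
proof (induction rule: nested.induct)
  case (step i c x)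
  then show ?case using W_br[OF f_W[of i], of x "\<lambda>j. - c j"] by simp
qed (use f_W in auto)

lemma sum_unit: "i \<in> I \<Longrightarrow> sum (unit i) I = 1"
  by (simp add: unit_def)

lemma nested_degree:
  "nested u c x \<Longrightarrow> (\<forall>j. 0 \<le> c j) \<and> (\<forall>j. j \<notin> I \<longrightarrow> c j = 0) \<and> 1 \<le> sum c I"
  by (induction rule: nested.induct) (auto simp: sum_unit sum.distrib unit_def)

abbreviation nested_span :: "(nat \<Rightarrow> 'g) \<Rightarrow> 'g set" where
  "nested_span u \<equiv> span {x. \<exists>c. nested u c x}"

text \<open>The derivation \<open>br (u i)\<close> meets the factors of the nested bracket one after
  the other. At each contact with some \<open>v j\<close> a combination of coroots appears, which by
  \<open>hv\<close> keeps the remaining bracket in the span.\<close>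

lemma lowering_nested:
  assumes uv: "\<And>i j. i \<in> I \<Longrightarrow> j \<in> I \<Longrightarrow> br (u i) (v j) \<in> span (hh ` I)"
    and hv: "\<And>z c y. z \<in> span (hh ` I) \<Longrightarrow> nested v c y \<Longrightarrow> br z y \<in> nested_span v"
    and i: "i \<in> I" and y: "nested v c y"
  shows "br (u i) y \<in> span (hh ` I \<union> {x. \<exists>c. nested v c x})"
  using y
proof (induction rule: nested.induct)
  case (base j)
  then show ?case using uv[OF i, of j] by (meson span_mono subsetD sup_ge1)
next
  case (step j c y)
  let ?S = "span (hh ` I \<union> {x. \<exists>c. nested v c x})"
  have "br (br (u i) (v j)) y \<in> ?S"
    using hv[OF uv[OF i step(1)] step(2)] by (meson span_mono subsetD sup_ge2)
  moreover have "br (v j) (br (u i) y) \<in> ?S"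
  proof (rule linear_image_span[OF linear_ad step.IH])
    fix z assume "z \<in> hh ` I \<union> {x. \<exists>c. nested v c x}"
    then show "br (v j) z \<in> ?S"
    proof
      assume "z \<in> hh ` I"
      then have "br z (v j) \<in> nested_span v"
        using hv[OF span_base nested.base[OF step(1)]] by auto
      then have "br (v j) z \<in> nested_span v"
        unfolding br_anticomm[of "v j" z] by (rule span_neg)
      then show ?thesis by (meson span_mono subsetD sup_ge2)
    next
      assume "z \<in> {x. \<exists>c. nested v c x}"
      then show ?thesis using step(1) by (blast intro: span_base nested.step)
    qed
  qed (rule subspace_span)
  ultimately show ?case unfolding br_derivation[of "u i" "v j" y] by (rule span_add)
qed

definition gen :: "(nat \<Rightarrow> int) \<Rightarrow> 'g \<Rightarrow> bool" where
  "gen c g \<longleftrightarrow> nested e c g \<or> c = (\<lambda>_. 0) \<and> g \<in> hh ` I \<or> nested f (\<lambda>j. - c j) g"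

lemma gen_W: "gen c g \<Longrightarrow> g \<in> W c"
  unfolding gen_def using nested_e_W[of c g] nested_f_W[of "\<lambda>j. - c j" g] hh_W by auto

lemma span_hh_subset_t: "span (hh ` I) \<subseteq> t"
  using hh_in_t subspace_t by (intro span_minimal) auto

lemma gen_iff: "(\<exists>c. gen c g) \<longleftrightarrow> (\<exists>c. nested e c g) \<or> g \<in> hh ` I \<or> (\<exists>c. nested f c g)"
proof -
  have "(\<exists>c. nested f (\<lambda>j. - c j) g) \<longleftrightarrow> (\<exists>c. nested f c g)"
  proof
    assume "\<exists>c. nested f c g"
    then obtain c where "nested f c g" by blast
    then show "\<exists>c. nested f (\<lambda>j. - c j) g" by (intro exI[of _ "\<lambda>j. - c j"]) simp
  qed blast
  then show ?thesis unfolding gen_def by blast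
qed

text \<open>The span is stable under every \<open>e i\<close> and \<open>f i\<close>, so its
  normaliser is the whole algebra. Therefore the span is itself a subalgebra, and it contains the
  generators.\<close>

lemma span_gen: "span {g. \<exists>c. gen c g} = UNIV"
proof -
  let ?S = "span {g. \<exists>c. gen c g}"
  have G: "{g. \<exists>c. gen c g} = {g. \<exists>c. nested e c g} \<union> hh ` I \<union> {g. \<exists>c. nested f c g}"
    unfolding gen_iff by blast
  have W: "br z y \<in> span {y}" if "z \<in> t" "y \<in> W c" for z y c
    using that by (auto simp: W_def intro: span_scale span_base)
  have hW: "br z y \<in> nested_span u" if "u = e \<or> u = f" "z \<in> span (hh ` I)" "nested u c y" for u z c y
  proof -
    have "br z y \<in> span {y}"
      using that W[of z y] nested_e_W nested_f_W span_hh_subset_t by blast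
    moreover have "span {y} \<subseteq> nested_span u" using that(3) by (intro span_mono) auto
    ultimately show ?thesis by blast
  qed
  have ef: "br (e i) (f j) \<in> span (hh ` I)" if "i \<in> I" "j \<in> I" for i j
    using that e_f_zero[OF that] by (cases "i = j") (auto simp: hh_def[symmetric] span_zero intro: span_base)
  have fe: "br (f i) (e j) \<in> span (hh ` I)" if "i \<in> I" "j \<in> I" for i j
    unfolding br_anticomm[of "f i" "e j"] by (intro span_neg ef that)
  have sub: "span (hh ` I \<union> {x. \<exists>c. nested u c x}) \<subseteq> ?S" "nested_span u \<subseteq> ?S" if "u = e \<or> u = f" for u
    using that unfolding G by (auto intro!: span_mono)
  have he: "br (u i) z \<in> ?S" if "z \<in> hh ` I" "i \<in> I" "u = e \<or> u = f" for z i u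
  proof -
    have "br z (u i) \<in> nested_span u"
      using hW[OF that(3) span_base nested.base[OF that(2)]] that(1) by auto
    then have "br (u i) z \<in> nested_span u"
      unfolding br_anticomm[of "u i" z] by (rule span_neg)
    then show ?thesis using sub(2)[OF that(3)] by blast
  qed
  have low_e: "br (e i) g \<in> span (hh ` I \<union> {x. \<exists>c. nested f c x})"
    if "i \<in> I" "nested f c g" for i c g
    by (rule lowering_nested[where v = f]) (use ef hW[of f] that in auto)
  have low_f: "br (f i) g \<in> span (hh ` I \<union> {x. \<exists>c. nested e c x})"
    if "i \<in> I" "nested e c g" for i c g
    by (rule lowering_nested[where v = e]) (use fe hW[of e] that in auto)
  have e: "br (e i) x \<in> ?S" if "i \<in> I" "x \<in> ?S" for i x
  proof (rule linear_image_span[OF linear_ad that(2)])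
    fix g assume "g \<in> {g. \<exists>c. gen c g}"
    then consider c where "nested e c g" | "g \<in> hh ` I" | c where "nested f c g"
      unfolding gen_iff by blast
    then show "br (e i) g \<in> ?S"
    proof cases
      case 1
      then have "br (e i) g \<in> nested_span e" using that(1) by (blast intro: span_base nested.step)
      then show ?thesis using sub(2)[of e] by blast
    next
      case 3
      then show ?thesis
        using low_e[OF that(1)] sub(1)[of f] by blast
    qed (use he that in auto)
  qed (rule subspace_span)
  have f: "br (f i) x \<in> ?S" if "i \<in> I" "x \<in> ?S" for i x
  proof (rule linear_image_span[OF linear_ad that(2)])
    fix g assume "g \<in> {g. \<exists>c. gen c g}"
    then consider c where "nested e c g" | "g \<in> hh ` I" | c where "nested f c g"
      unfolding gen_iff by blast
    then show "br (f i) g \<in> ?S"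
    proof cases
      case 3
      then have "br (f i) g \<in> nested_span f" using that(1) by (blast intro: span_base nested.step)
      then show ?thesis using sub(2)[of f] by blast
    next
      case 1
      then show ?thesis
        using low_f[OF that(1)] sub(1)[of e] by blast
    qed (use he that in auto)
  qed (rule subspace_span)
  have "{y. \<forall>x\<in>?S. br y x \<in> ?S} = UNIV"
    by (rule generated[OF normalizer_subalgebra]) (use e f in auto)
  then have "lie_subalgebra sc br ?S"
    by (auto simp: lie_subalgebra_def)
  moreover have "e ` I \<union> f ` I \<subseteq> ?S"
    unfolding G by (blast intro: span_base nested.base)
  ultimately show ?thesis by (rule generated)
qed

section \<open>The weight space decomposition\<close>

lemma gen_support: "gen c g \<Longrightarrow> j \<notin> I \<Longrightarrow> c j = 0"
  unfolding gen_def using nested_degree[of e c g] nested_degree[of f "\<lambda>j. - c j" g] by auto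

lemma W_components_in_subspace:
  assumes "finite K" "subspace S" "\<And>h x. h \<in> t \<Longrightarrow> x \<in> S \<Longrightarrow> br h x \<in> S"
    and "\<And>c. c \<in> K \<Longrightarrow> x c \<in> W c" "\<And>c j. c \<in> K \<Longrightarrow> j \<notin> I \<Longrightarrow> c j = 0"
    and "(\<Sum>c\<in>K. x c) \<in> S" "c \<in> K"
  shows "x c \<in> S"
proof (rule weight_components_in_subspace[OF assms(1,2), where L = t and T = br and w = wt])
  fix c d assume "c \<in> K" "d \<in> K" "c \<noteq> d"
  then show "\<exists>h\<in>t. wt c h \<noteq> wt d h" using wt_eq_imp_eq[of c d] assms(5) by blast
qed (use assms linear_ad in \<open>auto simp: W_def\<close>)

lemma weight_decomposition:
  obtains K y where "finite K" "x = (\<Sum>c\<in>K. y c)"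
    "\<And>c. c \<in> K \<Longrightarrow> y c \<in> span {g. gen c g}" "\<And>c j. c \<in> K \<Longrightarrow> j \<notin> I \<Longrightarrow> c j = 0"
    "\<And>c. c \<in> K \<Longrightarrow> y c \<in> W c"
proof -
  have "{g. \<exists>c. gen c g} = (\<Union>c. {g. gen c g})" by blast
  then have "x \<in> span (\<Union>c. {g. gen c g})" using span_gen by simp
  then obtain C y where C: "finite C" "x = (\<Sum>c\<in>C. y c)" "\<And>c. y c \<in> span {g. gen c g}"
    by (rule span_UN_decompose) blast
  \<comment> \<open>An index with zero summand may carry no generator at all, and then nothing is
    known about its entries outside \<open>I\<close>.\<close>
  let ?K = "{c \<in> C. y c \<noteq> 0}"
  show ?thesis
  proof (rule that[of ?K y])
    show "x = (\<Sum>c\<in>?K. y c)" unfolding C(2) using C(1) by (intro sum.mono_neutral_right) auto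
    show "c j = 0" if "c \<in> ?K" "j \<notin> I" for c j
    proof -
      have "\<exists>g. gen c g" using that C(3)[of c] by (metis (mono_tags) Collect_empty_eq mem_Collect_eq singletonD span_empty)
      then show ?thesis using gen_support that by blast
    qed
    have "span {g. gen c g} \<subseteq> W c" for c
      using gen_W by (intro span_minimal subspace_W) auto
    then show "y c \<in> W c" for c using C(3) by blast
  qed (use C in auto)
qed

lemma W_eq_span_gen:
  assumes "\<And>j. j \<notin> I \<Longrightarrow> c j = 0"
  shows "W c = span {g. gen c g}"
proof
  show "span {g. gen c g} \<subseteq> W c"
    using gen_W by (intro span_minimal subspace_W) auto
  show "W c \<subseteq> span {g. gen c g}"
  proof
    fix x assume x: "x \<in> W c"
    obtain K y where K: "finite K" "x = (\<Sum>c\<in>K. y c)"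
      "\<And>c. c \<in> K \<Longrightarrow> y c \<in> span {g. gen c g}" "\<And>c j. c \<in> K \<Longrightarrow> j \<notin> I \<Longrightarrow> c j = 0"
      "\<And>c. c \<in> K \<Longrightarrow> y c \<in> W c"
      using weight_decomposition[of x] by metis
    \<comment> \<open>These are the components of \<open>x - x\<close>, computed once from the
      decomposition of \<open>x\<close> and once from \<open>x \<in> W c\<close>. All of them
      vanish, and the one at \<open>c\<close> identifies \<open>x\<close> with
      \<open>y c\<close>.\<close>
    let ?z = "\<lambda>d. (if d \<in> K then y d else 0) - (if d = c then x else 0)"
    have "(\<Sum>d\<in>insert c K. if d \<in> K then y d else 0) = x"
      unfolding K(2) using K(1) by (intro sum.mono_neutral_cong_right) auto
    then have s: "(\<Sum>d\<in>insert c K. ?z d) \<in> {0}" using K(1) by (simp add: sum_subtractf)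
    have "?z c \<in> {0}"
    proof (rule W_components_in_subspace[OF _ _ _ _ _ s])
      show "?z d \<in> W d" if "d \<in> insert c K" for d
        using that K(5)[of d] x by (auto intro!: subspace_diff[OF subspace_W] subspace_0[OF subspace_W] subspace_neg[OF subspace_W])
    qed (use K assms in auto)
    then have "x = (if c \<in> K then y c else 0)" by simp
    then show "x \<in> span {g. gen c g}" using K(3)[of c] by (auto simp: span_zero split: if_splits)
  qed
qed

text \<open>A nonzero weight space contains one of the spanning vectors: a bracket of
  \<open>e\<close>s, a coroot or a bracket of \<open>f\<close>s. Mixed signs do not occur among
  these.\<close>

lemma W_nonzero_sign:
  assumes "x \<in> W c" "x \<noteq> 0" "\<And>j. j \<notin> I \<Longrightarrow> c j = 0"
  shows "(\<forall>j. 0 \<le> c j) \<or> (\<forall>j. c j \<le> 0)"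
proof -
  have "{g. gen c g} \<noteq> {}" using assms W_eq_span_gen[of c] by force
  then obtain g where "gen c g" by blast
  then show ?thesis
    unfolding gen_def using nested_degree[of e c g] nested_degree[of f "\<lambda>j. - c j" g] by auto
qed

lemma W_zero: "W (\<lambda>_. 0) = span (hh ` I)"
proof -
  have "\<not> nested u (\<lambda>_. 0) g" for u g using nested_degree[of u "\<lambda>_. 0" g] by auto
  then have "{g. gen (\<lambda>_. 0) g} = hh ` I" by (auto simp: gen_def)
  then show ?thesis using W_eq_span_gen[of "\<lambda>_. 0"] by simp
qed

text \<open>An element of \<open>t\<close> commutes with all coroots. The coroots already separate
  the weights, so each of its components commutes with them too; a nonzero component then has a
  weight vanishing on all coroots, which is the weight 0.\<close>

lemma t_eq: "t = span (hh ` I)"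
proof
  show "t \<subseteq> span (hh ` I)"
  proof
    fix x assume x: "x \<in> t"
    obtain K y where K: "finite K" "x = (\<Sum>c\<in>K. y c)"
      "\<And>c. c \<in> K \<Longrightarrow> y c \<in> span {g. gen c g}" "\<And>c j. c \<in> K \<Longrightarrow> j \<notin> I \<Longrightarrow> c j = 0"
      "\<And>c. c \<in> K \<Longrightarrow> y c \<in> W c"
      using weight_decomposition[of x] by metis
    let ?Z = "{x. \<forall>i\<in>I. br (hh i) x = 0}"
    have xZ: "x \<in> ?Z" using t_hh_commute x by (simp add: br_anticomm[of _ x])
    have Z: "y c \<in> ?Z" if "c \<in> K" for c
    proof (rule weight_components_in_subspace[OF K(1), where L = "hh ` I" and T = br and w = wt])
      show "subspace ?Z" by (auto simp: subspace_def br_add_right br_scale_right)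
      show "\<exists>h\<in>hh ` I. wt c h \<noteq> wt d h" if "c \<in> K" "d \<in> K" "c \<noteq> d" for c d
      proof (rule ccontr)
        assume "\<not> ?thesis"
        then have "c j = d j" for j
          using wt_inj[of c d j] K(4)[of c j] K(4)[of d j] that by (cases "j \<in> I") auto
        then show False using that by blast
      qed
    qed (use K xZ that linear_ad hh_in_t in \<open>auto simp: W_def\<close>)
    have *: "c = (\<lambda>_. 0) \<or> y c = 0" if "c \<in> K" for c
    proof (rule ccontr)
      assume n: "\<not> ?thesis"
      have "wt c (hh i) = 0" if "i \<in> I" for i
        using Z[OF \<open>c \<in> K\<close>] K(5)[OF \<open>c \<in> K\<close>] n that hh_in_t[OF that] by (auto simp: W_def)
      then have "c j = 0" for j
        using wt_inj[of c "\<lambda>_. 0" j] K(4)[OF that, of j] by (cases "j \<in> I") auto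
      then show False using n by auto
    qed
    have "y c \<in> W (\<lambda>_. 0)" if "c \<in> K" for c
      using *[OF that] K(5)[OF that] subspace_0[OF subspace_W] by auto
    then show "x \<in> span (hh ` I)"
      unfolding K(2) W_zero[symmetric] by (intro subspace_sum subspace_W)
  qed
qed (rule span_hh_subset_t)

end

section \<open>The Killing form and the Borel subalgebra\<close>

context chevalley_algebra
begin

text \<open>A basis of weight vectors, so that the coroots act diagonally with integral
  entries.\<close>

definition gen_basis :: "'g set" where
  "gen_basis = (SOME B. B \<subseteq> {g. \<exists>c. gen c g} \<and> finite B \<and> independent B \<and> span B = UNIV)"

lemma gen_basis:
  "gen_basis \<subseteq> {g. \<exists>c. gen c g}" "finite gen_basis" "independent gen_basis" "span gen_basis = UNIV"
proof -
  obtain F where F: "finite F" "span F = UNIV" using simple by (auto simp: simple_lie_algebra_def)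
  obtain B where B: "B \<subseteq> {g. \<exists>c. gen c g}" "independent B" "{g. \<exists>c. gen c g} \<subseteq> span B"
    using maximal_independent_subset by blast
  have "finite B" using independent_span_bound[OF F(1) B(2)] F(2) by simp
  moreover have "span B = UNIV"
    using span_minimal[OF B(3) subspace_span] span_gen by auto
  ultimately have "\<exists>B. B \<subseteq> {g. \<exists>c. gen c g} \<and> finite B \<and> independent B \<and> span B = UNIV"
    using B by blast
  from someI_ex[OF this] show "gen_basis \<subseteq> {g. \<exists>c. gen c g}" "finite gen_basis"
    "independent gen_basis" "span gen_basis = UNIV"
    unfolding gen_basis_def by auto
qed

definition killing :: "'g \<Rightarrow> 'g \<Rightarrow> 'k" where
  "killing x y = trace_on sc gen_basis (\<lambda>z. br x (br y z))"

lemma killing_sym: "killing x y = killing y x"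
  unfolding killing_def by (rule trace_on_comp_commute[OF gen_basis(2-4) linear_ad linear_ad])

lemma killing_add_left: "killing (x + y) z = killing x z + killing y z"
  by (simp add: killing_def br_add_left trace_on_add[OF gen_basis(3,4)])

lemma killing_scale_left: "killing (sc s x) z = s * killing x z"
  by (simp add: killing_def br_scale_left trace_on_scale[OF gen_basis(3,4)])

lemma linear_killing: "Vector_Spaces.linear sc (*) (killing x)"
proof -
  interpret K: vector_space "(*) :: 'k \<Rightarrow> 'k \<Rightarrow> 'k"
    by unfold_locales (simp_all add: algebra_simps)
  show ?thesis
    by unfold_locales
      (simp_all add: killing_sym[of x] killing_add_left killing_scale_left)
qed

lemma killing_zero [simp]: "killing 0 x = 0" "killing x 0 = 0"
  using killing_scale_left[of 0 0 x] killing_sym[of x 0] by simp_all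

lemma killing_minus_left: "killing (- x) y = - killing x y"
  using killing_scale_left[of "- 1" x y] by simp

lemma killing_invariant: "killing (br x y) z = killing x (br y z)"
proof -
  let ?T = "trace_on sc gen_basis"
  have lin: "Vector_Spaces.linear sc sc (\<lambda>w. br x (br z w))"
    by unfold_locales (simp_all add: br_add_right br_scale_right)
  have "br (br x y) w = br x (br y w) - br y (br x w)" for x y w
    using br_derivation[of x y w] by simp
  then have "killing (br x y) z = ?T (\<lambda>w. br x (br y (br z w))) - ?T (\<lambda>w. br y (br x (br z w)))"
    "killing x (br y z) = ?T (\<lambda>w. br x (br y (br z w))) - ?T (\<lambda>w. br x (br z (br y w)))"
    by (simp_all add: killing_def br_diff trace_on_diff[OF gen_basis(3,4)])
  then show ?thesis
    using trace_on_comp_commute[OF gen_basis(2-4) linear_ad[of y] lin] by simp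
qed

text \<open>The value is a sum of squares of integers. It could vanish only if \<open>hh i\<close>
  acted by 0, but \<open>e i\<close> is an eigenvector with eigenvalue 2.\<close>

lemma killing_hh_nonzero: assumes i: "i \<in> I" shows "killing (hh i) (hh i) \<noteq> 0"
proof
  assume 0: "killing (hh i) (hh i) = 0"
  have "\<forall>g\<in>gen_basis. \<exists>z::int. br (hh i) g = sc (of_int z) g"
  proof
    fix g assume "g \<in> gen_basis"
    then obtain c where "gen c g" using gen_basis(1) by blast
    then have "br (hh i) g = sc (wt c (hh i)) g" using gen_W hh_in_t[OF i] by (auto simp: W_def)
    then show "\<exists>z::int. br (hh i) g = sc (of_int z) g" unfolding wt_hh[OF i] by blast
  qed
  then obtain z :: "'g \<Rightarrow> int" where z: "\<And>g. g \<in> gen_basis \<Longrightarrow> br (hh i) g = sc (of_int (z g)) g"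
    by metis
  have "killing (hh i) (hh i) = (\<Sum>g\<in>gen_basis. of_int (z g * z g))"
    unfolding killing_def
    by (rule trace_on_diagonal[OF gen_basis(3)]) (simp add: z br_scale_right)
  also have "\<dots> = of_int (\<Sum>g\<in>gen_basis. z g * z g)" by simp
  finally have "(\<Sum>g\<in>gen_basis. z g * z g) = 0" using 0 by (metis of_int_eq_0_iff)
  then have "\<forall>g\<in>gen_basis. z g * z g = 0"
    using sum_nonneg_eq_0_iff[OF gen_basis(2), of "\<lambda>g. z g * z g"] by simp
  then have "br (hh i) x \<in> {0}" for x
    using linear_image_span[OF linear_ad, of x gen_basis "hh i" "{0}"] gen_basis(4) z by simp
  then have "br (hh i) (e i) = 0" by blast
  then show False using e_weight[OF i hh_in_t[OF i]] e_nonzero[OF i] alpha_hh[OF i i] by simp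
qed

lemma killing_nondegenerate:
  assumes "\<And>y. killing x y = 0"
  shows "x = 0"
proof -
  let ?R = "{x. \<forall>y. killing x y = 0}"
  have "killing (br x y) z = - killing y (br x z)" for x y z
    by (simp add: br_anticomm[of x y] killing_minus_left killing_invariant)
  then have "lie_ideal sc br ?R"
    by (auto simp: lie_ideal_def subspace_def killing_add_left killing_scale_left)
  moreover have "hh 1 \<notin> ?R" using killing_hh_nonzero[OF I_nonempty] by blast
  ultimately have "?R = {0}" using ideal_trivial by blast
  then show ?thesis using assms by blast
qed

lemma killing_pairing:
  assumes "span A = UNIV" "x \<noteq> 0"
  shows "\<exists>y\<in>A. killing x y \<noteq> 0"
proof (rule ccontr)
  assume *: "\<not> ?thesis"
  have "killing x y = 0" for y
  proof -
    interpret L: Vector_Spaces.linear sc "(*)" "killing x" by (rule linear_killing)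
    have "y \<in> span A" using assms(1) by simp
    then show ?thesis
      by (induction rule: span_induct_alt) (use * in \<open>auto simp: L.add L.scale\<close>)
  qed
  then show False using killing_nondegenerate assms(2) by blast
qed

text \<open>Stated for a single operator and bare scalars, so that it serves weights of
  \<open>t\<close> as well as weights of \<open>ts\<close>.\<close>

lemma killing_weights:
  assumes "br h x = sc p x" "br h y = sc q y" "killing x y \<noteq> 0"
  shows "q = - p"
proof -
  have "- (p * killing x y) = killing (br x h) y"
    by (simp add: br_anticomm[of x h] assms(1) killing_minus_left killing_scale_left)
  also have "\<dots> = killing x (br h y)" by (rule killing_invariant)
  also have "\<dots> = q * killing x y" by (simp add: assms(2) killing_sym[of x] killing_scale_left)
  finally show ?thesis using assms(3) by (metis mult_cancel_right mult_minus_left)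
qed

lemma killing_W:
  assumes "x \<in> W c" "y \<in> W d" "\<And>j. j \<notin> I \<Longrightarrow> c j = 0" "\<And>j. j \<notin> I \<Longrightarrow> d j = 0"
    and "d \<noteq> (\<lambda>j. - c j)"
  shows "killing x y = 0"
proof (rule ccontr)
  assume *: "\<not> ?thesis"
  have "wt d h = wt (\<lambda>j. - c j) h" if "h \<in> t" for h
    using killing_weights[of h x "wt c h" y "wt d h"] assms(1,2) * that by (auto simp: W_def wt_minus)
  then show False using wt_eq_imp_eq[of d "\<lambda>j. - c j"] assms(3-5) by auto
qed

lemma unit_outside: "i \<in> I \<Longrightarrow> j \<notin> I \<Longrightarrow> unit i j = 0"
  by (auto simp: unit_def)

text \<open>The Killing form pairs a negative weight vector \<open>x\<close> only with \<open>W (- c)\<close>, which is spanned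
  by brackets \<open>br (e i) y\<close> unless \<open>c\<close> is the negative of a simple root.\<close>

lemma annihilated_by_raising_zero:
  assumes x: "x \<in> W c" "\<And>j. c j \<le> 0" "c \<noteq> (\<lambda>_. 0)" "\<And>j. j \<notin> I \<Longrightarrow> c j = 0"
    and "\<And>i. i \<in> I \<Longrightarrow> c \<noteq> (\<lambda>j. - unit i j)"
    and e: "\<And>i. i \<in> I \<Longrightarrow> br (e i) x = 0"
  shows "x = 0"
proof (rule ccontr)
  assume "x \<noteq> 0"
  then obtain d y where y: "gen d y" "killing x y \<noteq> 0"
    using killing_pairing[OF span_gen] by blast
  have d: "d = (\<lambda>j. - c j)"
    using killing_W[OF x(1) gen_W[OF y(1)] x(4) gen_support[OF y(1)]] y(2) by blast
  from y(1) consider "nested e d y" | "d = (\<lambda>_. 0)" | "nested f (\<lambda>j. - d j) y"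
    unfolding gen_def by blast
  then show False
  proof cases
    case 1
    then show ?thesis
    proof cases
      case (base i)
      then have "c j = - unit i j" for j using fun_cong[OF d, of j] by simp
      then show ?thesis using assms(5)[OF base(3)] by blast
    next
      case (step i d' y')
      have "killing x y = killing (br x (e i)) y'" unfolding step killing_invariant ..
      also have "\<dots> = 0" using e[OF step(3)] by (simp add: br_anticomm[of x])
      finally show ?thesis using y(2) by simp
    qed
  next
    case 2
    then show ?thesis using d x(3) by (auto simp: fun_eq_iff)
  next
    case 3
    then have "0 \<le> - d j" for j using nested_degree by blast
    then have "c j = 0" for j using x(2)[of j] d by (auto intro: antisym)
    then show ?thesis using x(3) by blast
  qed
qed

section \<open>Signs of weights and membership in the Borel subalgebra\<close>

lemma nested_unit: "nested u (unit i) g \<Longrightarrow> i \<in> I \<Longrightarrow> g = u i"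
proof (cases rule: nested.cases, assumption)
  fix j assume "unit i = unit j" "g = u j"
  then show ?thesis by (metis unit_def zero_neq_one)
next
  fix j c x assume *: "i \<in> I" "unit i = (\<lambda>k. unit j k + c k)" "j \<in> I" "nested u c x"
  have "sum (unit i) I = sum (unit j) I + sum c I" unfolding *(2) by (simp add: sum.distrib)
  then show ?thesis using sum_unit *(1,3) nested_degree[OF *(4)] by simp
qed

lemma W_minus_unit: assumes i: "i \<in> I" shows "W (\<lambda>j. - unit i j) = span {f i}"
proof -
  have "g = f i" if "gen (\<lambda>j. - unit i j) g" for g
  proof -
    have "\<not> nested e (\<lambda>j. - unit i j) g"
      using nested_degree[of e "\<lambda>j. - unit i j" g] sum_unit[OF i] by (auto simp: sum_negf)
    moreover have "(\<lambda>j. - unit i j) \<noteq> (\<lambda>_. 0)" by (auto simp: unit_def fun_eq_iff)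
    ultimately have "nested f (unit i) g" using that by (auto simp: gen_def)
    then show ?thesis using nested_unit i by blast
  qed
  moreover have "gen (\<lambda>j. - unit i j) (f i)" using nested.base[OF i, of f] by (simp add: gen_def)
  ultimately have "{g. gen (\<lambda>j. - unit i j) g} = {f i}" by blast
  then show ?thesis using W_eq_span_gen[of "\<lambda>j. - unit i j"] unit_outside[OF i] by simp
qed

text \<open>Otherwise \<open>b\<close> would contain the triple \<open>e i\<close>,
  \<open>hh i\<close>, \<open>f i\<close>. These three vectors are multiples of brackets of one
  another and survive in every term of the derived series, against solvability.\<close>

lemma f_notin_b: assumes i: "i \<in> I" shows "f i \<notin> b"
proof
  assume f: "f i \<in> b"
  have S: "hh i \<in> U \<and> e i \<in> U \<and> f i \<in> U \<Longrightarrow>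
      hh i \<in> bracket_span sc br U U \<and> e i \<in> bracket_span sc br U U \<and> f i \<in> bracket_span sc br U U" for U
  proof -
    assume U: "hh i \<in> U \<and> e i \<in> U \<and> f i \<in> U"
    let ?V = "bracket_span sc br U U"
    have br: "br x y \<in> ?V" if "x \<in> U" "y \<in> U" for x y
      unfolding bracket_span_def using that by (blast intro: span_base)
    have "sc (1/2) (br (hh i) (e i)) \<in> ?V" "sc (- (1/2)) (br (hh i) (f i)) \<in> ?V"
      using br U unfolding bracket_span_def by (blast intro: span_scale)+
    moreover have "sc (1/2) (br (hh i) (e i)) = e i" "sc (- (1/2)) (br (hh i) (f i)) = f i"
      using e_weight[OF i hh_in_t[OF i]] f_weight[OF i hh_in_t[OF i]] alpha_hh[OF i i] by simp_all
    ultimately show ?thesis using br[of "e i" "f i"] U by (simp add: hh_def)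
  qed
  have "hh i \<in> ((\<lambda>U. bracket_span sc br U U) ^^ k) b \<and> e i \<in> ((\<lambda>U. bracket_span sc br U U) ^^ k) b
      \<and> f i \<in> ((\<lambda>U. bracket_span sc br U U) ^^ k) b" for k
  proof (induction k)
    case 0
    then show ?case using f e_in_b[OF i] br_in_b[of "e i" "f i"] by (simp add: hh_def)
  next
    case (Suc k)
    show ?case unfolding funpow.simps comp_def by (rule S[OF Suc.IH])
  qed
  moreover obtain k where "((\<lambda>U. bracket_span sc br U U) ^^ k) b = {0}"
    using borel by (auto simp: borel_subalgebra_def solvable_subalgebra_def)
  ultimately show False using e_nonzero[OF i] by blast
qed

text \<open>Raising by some \<open>e i\<close> keeps a vector in \<open>b\<close> and, by
  nondegeneracy of the Killing form, can be done without reaching 0 until the weight is the negative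
  of a simple root. There \<open>f_notin_b\<close> applies.\<close>

lemma negative_weight_vector_notin_b:
  assumes "x \<in> W c" "x \<in> b" "\<And>j. c j \<le> 0" "c \<noteq> (\<lambda>_. 0)" "\<And>j. j \<notin> I \<Longrightarrow> c j = 0"
  shows "x = 0"
  using assms
proof (induction "nat (- sum c I)" arbitrary: c x rule: less_induct)
  case less
  show ?case
  proof (rule ccontr)
    assume x: "x \<noteq> 0"
    show False
    proof (cases "\<exists>i\<in>I. c = (\<lambda>j. - unit i j)")
      case True
      then obtain i where i: "i \<in> I" "c = (\<lambda>j. - unit i j)" by blast
      then have "x \<in> span {f i}" using less.prems(1) W_minus_unit by blast
      then obtain k where k: "x = sc k (f i)" by (auto simp: span_singleton)
      then have "k \<noteq> 0" using x by auto
      then have "f i = sc (inverse k) x" using k by simp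
      then have "f i \<in> b" using less.prems(2) subspace_scale[OF subspace_b] by simp
      then show False using f_notin_b i by blast
    next
      case False
      then obtain i where i: "i \<in> I" "br (e i) x \<noteq> 0"
        using annihilated_by_raising_zero[OF less.prems(1,3,4,5)] x by blast
      let ?c = "\<lambda>j. unit i j + c j"
      have W: "br (e i) x \<in> W ?c" using W_br[OF e_W[OF i(1)] less.prems(1)] .
      have out: "?c j = 0" if "j \<notin> I" for j using that less.prems(5) unit_outside i by simp
      have nz: "?c \<noteq> (\<lambda>_. 0)"
      proof
        assume "?c = (\<lambda>_. 0)"
        then have "c j = - unit i j" for j by (metis add.commute add_eq_0_iff)
        then show False using False i(1) by blast
      qed
      \<comment> \<open>Raising by one simple root can turn a nonpositive vector into a nonnegative
        one only from 0 or from the negative of that simple root.\<close>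
      have "?c j \<le> 0" for j
      proof (rule ccontr)
        assume "\<not> ?c j \<le> 0"
        then have pos: "0 \<le> ?c k" for k using W_nonzero_sign[OF W i(2) out] by fastforce
        have "c k = 0" if "k \<noteq> i" for k
          using pos[of k] less.prems(3)[of k] that by (simp add: unit_def)
        moreover have "c i = 0 \<or> c i = - 1"
          using pos[of i] less.prems(3)[of i] by (simp add: unit_def) linarith
        ultimately have "c = (\<lambda>_. 0) \<or> c = (\<lambda>j. - unit i j)"
          unfolding unit_def fun_eq_iff by (metis minus_zero)
        then show False using False i(1) less.prems(4) by blast
      qed
      moreover have "nat (- sum ?c I) < nat (- sum c I)"
      proof -
        have "sum ?c I = 1 + sum c I" using sum_unit[OF i(1)] by (simp add: sum.distrib)
        moreover have "sum ?c I \<le> 0" using \<open>\<And>j. ?c j \<le> 0\<close> by (intro sum_nonpos) auto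
        ultimately show ?thesis by simp
      qed
      ultimately have "br (e i) x = 0"
        using less.hyps[of ?c "br (e i) x"] W nz out br_in_b[OF e_in_b[OF i(1)] less.prems(2)] by blast
      then show False using i(2) by simp
    qed
  qed
qed

lemma positive_weight_space_in_b:
  assumes "\<And>j. 0 \<le> c j" "c \<noteq> (\<lambda>_. 0)" "\<And>j. j \<notin> I \<Longrightarrow> c j = 0"
  shows "W c \<subseteq> b"
proof -
  have nb: "nested e d x \<Longrightarrow> x \<in> b" for d x
    by (induction rule: nested.induct) (auto intro: e_in_b br_in_b)
  have "g \<in> b" if g: "gen c g" for g
  proof -
    have "\<not> nested f (\<lambda>j. - c j) g"
    proof
      assume "nested f (\<lambda>j. - c j) g"
      then have "c j \<le> 0" for j using nested_degree[of f "\<lambda>j. - c j" g] by auto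
      then have "c j = 0" for j using assms(1)[of j] by (simp add: antisym)
      then show False using assms(2) by blast
    qed
    then show ?thesis using g nb assms(2) by (auto simp: gen_def)
  qed
  then have "span {g. gen c g} \<subseteq> b" by (intro span_minimal subspace_b) auto
  then show ?thesis using W_eq_span_gen[of c] assms(3) by simp
qed

end

section \<open>Grading by a diagram automorphism\<close>

locale twisted_chevalley_algebra = chevalley_algebra sc br t b X \<alpha> e f
  for sc :: "'k::field_char_0 \<Rightarrow> 'g::ab_group_add \<Rightarrow> 'g" and br t b X \<alpha> e f +
  fixes \<sigma> :: "'g \<Rightarrow> 'g" and \<pi> :: "nat \<Rightarrow> nat" and \<omega> :: 'k
  assumes automorphism: "lie_automorphism sc br \<sigma>"
    and symmetry: "diagram_symmetry X \<pi>" and nontrivial: "\<pi> \<noteq> id"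
    and sigma_e: "i \<in> {1..dynkin_rank X} \<Longrightarrow> \<sigma> (e i) = e (\<pi> i)"
    and sigma_f: "i \<in> {1..dynkin_rank X} \<Longrightarrow> \<sigma> (f i) = f (\<pi> i)"
    and omega: "primitive_root_of_unity (aut_order \<sigma>) \<omega>"
begin

abbreviation s :: nat where "s \<equiv> aut_order \<sigma>"

sublocale \<sigma>: Vector_Spaces.linear sc sc \<sigma>
  using automorphism by (simp add: lie_automorphism_def)

lemma sigma_br: "\<sigma> (br x y) = br (\<sigma> x) (\<sigma> y)"
  using automorphism by (simp add: lie_automorphism_def)

lemma pi_permutes: "\<pi> permutes I"
  using symmetry by (simp add: diagram_symmetry_def I_def)

lemma pi_in_I [simp]: "\<pi> i \<in> I \<longleftrightarrow> i \<in> I"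
  by (rule permutes_in_image[OF pi_permutes])

lemma pi_outside: "i \<notin> I \<Longrightarrow> \<pi> i = i"
  using pi_permutes by (simp add: permutes_not_in)

lemma pi_inj [simp]: "\<pi> i = \<pi> j \<longleftrightarrow> i = j"
  using pi_permutes by (metis permutes_def)

lemma cartan_pi: "i \<in> I \<Longrightarrow> j \<in> I \<Longrightarrow> a (\<pi> i) (\<pi> j) = a i j"
  using symmetry by (simp add: diagram_symmetry_def I_def)

lemma pi_pow_in_I [simp]: "(\<pi> ^^ k) i \<in> I \<longleftrightarrow> i \<in> I"
  by (induction k) auto

lemma e_inj: "i \<in> I \<Longrightarrow> j \<in> I \<Longrightarrow> e i = e j \<Longrightarrow> i = j"
  using e_f_zero[of i j] hh_nonzero[of j] by (auto simp: hh_def)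

lemma id_if_fixes_generators:
  assumes "Vector_Spaces.linear sc sc T" "\<And>x y. T (br x y) = br (T x) (T y)"
    "\<And>i. i \<in> I \<Longrightarrow> T (e i) = e i" "\<And>i. i \<in> I \<Longrightarrow> T (f i) = f i"
  shows "T = id"
proof -
  interpret T: Vector_Spaces.linear sc sc T by fact
  have "{x. T x = x} = UNIV"
    by (rule generated)
      (use assms in \<open>auto simp: lie_subalgebra_def subspace_def T.add T.scale T.zero\<close>)
  then show ?thesis by (auto simp: fun_eq_iff)
qed

text \<open>An automorphism is determined by its values on the generators and the \<open>e i\<close>
  are distinct, so \<open>\<sigma>\<close> and \<open>\<pi>\<close> have the same order.\<close>

lemma s_cases:
  "(s = 2 \<and> (\<forall>i. \<pi> (\<pi> i) = i)) \<or>
   (s = 3 \<and> X = Type_D 4 \<and> \<pi> 2 = 2 \<and> \<pi> 1 \<noteq> 1 \<and> \<pi> 3 \<noteq> 3 \<and> \<pi> 4 \<noteq> 4 \<and> (\<forall>i. \<pi> (\<pi> (\<pi> i)) = i))"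
proof -
  have e: "\<sigma> (e i) = e (\<pi> i)" "\<sigma> (f i) = f (\<pi> i)" if "i \<in> I" for i
    using sigma_e sigma_f that by (simp_all add: I_def)
  have moved: "\<sigma> \<noteq> id"
  proof
    assume "\<sigma> = id"
    then have "\<pi> i = i" for i using e_inj[of "\<pi> i" i] e[of i] pi_outside[of i] by (cases "i \<in> I") auto
    then show False using nontrivial by auto
  qed
  have lin2: "Vector_Spaces.linear sc sc (\<lambda>x. \<sigma> (\<sigma> x))"
    by unfold_locales (simp_all add: \<sigma>.add \<sigma>.scale)
  have lin3: "Vector_Spaces.linear sc sc (\<lambda>x. \<sigma> (\<sigma> (\<sigma> x)))"
    by unfold_locales (simp_all add: \<sigma>.add \<sigma>.scale)
  have pow: "\<sigma> ^^ 1 = \<sigma>" "\<sigma> ^^ 2 = (\<lambda>x. \<sigma> (\<sigma> x))" "\<sigma> ^^ 3 = (\<lambda>x. \<sigma> (\<sigma> (\<sigma> x)))"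
    by (auto simp: numeral_2_eq_2 numeral_3_eq_3)
  from diagram_symmetry_order[OF outer symmetry] show ?thesis
  proof
    assume 2: "\<forall>i. \<pi> (\<pi> i) = i"
    have "\<sigma> ^^ 2 = id"
      unfolding pow by (rule id_if_fixes_generators[OF lin2]) (use 2 e sigma_br in auto)
    moreover have "2 \<le> k" if "0 < k \<and> \<sigma> ^^ k = id" for k
      using that moved pow(1) by (cases "k = 1") auto
    ultimately have "s = 2" unfolding aut_order_def by (intro Least_equality) auto
    then show ?thesis using 2 by simp
  next
    assume 3: "X = Type_D 4 \<and> \<pi> 2 = 2 \<and> \<pi> 1 \<noteq> 1 \<and> \<pi> 3 \<noteq> 3 \<and> \<pi> 4 \<noteq> 4 \<and> (\<forall>i. \<pi> (\<pi> (\<pi> i)) = i)"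
    have "\<sigma> ^^ 3 = id"
      unfolding pow by (rule id_if_fixes_generators[OF lin3]) (use conjunct2[OF 3] e sigma_br in auto)
    moreover have "\<sigma> ^^ 2 \<noteq> id"
    proof
      assume "\<sigma> ^^ 2 = id"
      then have "e (\<pi> (\<pi> 1)) = e 1" using e[of 1] e[of "\<pi> 1"] I_nonempty pow(2) by (metis id_apply pi_in_I)
      then have "\<pi> (\<pi> 1) = 1" using e_inj I_nonempty by (metis pi_in_I)
      \<comment> \<open>Together with \<open>\<pi> (\<pi> (\<pi> 1)) = 1\<close> this would give
        \<open>\<pi> 1 = 1\<close>.\<close>
      then show False using 3 by metis
    qed
    moreover have "3 \<le> k" if k: "0 < k \<and> \<sigma> ^^ k = id" for k
    proof (rule ccontr)
      assume "\<not> 3 \<le> k"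
      then have "k = 1 \<or> k = 2" using k by linarith
      then show False using k moved pow(1) \<open>\<sigma> ^^ 2 \<noteq> id\<close> by auto
    qed
    ultimately have "s = 3" unfolding aut_order_def by (intro Least_equality) auto
    then show ?thesis using 3 by simp
  qed
qed

lemma s_pos: "0 < s" "1 < s"
  using s_cases by auto

lemma sigma_gen: "i \<in> I \<Longrightarrow> \<sigma> (e i) = e (\<pi> i)" "i \<in> I \<Longrightarrow> \<sigma> (f i) = f (\<pi> i)"
    "i \<in> I \<Longrightarrow> \<sigma> (hh i) = hh (\<pi> i)"
  using sigma_e sigma_f by (simp_all add: I_def hh_def sigma_br)

lemma sigma_pow_gen: "i \<in> I \<Longrightarrow> (\<sigma> ^^ k) (e i) = e ((\<pi> ^^ k) i)" "i \<in> I \<Longrightarrow> (\<sigma> ^^ k) (f i) = f ((\<pi> ^^ k) i)"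
    "i \<in> I \<Longrightarrow> (\<sigma> ^^ k) (hh i) = hh ((\<pi> ^^ k) i)"
  by (induction k) (simp_all add: sigma_gen)

lemma pi_pow_s: "(\<pi> ^^ s) i = i"
  using s_cases by (auto simp: numeral_2_eq_2 numeral_3_eq_3)

lemma linear_sigma_pow: "Vector_Spaces.linear sc sc (\<sigma> ^^ k)"
proof -
  have "(\<sigma> ^^ k) (x + y) = (\<sigma> ^^ k) x + (\<sigma> ^^ k) y" "(\<sigma> ^^ k) (sc c x) = sc c ((\<sigma> ^^ k) x)" for x y c
    by (induction k) (simp_all add: \<sigma>.add \<sigma>.scale)
  then show ?thesis by unfold_locales
qed

lemma sigma_pow_br: "(\<sigma> ^^ k) (br x y) = br ((\<sigma> ^^ k) x) ((\<sigma> ^^ k) y)"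
  by (induction k) (simp_all add: sigma_br)

lemma sigma_pow_s: "(\<sigma> ^^ s) x = x"
  using id_if_fixes_generators[OF linear_sigma_pow sigma_pow_br, of s]
  by (simp add: sigma_pow_gen pi_pow_s)

section \<open>Eigenspaces and restriction to the fixed part of the Cartan subalgebra\<close>

abbreviation gr :: "nat \<Rightarrow> 'g set" where "gr j \<equiv> eigenspace sc \<sigma> (\<omega> ^ j)"

abbreviation ts :: "'g set" where "ts \<equiv> t \<inter> gr 0"

lemma omega_s: "\<omega> ^ s = 1"
  using omega by (simp add: primitive_root_of_unity_def)

lemma omega_nonzero [simp]: "\<omega> \<noteq> 0"
  using omega_s s_pos by (auto simp: power_0_left)

lemma omega_pow_neq_1: "0 < k \<Longrightarrow> k < s \<Longrightarrow> \<omega> ^ k \<noteq> 1"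
  using omega by (simp add: primitive_root_of_unity_def)

lemma subspace_gr: "subspace (gr j)"
  by (auto simp: subspace_def eigenspace_def \<sigma>.add \<sigma>.scale \<sigma>.zero scale_right_distrib mult.commute)

lemma gr_br: "x \<in> gr j \<Longrightarrow> y \<in> gr k \<Longrightarrow> br x y \<in> gr (j + k)"
  by (simp add: eigenspace_def sigma_br br_scale_left br_scale_right power_add)

lemma sigma_pow_gr: "x \<in> gr j \<Longrightarrow> (\<sigma> ^^ k) x = sc (\<omega> ^ (j * k)) x"
  by (induction k) (simp_all add: eigenspace_def \<sigma>.scale power_add mult.commute)

lemma sigma_pow_fixed: "h \<in> ts \<Longrightarrow> (\<sigma> ^^ k) h = h"
  using sigma_pow_gr[of h 0 k] by simp

lemma sigma_t: assumes "h \<in> t" shows "(\<sigma> ^^ k) h \<in> t"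
proof (rule linear_image_span[OF linear_sigma_pow _ _ subspace_t])
  show "h \<in> span (hh ` I)" using assms by (simp only: t_eq)
  show "(\<sigma> ^^ k) x \<in> t" if "x \<in> hh ` I" for x
    using that sigma_pow_gen(3) hh_in_t by auto
qed

text \<open>Both sides are linear on \<open>t\<close>, and on the coroots they agree by the
  invariance of the Cartan matrix under \<open>\<pi>\<close>.\<close>

lemma wt_sigma: assumes "h \<in> t" shows "wt c ((\<sigma> ^^ k) h) = wt (\<lambda>i. c ((\<pi> ^^ k) i)) h"
proof -
  interpret T: Vector_Spaces.linear sc sc "\<sigma> ^^ k" by (rule linear_sigma_pow)
  have bij: "bij_betw (\<pi> ^^ k) I I"
    by (rule bij_betw_funpow[OF permutes_imp_bij[OF pi_permutes]])
  have a: "a ((\<pi> ^^ k) i) ((\<pi> ^^ k) j) = a i j" if "i \<in> I" "j \<in> I" for i j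
    by (induction k) (simp_all add: cartan_pi that)
  have hh: "wt c ((\<sigma> ^^ k) (hh i)) = wt (\<lambda>i. c ((\<pi> ^^ k) i)) (hh i)" if i: "i \<in> I" for i
  proof -
    have "(\<Sum>j\<in>I. a ((\<pi> ^^ k) i) j * c j) = (\<Sum>j\<in>I. a ((\<pi> ^^ k) i) ((\<pi> ^^ k) j) * c ((\<pi> ^^ k) j))"
      by (rule sum.reindex_bij_betw[OF bij, symmetric])
    also have "\<dots> = (\<Sum>j\<in>I. a i j * c ((\<pi> ^^ k) j))"
      using a i by (intro sum.cong) auto
    finally show ?thesis using i by (simp add: sigma_pow_gen wt_hh)
  qed
  have "h \<in> span (hh ` I)" using assms t_eq by simp
  then have "h \<in> t \<and> wt c ((\<sigma> ^^ k) h) = wt (\<lambda>i. c ((\<pi> ^^ k) i)) h"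
  proof (induction rule: span_induct_alt)
    case base
    show ?case using wt_linear_scale[of 0 c 0] wt_linear_scale[of 0 "\<lambda>i. c ((\<pi> ^^ k) i)" 0] subspace_0[OF subspace_t]
      by (simp add: T.zero)
  next
    case (step r x y)
    then have "x \<in> t" using hh_in_t by auto
    then show ?case
      using step hh by (auto simp: T.add T.scale wt_linear_add wt_linear_scale sigma_t
        intro!: subspace_add[OF subspace_t] subspace_scale[OF subspace_t])
        (auto simp: wt_linear_add wt_linear_scale subspace_scale[OF subspace_t] sigma_t)
  qed
  then show ?thesis by blast
qed

text \<open>The part of \<open>c\<close> that restriction to \<open>ts\<close> remembers: evaluating
  \<open>c\<close> on \<open>orbit_hh i\<close> is the same as evaluating \<open>orbit_sum c\<close>
  on \<open>hh i\<close>. The sum runs over the powers of \<open>\<pi>\<close> and not over the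
  points of the orbit, so a fixed vertex counts \<open>s\<close> times.\<close>

definition orbit_sum :: "(nat \<Rightarrow> int) \<Rightarrow> nat \<Rightarrow> int" where
  "orbit_sum c i = (\<Sum>k<s. c ((\<pi> ^^ k) i))"

definition orbit_hh :: "nat \<Rightarrow> 'g" where
  "orbit_hh i = (\<Sum>k<s. hh ((\<pi> ^^ k) i))"

text \<open>The value 0 off \<open>ts\<close> is the normalisation of \<open>dual_on\<close>; it
  turns equality of restricted weights into equality of functions.\<close>

definition res :: "(nat \<Rightarrow> int) \<Rightarrow> 'g \<Rightarrow> 'k" where
  "res c h = (if h \<in> ts then wt c h else 0)"

lemma orbit_hh_ts: assumes "i \<in> I" shows "orbit_hh i \<in> ts"
proof -
  have "\<sigma> (orbit_hh i) = (\<Sum>k<s. hh ((\<pi> ^^ Suc k) i))"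
    unfolding orbit_hh_def \<sigma>.sum using assms by (intro sum.cong) (auto simp: sigma_gen)
  also have "\<dots> = orbit_hh i"
    unfolding orbit_hh_def by (rule sum_cyclic) (simp add: pi_pow_s)
  finally have "orbit_hh i \<in> gr 0" by (simp add: eigenspace_def)
  moreover have "orbit_hh i \<in> t"
    unfolding orbit_hh_def by (intro subspace_sum[OF subspace_t] hh_in_t) (simp add: assms)
  ultimately show ?thesis by blast
qed

lemma subspace_ts: "subspace ts"
  by (intro subspace_inter subspace_t subspace_gr)

lemma wt_sum: "finite A \<Longrightarrow> (\<And>x. x \<in> A \<Longrightarrow> u x \<in> t) \<Longrightarrow> wt c (\<Sum>x\<in>A. u x) = (\<Sum>x\<in>A. wt c (u x))"
proof (induction A rule: finite_induct)
  case empty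
  then show ?case using wt_linear_scale[of 0 c 0] subspace_0[OF subspace_t] by simp
next
  case (insert x A)
  then have "(\<Sum>x\<in>A. u x) \<in> t" by (intro subspace_sum[OF subspace_t]) auto
  then show ?case using insert by (simp add: wt_linear_add)
qed

lemma wt_orbit_hh: assumes "i \<in> I" shows "wt c (orbit_hh i) = wt (orbit_sum c) (hh i)"
proof -
  have "wt c (orbit_hh i) = (\<Sum>k<s. wt c (hh ((\<pi> ^^ k) i)))"
    unfolding orbit_hh_def by (rule wt_sum) (use assms hh_in_t in auto)
  also have "\<dots> = (\<Sum>k<s. wt (\<lambda>j. c ((\<pi> ^^ k) j)) (hh i))"
    using wt_sigma[OF hh_in_t[OF assms]] by (intro sum.cong) (auto simp: sigma_pow_gen assms)
  also have "\<dots> = wt (orbit_sum c) (hh i)"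
    unfolding wt_def orbit_sum_def of_int_sum sum_distrib_right by (rule sum.swap)
  finally show ?thesis .
qed

lemma res_eq_imp_orbit_sum_eq:
  assumes "res c = res d" "i \<in> I"
  shows "orbit_sum c i = orbit_sum d i"
proof (rule wt_inj[OF _ assms(2)])
  fix l assume l: "l \<in> I"
  have "res c (orbit_hh l) = res d (orbit_hh l)" using assms(1) by simp
  then show "wt (orbit_sum c) (hh l) = wt (orbit_sum d) (hh l)"
    using orbit_hh_ts[OF l] by (simp add: res_def wt_orbit_hh[OF l])
qed

lemma orbit_sum_positive:
  assumes "\<And>j. 0 \<le> c j" "0 < c i"
  shows "0 < orbit_sum c i"
proof -
  have "c ((\<pi> ^^ 0) i) \<le> orbit_sum c i"
    unfolding orbit_sum_def by (rule member_le_sum) (use s_pos assms(1) in auto)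
  then show ?thesis using assms(2) by simp
qed

lemma orbit_sum_nonneg: "(\<And>j. 0 \<le> c j) \<Longrightarrow> 0 \<le> orbit_sum c i"
  unfolding orbit_sum_def by (simp add: sum_nonneg)

lemma orbit_sum_linear:
  "orbit_sum (\<lambda>j. c j + d j) i = orbit_sum c i + orbit_sum d i"
  "orbit_sum (\<lambda>j. - c j) i = - orbit_sum c i"
  "orbit_sum (\<lambda>_. 0) i = 0"
  by (simp_all add: orbit_sum_def sum.distrib sum_negf)

text \<open>This is \<open>s\<close> times the projection onto \<open>gr j\<close>; leaving out the
  factor 1/\<open>s\<close> keeps the formulas free of division.\<close>

definition component :: "nat \<Rightarrow> 'g \<Rightarrow> 'g" where
  "component j x = (\<Sum>k<s. sc (inverse \<omega> ^ (j * k)) ((\<sigma> ^^ k) x))"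

lemma component_gr: "component j x \<in> gr j"
proof -
  let ?F = "\<lambda>k. sc (\<omega> ^ j * inverse \<omega> ^ (j * k)) ((\<sigma> ^^ k) x)"
  have w: "\<omega> ^ j * inverse \<omega> ^ (j * Suc k) = inverse \<omega> ^ (j * k)" for k
    by (simp add: power_add power_inverse)
  have "\<sigma> (component j x) = (\<Sum>k<s. ?F (Suc k))"
    unfolding component_def \<sigma>.sum w by (simp add: \<sigma>.scale)
  also have "\<dots> = (\<Sum>k<s. ?F k)"
  proof (rule sum_cyclic)
    have "inverse \<omega> ^ (j * s) = 1"
      by (metis mult.commute inverse_1 omega_s power_inverse power_mult power_one)
    then show "?F s = ?F 0" by (simp add: sigma_pow_s)
  qed
  also have "\<dots> = sc (\<omega> ^ j) (component j x)"
    by (simp add: component_def scale_sum_right)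
  finally show ?thesis by (simp add: eigenspace_def)
qed

lemma component_of_gr: "x \<in> gr j \<Longrightarrow> component j x = sc (of_nat s) x"
proof -
  assume x: "x \<in> gr j"
  have "component j x = (\<Sum>k<s. x)"
    unfolding component_def sigma_pow_gr[OF x] by (simp add: power_inverse)
  also have "(\<Sum>k<n. x) = sc (of_nat n) x" for n :: nat
    by (induction n) (simp_all add: scale_left_distrib)
  finally show ?thesis .
qed

lemma linear_component: "Vector_Spaces.linear sc sc (component j)"
proof -
  interpret T: Vector_Spaces.linear sc sc "\<sigma> ^^ k" for k by (rule linear_sigma_pow)
  show ?thesis
    by unfold_locales
      (simp_all add: component_def T.add T.scale scale_right_distrib sum.distrib scale_sum_right mult.commute)
qed

text \<open>By orthogonality of the powers of \<open>\<omega>\<close>: for 0 < \<open>k\<close> <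
  \<open>s\<close> the coefficient of the \<open>k\<close>-th power of \<sigma> is a full geometric
  sum and vanishes.\<close>

lemma sum_components: "(\<Sum>j<s. component j x) = sc (of_nat s) x"
proof -
  have q: "(\<Sum>j<s. inverse \<omega> ^ (j * k)) = (if k = 0 then of_nat s else 0)" if "k < s" for k
  proof (cases "k = 0")
    case False
    let ?q = "inverse (\<omega> ^ k)"
    have "?q \<noteq> 1" using omega_pow_neq_1[of k] False that by (metis inverse_1 inverse_inverse_eq gr0I)
    moreover have "?q ^ s = 1"
      by (metis inverse_1 mult.commute omega_s power_inverse power_mult power_one)
    ultimately have "(\<Sum>j<s. ?q ^ j) = 0" by (simp add: sum_gp_strict)
    moreover have "inverse \<omega> ^ (j * k) = ?q ^ j" for j
      by (metis mult.commute power_inverse power_mult)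
    ultimately show ?thesis using False by simp
  qed simp
  have "(\<Sum>j<s. component j x) = (\<Sum>k<s. sc (\<Sum>j<s. inverse \<omega> ^ (j * k)) ((\<sigma> ^^ k) x))"
    unfolding component_def scale_sum_left by (rule sum.swap)
  also have "\<dots> = (\<Sum>k<s. if k = 0 then sc (of_nat s) x else 0)"
    by (intro sum.cong) (auto simp: q)
  finally show ?thesis using s_pos by simp
qed

lemma br_component: "h \<in> ts \<Longrightarrow> br h (component j x) = component j (br h x)"
  by (simp add: component_def br_sum br_scale_right sigma_pow_br sigma_pow_fixed)

section \<open>Weights of the eigenspaces\<close>

abbreviation wsp :: "nat \<Rightarrow> ('g \<Rightarrow> 'k) \<Rightarrow> 'g set" where
  "wsp j \<equiv> weight_space sc br (gr j) ts"

abbreviation wts :: "nat \<Rightarrow> ('g \<Rightarrow> 'k) set" where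
  "wts j \<equiv> weights sc br (gr j) ts"

lemma component_weight: assumes "x \<in> W c" shows "component j x \<in> wsp j (res c)"
proof -
  interpret T: Vector_Spaces.linear sc sc "component j" by (rule linear_component)
  show ?thesis
    using assms by (auto simp: weight_space_def component_gr br_component W_def T.scale res_def)
qed

lemma res_dual: "res c \<in> dual_on sc ts"
  unfolding dual_on_def mem_Collect_eq
proof (intro conjI ballI allI impI)
  fix x y r assume x: "x \<in> ts" and y: "y \<in> ts"
  then have "x + y \<in> ts" using subspace_add[OF subspace_ts] by blast
  then show "res c (x + y) = res c x + res c y"
    using x y unfolding res_def by (simp only: if_True IntD1 wt_linear_add)
next
  fix x r assume x: "x \<in> ts"
  then have "sc r x \<in> ts" using subspace_scale[OF subspace_ts] by blast
  then show "res c (sc r x) = r * res c x"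
    using x unfolding res_def by (simp only: if_True IntD1 wt_linear_scale)
qed (simp only: res_def if_False)

lemma subspace_wsp: "subspace (wsp j \<gamma>)"
  using subspace_gr[of j]
  by (auto simp: subspace_def weight_space_def br_add_right br_scale_right scale_right_distrib mult.commute)

lemma wtsI: "x \<in> wsp j \<gamma> \<Longrightarrow> x \<noteq> 0 \<Longrightarrow> \<gamma> \<in> dual_on sc ts \<Longrightarrow> \<gamma> \<in> wts j"
  by (auto simp: weights_def)

lemma wtsE:
  assumes "\<gamma> \<in> wts j"
  obtains x where "x \<in> wsp j \<gamma>" "x \<noteq> 0" "\<gamma> \<in> dual_on sc ts"
proof -
  have "0 \<in> wsp j \<gamma>" using subspace_wsp subspace_0 by blast
  then show ?thesis using assms that unfolding weights_def by blast
qed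

lemma span_weight_vectors: "span {x. \<exists>j<s. \<exists>c. (\<forall>i. i \<notin> I \<longrightarrow> c i = 0) \<and> x \<in> wsp j (res c)} = UNIV"
    (is "span ?A = UNIV")
proof -
  have "g \<in> span ?A" if g: "gen c g" for c g
  proof -
    have "component j g \<in> ?A" if "j < s" for j
      using component_weight[OF gen_W[OF g], of j] gen_support[OF g] that by blast
    then have "(\<Sum>j<s. component j g) \<in> span ?A" by (intro span_sum span_base) auto
    then have "sc (inverse (of_nat s)) (sc (of_nat s) g) \<in> span ?A"
      unfolding sum_components by (rule span_scale)
    then show ?thesis using s_pos by simp
  qed
  then have "span {g. \<exists>c. gen c g} \<subseteq> span ?A" by (intro span_minimal subspace_span) auto
  then show ?thesis using span_gen by auto
qed

text \<open>The space \<open>wsp j \<gamma>\<close> need not be stable under \<open>t\<close>, but it becomes so when the condition of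
  lying in \<open>gr j\<close> is dropped.\<close>

lemma weight_carrier:
  assumes "x \<in> wsp j \<gamma>" "\<gamma> \<in> dual_on sc ts"
  obtains K y where "finite K" "x = (\<Sum>c\<in>K. y c)"
    "\<And>c. c \<in> K \<Longrightarrow> y c \<in> W c" "\<And>c i. c \<in> K \<Longrightarrow> i \<notin> I \<Longrightarrow> c i = 0"
    "\<And>c. c \<in> K \<Longrightarrow> y c \<noteq> 0" "\<And>c. c \<in> K \<Longrightarrow> \<gamma> = res c"
proof -
  obtain K y where K: "finite K" "x = (\<Sum>c\<in>K. y c)"
    "\<And>c j. c \<in> K \<Longrightarrow> j \<notin> I \<Longrightarrow> c j = 0" "\<And>c. c \<in> K \<Longrightarrow> y c \<in> W c"
    using weight_decomposition[of x] by metis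
  let ?S = "{x. \<forall>h\<in>ts. br h x = sc (\<gamma> h) x}"
  have comm: "br h h' = 0" if "h \<in> t" "h' \<in> t" for h h'
  proof -
    have "h' \<in> W (\<lambda>_. 0)" using that(2) t_eq W_zero by simp
    then show ?thesis using that(1) by (simp add: W_def)
  qed
  have S: "y c \<in> ?S" if c: "c \<in> K" for c
  proof (rule W_components_in_subspace[OF K(1), of ?S y])
    show "subspace ?S"
      by (auto simp: subspace_def br_add_right br_scale_right scale_right_distrib mult.commute)
    show "br h x \<in> ?S" if "h \<in> t" "x \<in> ?S" for h x
      using that comm[of _ h] by (auto simp: br_derivation[of _ h x] br_scale_right)
  qed (use K assms(1) c in \<open>auto simp: weight_space_def\<close>)
  have res: "\<gamma> = res c" if c: "c \<in> K" "y c \<noteq> 0" for c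
  proof
    fix h
    show "\<gamma> h = res c h"
    proof (cases "h \<in> ts")
      case True
      then have "sc (\<gamma> h) (y c) = sc (wt c h) (y c)" using S[OF c(1)] K(4)[OF c(1)] by (auto simp: W_def)
      then show ?thesis using c(2) True by (simp add: res_def scale_right_imp_eq)
    next
      case False
      then show ?thesis using assms(2) by (auto simp: dual_on_def res_def)
    qed
  qed
  show ?thesis
  proof (rule that[of "{c \<in> K. y c \<noteq> 0}" y])
    show "x = (\<Sum>c\<in>{c \<in> K. y c \<noteq> 0}. y c)"
      unfolding K(2) using K(1) by (intro sum.mono_neutral_right) auto
    show "\<gamma> = res c" if "c \<in> {c \<in> K. y c \<noteq> 0}" for c using that by (intro res) simp_all
    show "c i = 0" if "c \<in> {c \<in> K. y c \<noteq> 0}" "i \<notin> I" for c i using that by (intro K(3)) simp_all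
    show "y c \<in> W c" if "c \<in> {c \<in> K. y c \<noteq> 0}" for c using that by (intro K(4)) simp_all
  qed (use K(1) in simp_all)
qed

text \<open>A weight vector in \<open>gr j\<close> is multiplied by \<open>s\<close> under
  \<open>component j\<close>, so at least one of its components under \<open>t\<close> has a nonzero
  image.\<close>

lemma weight_is_res:
  assumes "\<gamma> \<in> wts j"
  obtains c v where "\<gamma> = res c" "\<And>i. i \<notin> I \<Longrightarrow> c i = 0" "v \<in> W c" "component j v \<noteq> 0"
proof -
  interpret T: Vector_Spaces.linear sc sc "component j" by (rule linear_component)
  obtain x where x: "x \<in> wsp j \<gamma>" "x \<noteq> 0" "\<gamma> \<in> dual_on sc ts" using assms by (rule wtsE)
  obtain K y where K: "finite K" "x = (\<Sum>c\<in>K. y c)"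
    "\<And>c. c \<in> K \<Longrightarrow> y c \<in> W c" "\<And>c i. c \<in> K \<Longrightarrow> i \<notin> I \<Longrightarrow> c i = 0"
    "\<And>c. c \<in> K \<Longrightarrow> \<gamma> = res c"
    using weight_carrier[OF x(1,3)] by metis
  have "component j x \<noteq> 0"
    using x s_pos component_of_gr[of x j] by (auto simp: weight_space_def)
  then have "(\<Sum>c\<in>K. component j (y c)) \<noteq> 0" by (simp add: K(2) T.sum)
  then obtain c where "c \<in> K" "component j (y c) \<noteq> 0" by (meson sum.neutral)
  then show ?thesis using that K by blast
qed

text \<open>The adjoint action of \<open>\<sigma> x\<close> is that of \<open>x\<close> conjugated
  by \<sigma>, and the trace is cyclic. The inverse of \<sigma> is its power
  \<open>s - 1\<close>.\<close>

lemma killing_sigma: "killing (\<sigma> x) (\<sigma> y) = killing x y"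
proof -
  define \<tau> where "\<tau> = \<sigma> ^^ (s - 1)"
  interpret T: Vector_Spaces.linear sc sc \<tau> unfolding \<tau>_def by (rule linear_sigma_pow)
  have s: "Suc (s - 1) = s" using s_pos by simp
  have inv: "\<sigma> (\<tau> z) = z" "\<tau> (\<sigma> z) = z" for z
    using sigma_pow_s[of z] funpow.simps(2)[of "s - 1" \<sigma>] funpow_Suc_right[of "s - 1" \<sigma>] unfolding s \<tau>_def
    by (metis comp_apply)+
  have "br (\<sigma> x) z = \<sigma> (br x (\<tau> z))" for x z by (simp add: sigma_br inv)
  then have "killing (\<sigma> x) (\<sigma> y) = trace_on sc gen_basis (\<lambda>z. \<sigma> (br x (br y (\<tau> z))))"
    by (simp add: killing_def inv)
  also have "\<dots> = trace_on sc gen_basis (\<lambda>z. br x (br y (\<tau> (\<sigma> z))))"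
  proof (rule trace_on_comp_commute[OF gen_basis(2-4) \<sigma>.linear_axioms])
    show "Vector_Spaces.linear sc sc (\<lambda>z. br x (br y (\<tau> z)))"
      by unfold_locales (simp_all add: T.add T.scale br_add_right br_scale_right)
  qed
  finally show ?thesis by (simp add: inv killing_def)
qed

text \<open>A nonzero weight vector pairs nontrivially with some weight vector of some
  \<open>gr k\<close>. Invariance under \<open>ts\<close> makes the two weights opposite, and
  invariance under \<sigma> makes the two eigenvalues inverse to each other.\<close>

lemma weights_dual:
  assumes "\<gamma> \<in> wts j" "j \<le> s"
  shows "(\<lambda>h. - \<gamma> h) \<in> wts (s - j)"
proof -
  obtain x where x: "x \<in> wsp j \<gamma>" "x \<noteq> 0" "\<gamma> \<in> dual_on sc ts" using assms(1) by (rule wtsE)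
  obtain k c y where y: "k < s" "y \<in> wsp k (res c)" "killing x y \<noteq> 0"
    using killing_pairing[OF span_weight_vectors x(2)] by blast
  have "res c h = - \<gamma> h" for h
  proof (cases "h \<in> ts")
    case True
    then show ?thesis using killing_weights[of h x "\<gamma> h" y "res c h"] x(1) y by (auto simp: weight_space_def)
  next
    case False
    then show ?thesis using x(3) by (auto simp: dual_on_def res_def)
  qed
  then have \<gamma>: "(\<lambda>h. - \<gamma> h) = res c" by auto
  have "killing (\<sigma> x) (\<sigma> y) = \<omega> ^ j * (\<omega> ^ k * killing x y)"
    using x(1) y(2) by (simp add: weight_space_def eigenspace_def killing_scale_left killing_sym[of x])
  then have "\<omega> ^ j * \<omega> ^ k = 1" using y(3) by (simp add: killing_sigma)
  also have "\<dots> = \<omega> ^ j * \<omega> ^ (s - j)" using assms(2) by (simp add: omega_s flip: power_add)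
  finally have "\<omega> ^ k = \<omega> ^ (s - j)" by simp
  \<comment> \<open>Only the eigenvalues agree: for \<open>j = 0\<close> the index \<open>k\<close>
    is 0 and not \<open>s\<close>.\<close>
  then have "y \<in> wsp (s - j) (res c)" using y(2) by simp
  then show ?thesis unfolding \<gamma> by (rule wtsI) (use y res_dual in auto)
qed

lemma sigma_pow_W:
  assumes "v \<in> W c" "k \<le> s"
  shows "(\<sigma> ^^ k) v \<in> W (\<lambda>i. c ((\<pi> ^^ (s - k)) i))"
proof -
  interpret T: Vector_Spaces.linear sc sc "\<sigma> ^^ k" by (rule linear_sigma_pow)
  have "br h ((\<sigma> ^^ k) v) = sc (wt (\<lambda>i. c ((\<pi> ^^ (s - k)) i)) h) ((\<sigma> ^^ k) v)" if h: "h \<in> t" for h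
  proof -
    let ?h = "(\<sigma> ^^ (s - k)) h"
    have "(\<sigma> ^^ k) ?h = h"
      using assms(2) sigma_pow_s[of h] by (metis comp_apply funpow_add le_add_diff_inverse)
    then have "br h ((\<sigma> ^^ k) v) = (\<sigma> ^^ k) (br ?h v)" by (simp add: sigma_pow_br)
    also have "br ?h v = sc (wt c ?h) v" using assms(1) sigma_t[OF h] by (simp add: W_def)
    finally show ?thesis by (simp add: T.scale wt_sigma[OF h])
  qed
  then show ?thesis by (simp add: W_def)
qed

text \<open>As \<open>s\<close> is 2 or 3, hence prime, a vector that \<open>\<pi>\<close> moves has
  \<open>s\<close> distinct translates.\<close>

lemma nonfixed_orbit_distinct:
  assumes c: "c (\<pi> l) \<noteq> c l" and k: "k < s" "k' < s" "k \<noteq> k'"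
  shows "\<exists>i. c ((\<pi> ^^ (s - k)) i) \<noteq> c ((\<pi> ^^ (s - k')) i)"
proof (rule ccontr)
  assume "\<not> ?thesis"
  then have eq: "c ((\<pi> ^^ (s - k)) i) = c ((\<pi> ^^ (s - k')) i)" for i by blast
  from s_cases show False
  proof
    assume *: "s = 2 \<and> (\<forall>i. \<pi> (\<pi> i) = i)"
    then consider "k = 0" "k' = 1" | "k = 1" "k' = 0" using k by fastforce
    then show False using eq[of l] c * by cases (auto simp: numeral_2_eq_2)
  next
    assume *: "s = 3 \<and> X = Type_D 4 \<and> \<pi> 2 = 2 \<and> \<pi> 1 \<noteq> 1 \<and> \<pi> 3 \<noteq> 3 \<and> \<pi> 4 \<noteq> 4 \<and> (\<forall>i. \<pi> (\<pi> (\<pi> i)) = i)"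
    then have s: "s = 3" and p: "\<pi> (\<pi> (\<pi> i)) = i" for i by auto
    have "k = 0 \<or> k = 1 \<or> k = 2" "k' = 0 \<or> k' = 1 \<or> k' = 2" using k s by auto
    then show False
      using eq[of l] eq[of "\<pi> l"] eq[of "\<pi> (\<pi> l)"] c k(3) unfolding s
      by (elim disjE) (simp_all add: numeral_3_eq_3 numeral_2_eq_2 p)
  qed
qed

text \<open>The translates of \<open>v\<close> under \<sigma> lie in distinct weight spaces and
  cannot cancel. The summand for exponent 0 is \<open>v\<close> itself.\<close>

lemma component_nonfixed:
  assumes v: "v \<in> W c" "v \<noteq> 0" and c: "\<And>i. i \<notin> I \<Longrightarrow> c i = 0" "c (\<pi> l) \<noteq> c l"
  shows "component j v \<noteq> 0"
proof
  assume 0: "component j v = 0"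
  let ?x = "\<lambda>k. sc (inverse \<omega> ^ (j * k)) ((\<sigma> ^^ k) v)"
  let ?w = "\<lambda>k. wt (\<lambda>i. c ((\<pi> ^^ (s - k)) i))"
  have "?x 0 \<in> {0}"
  proof (rule weight_components_in_subspace[where K = "{..<s}" and T = br and L = t and w = ?w])
    show "br h (?x k) = sc (?w k h) (?x k)" if "k \<in> {..<s}" "h \<in> t" for k h
      using sigma_pow_W[OF v(1), of k] that by (simp add: W_def br_scale_right mult.commute)
    show "\<exists>h\<in>t. ?w k h \<noteq> ?w k' h" if "k \<in> {..<s}" "k' \<in> {..<s}" "k \<noteq> k'" for k k'
    proof (rule ccontr)
      assume "\<not> ?thesis"
      then have "(\<lambda>i. c ((\<pi> ^^ (s - k)) i)) = (\<lambda>i. c ((\<pi> ^^ (s - k')) i))"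
        by (intro wt_eq_imp_eq) (auto simp: c(1))
      then show False using nonfixed_orbit_distinct[OF c(2)] that by (metis lessThan_iff)
    qed
  qed (use 0 s_pos linear_ad in \<open>auto simp: component_def\<close>)
  then show False using v(2) by simp
qed

lemma weight_nonfixed:
  assumes "v \<in> W c" "v \<noteq> 0" "\<And>i. i \<notin> I \<Longrightarrow> c i = 0" "c (\<pi> l) \<noteq> c l"
  shows "res c \<in> wts j"
  by (rule wtsI[OF component_weight[OF assms(1)] component_nonfixed[OF assms] res_dual])

lemma unit_pi: "unit (\<pi> i) (\<pi> j) = unit i j"
  by (simp add: unit_def)

lemma unit_nonfixed: "\<pi> i \<noteq> i \<Longrightarrow> unit i (\<pi> i) \<noteq> unit i i"
  by (simp add: unit_def)

lemma res_add: "res (\<lambda>j. c j + d j) = (\<lambda>h. res c h + res d h)"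
  by (auto simp: res_def wt_add)

lemma res_minus: "res (\<lambda>j. - c j) = (\<lambda>h. - res c h)"
  by (auto simp: res_def wt_minus)

lemma res_zero: "res (\<lambda>_. 0) = (\<lambda>_. 0)"
  by (auto simp: res_def)

lemma res_pi: "res (\<lambda>i. c (\<pi> i)) = res c"
proof
  fix h
  show "res (\<lambda>i. c (\<pi> i)) h = res c h"
  proof (cases "h \<in> ts")
    case True
    then show ?thesis using wt_sigma[of h c 1] sigma_pow_fixed[OF True, of 1] by (simp add: res_def)
  next
    case False
    then show ?thesis by (simp only: res_def if_False)
  qed
qed

lemma res_unit_pi_pow: "res (unit ((\<pi> ^^ k) i)) = res (unit i)"
proof (induction k)
  case (Suc k)
  have "res (unit (\<pi> ((\<pi> ^^ k) i))) = res (\<lambda>j. unit (\<pi> ((\<pi> ^^ k) i)) (\<pi> j))"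
    by (rule res_pi[symmetric])
  then show ?case using Suc by (simp add: unit_pi)
qed simp

lemma orbit_sum_unit_nonzero:
  assumes "orbit_sum (unit i) j \<noteq> 0"
  obtains k where "(\<pi> ^^ k) j = i"
proof -
  obtain k where "unit i ((\<pi> ^^ k) j) \<noteq> 0" using assms unfolding orbit_sum_def by (meson sum.neutral)
  then show ?thesis using that[of k] by (auto simp: unit_def split: if_splits)
qed

lemma orbit_hh_pi_pow: assumes "i \<in> I" shows "orbit_hh ((\<pi> ^^ k) i) = orbit_hh i"
proof (induction k)
  case (Suc k)
  have "orbit_hh (\<pi> j) = orbit_hh j" for j
    using sum_cyclic[of "\<lambda>k. hh ((\<pi> ^^ k) j)" s] by (simp add: orbit_hh_def pi_pow_s funpow_swap1)
  then show ?case using Suc by simp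
qed simp

lemma orbit_sum_unit_pos: "0 < orbit_sum (unit i) i"
  by (rule orbit_sum_positive) (auto simp: unit_def)

lemma res_unit_inj:
  assumes "res (unit i) = res (unit j)" "i \<in> I" "j \<in> I"
  obtains k where "(\<pi> ^^ k) i = j"
proof -
  have "orbit_sum (unit j) i \<noteq> 0"
    using res_eq_imp_orbit_sum_eq[OF assms(1,2)] orbit_sum_unit_pos[of i] by simp
  then show ?thesis using orbit_sum_unit_nonzero that by blast
qed

lemma sum_orbit_sum: "(\<Sum>i\<in>I. orbit_sum c i) = int s * sum c I"
proof -
  have "(\<Sum>i\<in>I. c ((\<pi> ^^ k) i)) = sum c I" for k
    by (rule sum.reindex_bij_betw[OF bij_betw_funpow[OF permutes_imp_bij[OF pi_permutes]]])
  then show ?thesis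
    unfolding orbit_sum_def by (subst sum.swap) simp
qed

lemma moved_vertex: obtains i where "i \<in> I" "\<pi> i \<noteq> i"
proof -
  obtain i where "\<pi> i \<noteq> i" using nontrivial by (auto simp: fun_eq_iff)
  then show ?thesis using that pi_outside by blast
qed

section \<open>Simple roots of the fixed point algebra\<close>

abbreviation pos_roots0 :: "('g \<Rightarrow> 'k) set" where
  "pos_roots0 \<equiv> positive_roots sc br (gr 0) ts (b \<inter> gr 0)"

text \<open>Since \<open>b\<close> is stable under \<open>t\<close>, it contains the
  \<open>t\<close>-components of a root vector along with the vector. A component of negative weight
  is ruled out by \<open>negative_weight_vector_notin_b\<close>.\<close>

lemma positive_root0E:
  assumes "\<gamma> \<in> pos_roots0"
  obtains c where "\<gamma> = res c" "\<And>i. 0 \<le> c i" "c \<noteq> (\<lambda>_. 0)" "\<And>i. i \<notin> I \<Longrightarrow> c i = 0"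
proof -
  have \<gamma>: "\<gamma> \<in> wts 0" "\<gamma> \<noteq> (\<lambda>_. 0)" "wsp 0 \<gamma> \<subseteq> b"
    using assms by (auto simp: positive_roots_def roots_def)
  obtain x where x: "x \<in> wsp 0 \<gamma>" "x \<noteq> 0" "\<gamma> \<in> dual_on sc ts" using \<gamma>(1) by (rule wtsE)
  obtain K y where K: "finite K" "x = (\<Sum>c\<in>K. y c)"
    "\<And>c. c \<in> K \<Longrightarrow> y c \<in> W c" "\<And>c i. c \<in> K \<Longrightarrow> i \<notin> I \<Longrightarrow> c i = 0"
    "\<And>c. c \<in> K \<Longrightarrow> y c \<noteq> 0" "\<And>c. c \<in> K \<Longrightarrow> \<gamma> = res c"
    using weight_carrier[OF x(1,3)] by metis
  obtain c where c: "c \<in> K" using K(2) x(2) by fastforce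
  have "y c \<in> b"
    by (rule W_components_in_subspace[OF K(1) subspace_b])
      (use K x \<gamma>(3) c t_subset_b br_in_b in auto)
  moreover have nz: "c \<noteq> (\<lambda>_. 0)" using K(6)[OF c] \<gamma>(2) res_zero by auto
  ultimately have "\<not> (\<forall>i. c i \<le> 0)"
    using negative_weight_vector_notin_b[OF K(3)[OF c]] K(4,5)[OF c] by blast
  then have "0 \<le> c i" for i using W_nonzero_sign[OF K(3)[OF c] K(5)[OF c] K(4)[OF c]] by blast
  then show ?thesis using that[of c] K(4,6)[OF c] nz by blast
qed

lemma res_unit_nonzero: assumes "i \<in> I" shows "res (unit i) \<noteq> (\<lambda>_. 0)"
proof
  assume "res (unit i) = (\<lambda>_. 0)"
  then have "orbit_sum (unit i) i = orbit_sum (\<lambda>_. 0) i"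
    using res_eq_imp_orbit_sum_eq[of "unit i" "\<lambda>_. 0" i] assms res_zero by simp
  then show False using orbit_sum_unit_pos[of i] by (simp add: orbit_sum_linear)
qed

lemma res_unit_positive_root: assumes i: "i \<in> I" shows "res (unit i) \<in> pos_roots0"
proof -
  have "component 0 (e i) \<noteq> 0"
  proof (cases "\<pi> i = i")
    case True
    then have "e i \<in> gr 0" using sigma_gen(1)[OF i] by (simp add: eigenspace_def)
    then show ?thesis using component_of_gr[of "e i" 0] e_nonzero[OF i] s_pos by simp
  next
    case False
    show ?thesis
      by (rule component_nonfixed[OF e_W[OF i] e_nonzero[OF i] _ unit_nonfixed[OF False]])
        (rule unit_outside[OF i])
  qed
  then have "res (unit i) \<in> wts 0" by (rule wtsI[OF component_weight[OF e_W[OF i]] _ res_dual])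
  moreover have "x \<in> b" if x: "x \<in> wsp 0 (res (unit i))" for x
  proof -
    obtain K y where K: "finite K" "x = (\<Sum>c\<in>K. y c)"
      "\<And>c. c \<in> K \<Longrightarrow> y c \<in> W c" "\<And>c i. c \<in> K \<Longrightarrow> i \<notin> I \<Longrightarrow> c i = 0"
      "\<And>c. c \<in> K \<Longrightarrow> y c \<noteq> 0" "\<And>c. c \<in> K \<Longrightarrow> res (unit i) = res c"
      using weight_carrier[OF x res_dual] by metis
    have "y c \<in> b" if c: "c \<in> K" for c
    proof -
      \<comment> \<open>Other vectors may restrict to the same weight, but the common orbit sums
        force them to be positive as well.\<close>
      have pos: "0 < orbit_sum c i"
        using res_eq_imp_orbit_sum_eq[OF K(6)[OF c] i] orbit_sum_unit_pos[of i] by simp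
      have "\<not> (\<forall>i. c i \<le> 0)"
      proof
        assume "\<forall>i. c i \<le> 0"
        then have "0 \<le> orbit_sum (\<lambda>j. - c j) i" by (intro orbit_sum_nonneg) simp
        then show False using pos by (simp add: orbit_sum_linear)
      qed
      then have "0 \<le> c i" for i using W_nonzero_sign[OF K(3)[OF c] K(5)[OF c] K(4)[OF c]] by blast
      moreover have "c \<noteq> (\<lambda>_. 0)" using pos by (auto simp: orbit_sum_linear)
      ultimately show ?thesis using positive_weight_space_in_b[of c] K(3,4)[OF c] by blast
    qed
    then show ?thesis unfolding K(2) by (intro subspace_sum subspace_b)
  qed
  ultimately show ?thesis
    using res_unit_nonzero[OF i] by (auto simp: positive_roots_def roots_def weight_space_def)
qed

text \<open>The orbit sums add up to \<open>s\<close> times the height, so the height is determined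
  by the restriction. A simple root has height 1, a sum of two positive ones at least 2.\<close>

lemma res_unit_simple_root:
  assumes i: "i \<in> I" shows "res (unit i) \<in> simple_roots sc br (gr 0) ts (b \<inter> gr 0)"
proof -
  have "False" if \<mu>: "\<mu> \<in> pos_roots0" "\<kappa> \<in> pos_roots0" "res (unit i) = (\<lambda>h. \<mu> h + \<kappa> h)" for \<mu> \<kappa>
  proof -
    obtain c where c: "\<mu> = res c" "\<And>i. 0 \<le> c i" "c \<noteq> (\<lambda>_. 0)" "\<And>i. i \<notin> I \<Longrightarrow> c i = 0"
      using \<mu>(1) by (rule positive_root0E) blast
    obtain d where d: "\<kappa> = res d" "\<And>i. 0 \<le> d i" "d \<noteq> (\<lambda>_. 0)" "\<And>i. i \<notin> I \<Longrightarrow> d i = 0"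
      using \<mu>(2) by (rule positive_root0E) blast
    have pos: "1 \<le> sum c I" if c: "\<And>i. 0 \<le> c i" "c \<noteq> (\<lambda>_. 0)" "\<And>i. i \<notin> I \<Longrightarrow> c i = 0" for c :: "nat \<Rightarrow> int"
    proof -
      obtain j where "c j \<noteq> 0" using c(2) by auto
      then have j: "j \<in> I" "1 \<le> c j" using c(1)[of j] c(3)[of j] by (auto simp: order.order_iff_strict)
      moreover have "c j \<le> sum c I" by (rule member_le_sum) (use c(1) j in auto)
      ultimately show ?thesis by simp
    qed
    have "res (unit i) = res (\<lambda>j. c j + d j)" using \<mu>(3) c(1) d(1) by (simp add: res_add)
    then have "orbit_sum (unit i) j = orbit_sum c j + orbit_sum d j" if "j \<in> I" for j
      using res_eq_imp_orbit_sum_eq[OF _ that] by (metis orbit_sum_linear(1))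
    then have "(\<Sum>j\<in>I. orbit_sum (unit i) j) = (\<Sum>j\<in>I. orbit_sum c j) + (\<Sum>j\<in>I. orbit_sum d j)"
      by (simp add: sum.distrib)
    then have "int s * 1 = int s * (sum c I + sum d I)"
      unfolding sum_orbit_sum sum_unit[OF i] by (simp add: algebra_simps)
    then have "sum c I + sum d I = 1" using s_pos by simp
    then show False using pos[of c] pos[of d] c d by auto
  qed
  then show ?thesis using res_unit_positive_root[OF i] by (auto simp: simple_roots_def)
qed

lemma ts_subset_span_orbit_hh: "ts \<subseteq> span (orbit_hh ` I)"
proof
  fix x assume x: "x \<in> ts"
  have hh: "component 0 y = orbit_hh i" if "i \<in> I" "y = hh i" for i y
    using that by (simp add: component_def orbit_hh_def sigma_pow_gen)
  have "component 0 x \<in> span (orbit_hh ` I)"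
  proof (rule linear_image_span[OF linear_component _ _ subspace_span])
    show "x \<in> span (hh ` I)" using x t_eq by blast
    show "component 0 y \<in> span (orbit_hh ` I)" if "y \<in> hh ` I" for y
      using that hh by (auto intro: span_base)
  qed
  then have "sc (of_nat s) x \<in> span (orbit_hh ` I)"
    using component_of_gr[OF IntD2[OF x]] by (simp only:)
  then have "sc (inverse (of_nat s)) (sc (of_nat s) x) \<in> span (orbit_hh ` I)"
    by (rule span_scale)
  then show "x \<in> span (orbit_hh ` I)" using s_pos by simp
qed

end

locale kac_algebra = twisted_chevalley_algebra sc br t b X \<alpha> e f \<sigma> \<pi> \<omega>
  for sc :: "'k::field_char_0 \<Rightarrow> 'g::ab_group_add \<Rightarrow> 'g" and br t b X \<alpha> e f \<sigma> \<pi> \<omega> +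
  fixes r :: nat and \<nu> :: "nat \<Rightarrow> 'g \<Rightarrow> 'k" and \<delta> :: "'g \<Rightarrow> 'k"
  assumes rank: "r = vector_space.dim sc (t \<inter> eigenspace sc \<sigma> (\<omega> ^ 0))"
    and simple_roots0: "bij_betw \<nu> {1..r}
      (simple_roots sc br (eigenspace sc \<sigma> (\<omega> ^ 0)) (t \<inter> eigenspace sc \<sigma> (\<omega> ^ 0)) (b \<inter> eigenspace sc \<sigma> (\<omega> ^ 0)))"
    and lowest: "is_lowest_weight sc br (eigenspace sc \<sigma> (\<omega> ^ 1)) (t \<inter> eigenspace sc \<sigma> (\<omega> ^ 0)) r \<nu> (\<lambda>h. - \<delta> h)"
begin

text \<open>Vertices whose simple roots have the same restriction lie in one orbit, hence
  \<open>orbit_hh\<close> factors through the restriction.\<close>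

lemma card_orbit_hh_le: "card (orbit_hh ` I) \<le> card ((\<lambda>i. res (unit i)) ` I)"
proof (rule surj_card_le)
  let ?G = "\<lambda>\<gamma>. orbit_hh (SOME i. i \<in> I \<and> res (unit i) = \<gamma>)"
  show "orbit_hh ` I \<subseteq> ?G ` ((\<lambda>i. res (unit i)) ` I)"
  proof
    fix y assume "y \<in> orbit_hh ` I"
    then obtain i where i: "i \<in> I" "y = orbit_hh i" by blast
    let ?j = "SOME j. j \<in> I \<and> res (unit j) = res (unit i)"
    have j: "?j \<in> I \<and> res (unit ?j) = res (unit i)"
      by (rule someI_ex) (use i in blast)
    then obtain k where "(\<pi> ^^ k) ?j = i" using res_unit_inj[of ?j i] i by blast
    then have "orbit_hh i = orbit_hh ?j" using orbit_hh_pi_pow j by metis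
    then show "y \<in> ?G ` ((\<lambda>i. res (unit i)) ` I)" using i by auto
  qed
qed simp

text \<open>The inclusion of the restricted simple roots of \<open>g\<close> in the simple roots of \<open>gr 0\<close> is an
  equality because the rank bounds the number of the latter.\<close>

lemma simple_roots0_eq: "\<nu> ` {1..r} = (\<lambda>i. res (unit i)) ` I"
proof -
  let ?S = "simple_roots sc br (gr 0) ts (b \<inter> gr 0)"
  have S: "\<nu> ` {1..r} = ?S" "finite ?S" "card ?S = r"
    using simple_roots0 bij_betw_finite[OF simple_roots0] bij_betw_same_card[OF simple_roots0]
    by (auto simp: bij_betw_def)
  have "r = dim ts" using rank by simp
  also have "\<dots> \<le> card (orbit_hh ` I)"
    by (rule dim_le_card[OF ts_subset_span_orbit_hh]) simp
  also have "\<dots> \<le> card ((\<lambda>i. res (unit i)) ` I)" by (rule card_orbit_hh_le)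
  finally have "(\<lambda>i. res (unit i)) ` I = ?S"
    using card_seteq[OF S(2), of "(\<lambda>i. res (unit i)) ` I"] res_unit_simple_root S(3) by blast
  then show ?thesis using S(1) by simp
qed

lemma nu_inj: "inj_on \<nu> {1..r}"
  using simple_roots0 by (simp add: bij_betw_def)

section \<open>Coordinates with respect to the simple roots of the fixed point algebra\<close>

definition lin :: "(nat \<Rightarrow> int) \<Rightarrow> 'g \<Rightarrow> 'k" where
  "lin n h = (\<Sum>i=1..r. of_int (n i) * \<nu> i h)"

lemma lin_add: "lin (\<lambda>i. n i + m i) = (\<lambda>h. lin n h + lin m h)"
  by (auto simp: lin_def sum.distrib algebra_simps)

lemma lin_diff: "lin (\<lambda>i. n i - m i) = (\<lambda>h. lin n h - lin m h)"
  by (auto simp: lin_def sum_subtractf algebra_simps)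

lemma lin_scale: "lin (\<lambda>i. k * n i) = (\<lambda>h. of_int k * lin n h)"
  by (auto simp: lin_def sum_distrib_left mult.assoc)

lemma res_sum_unit:
  assumes "finite A"
  shows "res (\<lambda>l. \<Sum>x\<in>A. n x * unit (u x) l) h = (\<Sum>x\<in>A. of_int (n x) * res (unit (u x)) h)"
proof (cases "h \<in> ts")
  case True
  have "wt (\<lambda>l. \<Sum>x\<in>A. n x * unit (u x) l) h
      = (\<Sum>l\<in>I. \<Sum>x\<in>A. of_int (n x) * (of_int (unit (u x) l) * \<alpha> l h))"
    by (simp add: wt_def sum_distrib_right mult.assoc)
  also have "\<dots> = (\<Sum>x\<in>A. of_int (n x) * wt (unit (u x)) h)"
    unfolding wt_def sum_distrib_left by (rule sum.swap)
  finally show ?thesis using True by (simp add: res_def)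
next
  case False
  then show ?thesis unfolding res_def by (simp only: if_False) simp
qed

text \<open>Lift each \<open>\<nu> i\<close> to a vertex \<open>u i\<close>. Different
  \<open>\<nu> i\<close> come from different orbits, so the orbit sum at \<open>u i0\<close>
  isolates the coefficient of \<open>\<nu> i0\<close>. This uniqueness gives meaning to the definite
  description in \<open>root_coeff\<close>.\<close>

lemma lin_eq_zero:
  assumes "lin n = (\<lambda>_. 0)" "i0 \<in> {1..r}"
  shows "n i0 = 0"
proof -
  have "\<forall>i\<in>{1..r}. \<exists>l\<in>I. \<nu> i = res (unit l)" using simple_roots0_eq by blast
  then obtain u where u: "\<And>i. i \<in> {1..r} \<Longrightarrow> u i \<in> I" "\<And>i. i \<in> {1..r} \<Longrightarrow> \<nu> i = res (unit (u i))"
    by metis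
  let ?c = "\<lambda>l. \<Sum>i=1..r. n i * unit (u i) l"
  have "res ?c = lin n"
    using u by (auto simp: res_sum_unit lin_def intro!: sum.cong)
  then have "res ?c = res (\<lambda>_. 0)" using assms(1) res_zero by simp
  then have "orbit_sum ?c (u i0) = 0"
    using res_eq_imp_orbit_sum_eq[of ?c "\<lambda>_. 0" "u i0"] u(1)[OF assms(2)] by (simp add: orbit_sum_linear)
  moreover have "orbit_sum ?c (u i0) = (\<Sum>i=1..r. n i * orbit_sum (unit (u i)) (u i0))"
    unfolding orbit_sum_def sum_distrib_left by (rule sum.swap)
  moreover have "orbit_sum (unit (u i)) (u i0) = 0" if "i \<in> {1..r}" "i \<noteq> i0" for i
  proof (rule ccontr)
    assume "orbit_sum (unit (u i)) (u i0) \<noteq> 0"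
    then obtain k where "(\<pi> ^^ k) (u i0) = u i" by (rule orbit_sum_unit_nonzero)
    then have "res (unit (u i)) = res (unit (u i0))" using res_unit_pi_pow[of k "u i0"] by (simp only:)
    then have "\<nu> i = \<nu> i0" by (simp only: u(2)[OF that(1)] u(2)[OF assms(2)])
    then show False using inj_onD[OF nu_inj _ that(1) assms(2)] that(2) by blast
  qed
  then have "(\<Sum>i=1..r. n i * orbit_sum (unit (u i)) (u i0))
      = (\<Sum>i=1..r. if i = i0 then n i0 * orbit_sum (unit (u i0)) (u i0) else 0)"
    by (intro sum.cong) auto
  ultimately have "n i0 * orbit_sum (unit (u i0)) (u i0) = 0" using assms(2) by simp
  then show ?thesis using orbit_sum_unit_pos[of "u i0"] by simp
qed

abbreviation coeff :: "('g \<Rightarrow> 'k) \<Rightarrow> nat \<Rightarrow> int" where "coeff \<equiv> root_coeff r \<nu>"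

lemma coeff_lin: assumes "\<And>i. i \<notin> {1..r} \<Longrightarrow> n i = 0" shows "coeff (lin n) = n"
  unfolding root_coeff_def
proof (rule the_equality)
  show "(\<forall>i. i \<notin> {1..r} \<longrightarrow> n i = 0) \<and> lin n = (\<lambda>h. \<Sum>i=1..r. of_int (n i) * \<nu> i h)"
    using assms by (auto simp: lin_def)
  fix m assume m: "(\<forall>i. i \<notin> {1..r} \<longrightarrow> m i = 0) \<and> lin n = (\<lambda>h. \<Sum>i=1..r. of_int (m i) * \<nu> i h)"
  then have "lin n = lin m" by (simp add: lin_def fun_eq_iff)
  then have "lin (\<lambda>i. m i - n i) = (\<lambda>_. 0)" by (simp add: lin_diff)
  then have "m i - n i = 0" if "i \<in> {1..r}" for i using lin_eq_zero[OF _ that, of "\<lambda>i. m i - n i"] by simp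
  then show "m = n" using m assms by (metis eq_iff_diff_eq_0 ext)
qed

text \<open>The functionals for which \<open>root_coeff\<close> is meaningful. The condition outside
  \<open>{1..r}\<close> matches the one in its definition.\<close>

definition lattice :: "('g \<Rightarrow> 'k) set" where
  "lattice = {lin n | n. \<forall>i. i \<notin> {1..r} \<longrightarrow> n i = 0}"

lemma latticeE:
  assumes "\<gamma> \<in> lattice"
  obtains n where "\<gamma> = lin n" "\<And>i. i \<notin> {1..r} \<Longrightarrow> n i = 0" "coeff \<gamma> = n"
  using assms coeff_lin by (auto simp: lattice_def)

lemma lattice_add:
  assumes "\<gamma> \<in> lattice" "\<mu> \<in> lattice"
  shows "(\<lambda>h. \<gamma> h + \<mu> h) \<in> lattice" "coeff (\<lambda>h. \<gamma> h + \<mu> h) i = coeff \<gamma> i + coeff \<mu> i"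
proof -
  obtain n where n: "\<gamma> = lin n" "\<And>i. i \<notin> {1..r} \<Longrightarrow> n i = 0" "coeff \<gamma> = n" using assms(1) by (rule latticeE) blast
  obtain m where m: "\<mu> = lin m" "\<And>i. i \<notin> {1..r} \<Longrightarrow> m i = 0" "coeff \<mu> = m" using assms(2) by (rule latticeE) blast
  have *: "(\<lambda>h. \<gamma> h + \<mu> h) = lin (\<lambda>i. n i + m i)" unfolding n(1) m(1) lin_add ..
  have 0: "n i + m i = 0" if "i \<notin> {1..r}" for i using n(2)[OF that] m(2)[OF that] by simp
  show "(\<lambda>h. \<gamma> h + \<mu> h) \<in> lattice" unfolding * lattice_def using 0 by blast
  show "coeff (\<lambda>h. \<gamma> h + \<mu> h) i = coeff \<gamma> i + coeff \<mu> i"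
    unfolding * n(3) m(3) by (subst coeff_lin) (use 0 in auto)
qed

lemma lattice_scale:
  assumes "\<gamma> \<in> lattice"
  shows "(\<lambda>h. of_int k * \<gamma> h) \<in> lattice" "coeff (\<lambda>h. of_int k * \<gamma> h) i = k * coeff \<gamma> i"
proof -
  obtain n where n: "\<gamma> = lin n" "\<And>i. i \<notin> {1..r} \<Longrightarrow> n i = 0" "coeff \<gamma> = n" using assms(1) by (rule latticeE) blast
  have *: "(\<lambda>h. of_int k * \<gamma> h) = lin (\<lambda>i. k * n i)" unfolding n(1) lin_scale ..
  have 0: "k * n i = 0" if "i \<notin> {1..r}" for i using n(2)[OF that] by simp
  show "(\<lambda>h. of_int k * \<gamma> h) \<in> lattice" unfolding * lattice_def using 0 by blast
  show "coeff (\<lambda>h. of_int k * \<gamma> h) i = k * coeff \<gamma> i"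
    unfolding * n(3) by (subst coeff_lin) (use 0 in auto)
qed

lemma res_lattice:
  assumes "\<And>i. i \<notin> I \<Longrightarrow> c i = 0"
  shows "res c \<in> lattice" "(\<And>i. 0 \<le> c i) \<Longrightarrow> 0 \<le> coeff (res c) i"
proof -
  have "\<forall>l\<in>I. \<exists>i\<in>{1..r}. res (unit l) = \<nu> i" using simple_roots0_eq by blast
  then obtain u where u: "\<And>l. l \<in> I \<Longrightarrow> u l \<in> {1..r}" "\<And>l. l \<in> I \<Longrightarrow> res (unit l) = \<nu> (u l)"
    by metis
  let ?n = "\<lambda>i. \<Sum>l\<in>{l \<in> I. u l = i}. c l"
  have c: "c = (\<lambda>l. \<Sum>x\<in>I. c x * unit x l)"
  proof
    fix l
    have "(\<Sum>x\<in>I. c x * unit x l) = (\<Sum>x\<in>I. if x = l then c l else 0)"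
      by (intro sum.cong) (auto simp: unit_def)
    then show "c l = (\<Sum>x\<in>I. c x * unit x l)" using assms[of l] by simp
  qed
  have "res c h = lin ?n h" for h
  proof -
    have "res c h = (\<Sum>l\<in>I. of_int (c l) * res (unit l) h)"
      by (subst c) (rule res_sum_unit[OF finite_I])
    also have "\<dots> = (\<Sum>l\<in>I. of_int (c l) * \<nu> (u l) h)" using u by (intro sum.cong) auto
    also have "\<dots> = (\<Sum>i=1..r. \<Sum>l\<in>{l \<in> I. u l = i}. of_int (c l) * \<nu> (u l) h)"
      using u(1) by (intro sum.group[symmetric]) auto
    also have "\<dots> = lin ?n h"
      unfolding lin_def by (intro sum.cong) (auto simp: sum_distrib_right)
    finally show ?thesis .
  qed
  then have res: "res c = lin ?n" by blast
  have 0: "?n i = 0" if "i \<notin> {1..r}" for i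
  proof -
    have "{l \<in> I. u l = i} = {}" using u(1) that by blast
    then show ?thesis by (simp only: sum.empty)
  qed
  show "res c \<in> lattice" unfolding res lattice_def using 0 by blast
  show "0 \<le> coeff (res c) i" if "\<And>i. 0 \<le> c i"
    unfolding res by (subst coeff_lin) (use 0 that in \<open>auto intro: sum_nonneg\<close>)
qed

lemma weights_lattice: assumes "\<gamma> \<in> wts j" shows "\<gamma> \<in> lattice"
proof -
  obtain c v where c: "\<gamma> = res c" "\<And>i. i \<notin> I \<Longrightarrow> c i = 0"
    using assms by (rule weight_is_res) blast
  show ?thesis unfolding c(1) by (rule res_lattice(1)) (rule c(2))
qed

lemma lowest_weight: "(\<lambda>h. - \<delta> h) \<in> wts 1"
  using lowest by (simp add: is_lowest_weight_def)

lemma delta_lattice: "\<delta> \<in> lattice"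
  using lattice_scale(1)[OF weights_lattice[OF lowest_weight], of "- 1"] by simp

abbreviation D :: "nat \<Rightarrow> int" where "D \<equiv> coeff \<delta>"

lemma weights1_ge: assumes "\<gamma> \<in> wts 1" shows "- D i \<le> coeff \<gamma> i"
proof -
  obtain n :: "nat \<Rightarrow> nat" where n: "\<gamma> = (\<lambda>h. - \<delta> h + (\<Sum>i=1..r. of_nat (n i) * \<nu> i h))"
    using lowest assms by (auto simp: is_lowest_weight_def)
  let ?n = "\<lambda>i. if i \<in> {1..r} then int (n i) else 0"
  have lin: "lin ?n = (\<lambda>h. \<gamma> h + \<delta> h)"
    unfolding n lin_def by (auto intro!: sum.cong)
  have "coeff (lin ?n) = ?n" by (rule coeff_lin) auto
  then have "coeff \<gamma> i + coeff \<delta> i = ?n i"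
    unfolding lin lattice_add(2)[OF weights_lattice[OF assms] delta_lattice, symmetric] by simp
  then show ?thesis by (auto split: if_splits)
qed

end

section \<open>Bounds for the weights\<close>

context kac_algebra
begin

lemma coeff_res_minus:
  assumes "\<And>i. i \<notin> I \<Longrightarrow> c i = 0"
  shows "coeff (res (\<lambda>j. - c j)) i = - coeff (res c) i"
  using lattice_scale(2)[OF res_lattice(1), of c "- 1" i] assms by (simp add: res_minus)

lemma coeff_res_add:
  assumes "\<And>i. i \<notin> I \<Longrightarrow> c i = 0" "\<And>i. i \<notin> I \<Longrightarrow> d i = 0"
  shows "coeff (res (\<lambda>j. c j + d j)) i = coeff (res c) i + coeff (res d) i"
  using lattice_add(2)[OF res_lattice(1) res_lattice(1), of c d i] assms by (simp add: res_add)

lemma nonfixed_ge: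
  assumes "v \<in> W c" "v \<noteq> 0" "\<And>i. i \<notin> I \<Longrightarrow> c i = 0" "c (\<pi> l) \<noteq> c l"
  shows "- D i \<le> coeff (res c) i"
  by (rule weights1_ge[OF weight_nonfixed[OF assms]])

lemma coeff_unit_nonneg: "i \<in> I \<Longrightarrow> 0 \<le> coeff (res (unit i)) l"
  by (rule res_lattice(2)) (auto simp: unit_outside, simp add: unit_def)

text \<open>The vector \<open>f i\<close> is moved by \<sigma>, so its restricted weight occurs in
  \<open>gr 1\<close> and lies above the lowest weight.\<close>

lemma D_ge_unit:
  assumes i: "i \<in> I" "\<pi> i \<noteq> i"
  shows "coeff (res (unit i)) l \<le> D l"
proof -
  have "- D l \<le> coeff (res (\<lambda>j. - unit i j)) l"
    by (rule nonfixed_ge[OF f_W[OF i(1)] f_nonzero[OF i(1)], where l = i])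
      (use i in \<open>auto simp: unit_outside unit_def\<close>)
  then show ?thesis using coeff_res_minus[of "unit i" l] unit_outside[OF i(1)] by simp
qed

lemma D_nonneg: "0 \<le> D l"
proof -
  obtain i where i: "i \<in> I" "\<pi> i \<noteq> i" by (rule moved_vertex)
  show ?thesis using D_ge_unit[OF i, of l] coeff_unit_nonneg[OF i(1), of l] by simp
qed

lemma br_hh: "br (hh i) x = br (e i) (br (f i) x) - br (f i) (br (e i) x)"
  using br_derivation[of "e i" "f i" x] by (simp add: hh_def)

text \<open>For triality the weights of \<open>gr 2\<close> are not controlled by the lowest weight of \<open>gr 1\<close>.
  Roots of \<open>g\<close> moved by \<open>\<pi>\<close> contribute equally to all \<open>gr j\<close>. For a root fixed by \<open>\<pi>\<close> we move
  to a root that is not fixed by applying \<open>e i\<close> for an outer vertex \<open>i\<close> of the diagram,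
  possibly after \<open>e 2\<close>.\<close>

lemma triality_weights2_ge:
  assumes s: "s = 3" and \<gamma>: "\<gamma> \<in> wts 2"
  shows "- 2 * D l \<le> coeff \<gamma> l"
proof -
  note [simp del] = One_nat_def
  have XD: "X = Type_D 4" and p2: "\<pi> 2 = 2" and p1: "\<pi> 1 \<noteq> 1" "\<pi> 3 \<noteq> 3" "\<pi> 4 \<noteq> 4"
    using s_cases s by auto
  have "dynkin_rank X = 4" using XD by simp
  then have I4: "I = {1..4}" unfolding I_def by simp
  then have I2: "2 \<in> I" by simp
  note I1 = I_nonempty
  have p12: "\<pi> 1 \<noteq> 2" using pi_inj[of 1 2] p2 by simp
  have fixed_vertex: "i = 2" if "i \<in> I" "\<pi> i = i" for i
  proof -
    have "1 \<le> i" "i \<le> 4" using that(1) unfolding I4 by simp_all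
    then have "i = 1 \<or> i = 2 \<or> i = 3 \<or> i = 4" by linarith
    then show ?thesis using p1 that(2) by blast
  qed
  have a12: "a 1 2 = - 1"
    using edge_D[of 1 2 4] unfolding XD cartan_matrix_def by simp
  have a21: "a 2 1 = - 1" using a12 cartan_matrix_sym by metis
  obtain c v where c: "\<gamma> = res c" "\<And>i. i \<notin> I \<Longrightarrow> c i = 0" "v \<in> W c" "component 2 v \<noteq> 0"
    using \<gamma> by (rule weight_is_res) blast
  define y where "y = component 2 v"
  show ?thesis
  proof (cases "\<exists>l. c (\<pi> l) \<noteq> c l")
    case True
    interpret T: Vector_Spaces.linear sc sc "component 2" by (rule linear_component)
    have "v \<noteq> 0" using c(4) T.zero by auto
    with True have "- D l \<le> coeff (res c) l" using nonfixed_ge[OF c(3) _ c(2)] by blast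
    then show ?thesis using D_nonneg[of l] unfolding c(1) by linarith
  next
    case False
    then have fix1: "c (\<pi> i) = c i" for i by blast
    have "c ((\<pi> ^^ k) i) = c i" for k i by (induction k) (simp_all add: fix1)
    \<comment> \<open>As \<open>c\<close> is fixed, \<sigma> preserves \<open>W c\<close>; thus the
      projection \<open>y\<close> is at once a weight vector for all of \<open>t\<close> and an
      eigenvector of \<sigma>.\<close>
    then have sv: "(\<sigma> ^^ k) v \<in> W c" if "k < s" for k
      using sigma_pow_W[OF c(3), of k] that by simp
    have y: "y \<in> W c" "y \<noteq> 0" "y \<in> gr 2"
      unfolding y_def component_def[of 2 v]
      using sv by (auto intro!: subspace_sum[OF subspace_W] subspace_scale[OF subspace_W])
        (use c(4) component_gr[of 2 v] in \<open>simp_all add: component_def\<close>)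
    have nf: "unit i (\<pi> i) + c (\<pi> i) \<noteq> unit i i + c i" if "\<pi> i \<noteq> i" for i
      using that fix1 by (simp add: unit_def)
    have out: "unit i j + c j = 0" "- unit i j + c j = 0" if "i \<in> I" "j \<notin> I" for i j
      using c(2)[OF that(2)] unit_outside[OF that] by simp_all
    have add: "coeff (res (\<lambda>j. unit i j + d j)) l = coeff (res (unit i)) l + coeff (res d) l"
      if "i \<in> I" "\<And>j. j \<notin> I \<Longrightarrow> d j = 0" for i d
      using coeff_res_add[of "unit i" d l] unit_outside that by simp
    have "- 2 * D l \<le> coeff (res c) l"
    proof (cases "\<forall>i. 0 \<le> c i")
      case True
      then show ?thesis using res_lattice(2)[of c l] c(2) D_nonneg[of l] by simp
    next
      case neg: False
      show ?thesis
      proof (cases "\<exists>i\<in>I. \<pi> i \<noteq> i \<and> br (e i) y \<noteq> 0")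
        case True
        then obtain i where i: "i \<in> I" "\<pi> i \<noteq> i" "br (e i) y \<noteq> 0" by blast
        \<comment> \<open>The raised weight is no longer fixed and costs at most D, and the added
          simple root costs at most another D.\<close>
        have "- D l \<le> coeff (res (\<lambda>j. unit i j + c j)) l"
          by (rule nonfixed_ge[OF W_br[OF e_W[OF i(1)] y(1)] i(3), where l = i])
            (use out i nf in auto)
        then show ?thesis using add[OF i(1) c(2)] D_ge_unit[OF i(1,2), of l] by simp
      next
        case e1: False
        then have e1y: "br (e 1) y = 0" using I1 p1(1) by blast
        show ?thesis
        proof (cases "br (f 1) y = 0")
          case False
          have "- D l \<le> coeff (res (\<lambda>j. - unit 1 j + c j)) l"
            by (rule nonfixed_ge[OF W_br[OF f_W[OF I1] y(1)] False, where l = 1])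
              (use out I1 p1(1) fix1 in \<open>auto simp: unit_def\<close>)
          moreover have "coeff (res (\<lambda>j. - unit 1 j + c j)) l = - coeff (res (unit 1)) l + coeff (res c) l"
            using coeff_res_add[of "\<lambda>j. - unit 1 j" c l] coeff_res_minus[of "unit 1" l] unit_outside[OF I1] c(2)
            by simp
          ultimately show ?thesis using coeff_unit_nonneg[OF I1, of l] D_nonneg[of l] by simp
        next
          case f1y: True
          let ?z = "br (e 2) y" and ?d = "\<lambda>j. unit 2 j + c j"
          have "br (hh 1) y = 0" unfolding br_hh e1y f1y by simp
          \<comment> \<open>Both \<open>e 1\<close> and \<open>f 1\<close> annihilate
            \<open>y\<close>, so the coroot \<open>hh 1\<close> acts on it by 0.\<close>
          then have wt1: "wt c (hh 1) = 0" using y(1,2) hh_in_t[OF I1] by (auto simp: W_def)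
          \<comment> \<open>Otherwise all \<open>e i\<close> annihilate \<open>y\<close>, which is
            possible only if \<open>y\<close> is a multiple of some \<open>f i\<close> with
            \<open>i\<close> fixed. Such a vector lies in \<open>gr 0\<close>, whereas
            \<open>y\<close> lies in \<open>gr 2\<close>.\<close>
          have "?z \<noteq> 0"
          proof
            assume z: "?z = 0"
            have ez: "br (e i) y = 0" if "i \<in> I" for i
              using e1 that fixed_vertex[OF that] z by blast
            have "\<forall>i. c i \<le> 0" using W_nonzero_sign[OF y(1,2) c(2)] neg by blast
            moreover have "c \<noteq> (\<lambda>_. 0)" using neg by auto
            moreover have "c \<noteq> (\<lambda>j. - unit i j)" if i: "i \<in> I" for i
            proof
              assume ci: "c = (\<lambda>j. - unit i j)"
              have "\<pi> i = i"
                using fix1[of i] unfolding ci by (auto simp: unit_def split: if_splits)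
              then have "\<sigma> (f i) = f i" using sigma_gen(2)[OF i] by simp
              moreover obtain k where k: "y = sc k (f i)"
                using y(1) W_minus_unit[OF i] unfolding ci by (auto simp: span_singleton)
              ultimately have "sc (\<omega> ^ 2) y = sc 1 y" using y(3) by (simp add: eigenspace_def \<sigma>.scale)
              then have "\<omega> ^ 2 = 1" using y(2) by (simp only: scale_cancel_right) simp
              then show False using omega_pow_neq_1[of 2] s by simp
            qed
            ultimately have "y = 0"
              using annihilated_by_raising_zero[OF y(1) _ _ c(2) _ ez] by blast
            then show False using y(2) by simp
          qed
          have "br (f 1) (e 2) = 0"
            unfolding br_anticomm[of "f 1" "e 2"] using e_f_zero[OF I2 I1] by simp
          then have f1z: "br (f 1) ?z = 0" by (simp add: br_derivation[of "f 1" "e 2" y] f1y)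
          have zW: "?z \<in> W ?d" by (rule W_br[OF e_W[OF I2] y(1)])
          have "wt ?d (hh 1) = - 1"
            by (simp only: wt_add wt_unit[OF I2] alpha_hh[OF I1 I2] a12 wt1) simp
          then have "br (hh 1) ?z = - ?z" using zW hh_in_t[OF I1] by (simp add: W_def)
          \<comment> \<open>A nonzero vector annihilated by \<open>f 1\<close> on which
            \<open>hh 1\<close> acts by -1 cannot be annihilated by \<open>e 1\<close>.\<close>
          then have e1z: "br (e 1) ?z \<noteq> 0" using \<open>?z \<noteq> 0\<close> br_hh[of 1 ?z] f1z by auto
          have "- D l \<le> coeff (res (\<lambda>j. unit 1 j + ?d j)) l"
            by (rule nonfixed_ge[OF W_br[OF e_W[OF I1] zW] e1z, where l = 1])
              (use out[OF I2] unit_outside[OF I1] p1(1) p2 p12 fix1 in \<open>auto simp: unit_def\<close>)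
          then have 1: "- D l \<le> coeff (res (unit 1)) l + (coeff (res (unit 2)) l + coeff (res c) l)"
            using add[OF I1 out(1)[OF I2]] add[OF I2 c(2)] by simp
          \<comment> \<open>A nonzero vector of non-fixed weight: it shows that the two simple roots
            added to \<open>c\<close> together cost at most D, as a single one did before.\<close>
          let ?w = "br (f 1) (f 2)" and ?u = "\<lambda>j. - unit 1 j + - unit 2 j"
          have "br (e 1) ?w = sc (- 1) (- f 2)"
          proof -
            have "br (e 1) ?w = br (hh 1) (f 2)"
              using e_f_zero[OF I1 I2] by (simp add: br_derivation[of "e 1" "f 1" "f 2"] hh_def)
            also have "\<dots> = sc (- \<alpha> 2 (hh 1)) (f 2)" by (rule f_weight[OF I2 hh_in_t[OF I1]])
            finally show ?thesis using alpha_hh[OF I1 I2] a12 by simp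
          qed
          then have w: "?w \<noteq> 0" using f_nonzero[OF I2] by auto
          have "- D l \<le> coeff (res ?u) l"
            by (rule nonfixed_ge[OF W_br[OF f_W[OF I1] f_W[OF I2]] w, where l = 1])
              (use unit_outside[OF I1] unit_outside[OF I2] p1(1) p2 p12 in \<open>auto simp: unit_def\<close>)
          moreover have "coeff (res ?u) l = - coeff (res (unit 1)) l + - coeff (res (unit 2)) l"
            using coeff_res_add[of "\<lambda>j. - unit 1 j" "\<lambda>j. - unit 2 j" l]
              coeff_res_minus[of "unit 1" l] coeff_res_minus[of "unit 2" l]
              unit_outside[OF I1] unit_outside[OF I2] by simp
          ultimately show ?thesis using 1 by linarith
        qed
      qed
    qed
    then show ?thesis using c(1) by simp
  qed
qed

lemma weights_ge:
  assumes "0 < j" "j < s" "\<gamma> \<in> wts j"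
  shows "- int j * D i \<le> coeff \<gamma> i"
proof -
  have "j = 1 \<or> (j = 2 \<and> s = 3)" using s_cases assms by auto
  then show ?thesis
  proof
    assume "j = 1"
    then show ?thesis using weights1_ge[of \<gamma> i] assms(3) by simp
  next
    assume "j = 2 \<and> s = 3"
    then show ?thesis using triality_weights2_ge[of \<gamma> i] assms(3) by simp
  qed
qed

lemma weights_le:
  assumes "0 < j" "j < s" "\<gamma> \<in> wts j"
  shows "coeff \<gamma> i \<le> (int s - int j) * D i"
proof -
  have "- int (s - j) * D i \<le> coeff (\<lambda>h. - \<gamma> h) i"
    using weights_ge[of "s - j"] weights_dual[of \<gamma> j] assms by simp
  then show ?thesis
    using lattice_scale(2)[OF weights_lattice[OF assms(3)], of "- 1" i] assms(2)
    by (simp add: of_nat_diff algebra_simps)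
qed

section \<open>Weights of the fixed point algebra\<close>

lemma span_gr: assumes "y \<in> gr j" shows "y \<in> span {z. \<exists>c. (\<forall>i. i \<notin> I \<longrightarrow> c i = 0) \<and> z \<in> wsp j (res c)}"
    (is "y \<in> span ?A")
proof -
  have "component j y \<in> span ?A"
  proof (rule linear_image_span[OF linear_component _ _ subspace_span])
    show "y \<in> span {g. \<exists>c. gen c g}" using span_gen by simp
    show "component j g \<in> span ?A" if "g \<in> {g. \<exists>c. gen c g}" for g
      using that component_weight[OF gen_W] gen_support by (blast intro: span_base)
  qed
  then have "sc (of_nat s) y \<in> span ?A" by (simp only: component_of_gr[OF assms])
  then have "sc (inverse (of_nat s)) (sc (of_nat s) y) \<in> span ?A" by (rule span_scale)
  then show ?thesis using s_pos by simp
qed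

lemma centralizer_trivial:
  assumes x: "x \<in> gr 0" "\<And>j y. 0 < j \<Longrightarrow> j < s \<Longrightarrow> y \<in> gr j \<Longrightarrow> br x y = 0"
  shows "x = 0"
proof -
  let ?C = "{x \<in> gr 0. \<forall>j y. 0 < j \<longrightarrow> j < s \<longrightarrow> y \<in> gr j \<longrightarrow> br x y = 0}"
  have sub: "subspace ?C"
    using subspace_gr[of 0] by (auto simp: subspace_def br_add_left br_scale_left)
  have "br z x \<in> ?C" if x: "x \<in> ?C" for z x
  proof (rule linear_image_span[OF linear_ad' _ _ sub])
    show "z \<in> span {x. \<exists>j<s. \<exists>c. (\<forall>i. i \<notin> I \<longrightarrow> c i = 0) \<and> x \<in> wsp j (res c)}"
      using span_weight_vectors by simp
    fix g assume "g \<in> {x. \<exists>j<s. \<exists>c. (\<forall>i. i \<notin> I \<longrightarrow> c i = 0) \<and> x \<in> wsp j (res c)}"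
    then obtain j where j: "j < s" "g \<in> gr j" by (auto simp: weight_space_def)
    \<comment> \<open>For \<open>j\<close> > 0 the bracket is 0 by definition of \<open>?C\<close>,
      so only stability under \<open>gr 0\<close> requires the Jacobi identity.\<close>
    show "br g x \<in> ?C"
    proof (cases "j = 0")
      case True
      have "br (br g x) y = br g (br x y) - br x (br g y)" for y
        using br_derivation[of g x y] by simp
      moreover have "br g y \<in> gr k" if "y \<in> gr k" for y k
        using gr_br[of g 0 y k] j True that by simp
      moreover have "br g x \<in> gr 0" using gr_br[of g 0 x 0] j True x by simp
      ultimately show ?thesis using x by simp
    next
      case False
      then have "br g x = 0" using x j by (simp add: br_anticomm[of g x])
      then show ?thesis using subspace_0[OF sub] by simp
    qed
  qed
  then have "lie_ideal sc br ?C" using sub by (simp only: lie_ideal_def) blast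
  moreover have "?C \<noteq> UNIV"
  proof
    obtain i where i: "i \<in> I" "\<pi> i \<noteq> i" by (rule moved_vertex)
    assume "?C = UNIV"
    then have "e i \<in> gr 0" by blast
    then have "e (\<pi> i) = e i" using sigma_gen(1)[OF i(1)] by (simp add: eigenspace_def)
    then show False using e_inj[of "\<pi> i" i] i by simp
  qed
  ultimately have "?C = {0}" using ideal_trivial by blast
  then show ?thesis using x by blast
qed

text \<open>The common sign is inherited from a root of the whole algebra that restricts to
  \<gamma>. The size is bounded by writing \<gamma> as a difference of two weights of one
  \<open>gr j\<close> with 0 < \<open>j\<close> < \<open>s\<close>.\<close>

lemma weights0_bounds:
  assumes "\<gamma> \<in> wts 0"
  shows "(\<forall>i. 0 \<le> coeff \<gamma> i \<and> coeff \<gamma> i \<le> int s * D i) \<or>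
    (\<forall>i. - int s * D i \<le> coeff \<gamma> i \<and> coeff \<gamma> i \<le> 0)"
proof -
  obtain c v where c: "\<gamma> = res c" "\<And>i. i \<notin> I \<Longrightarrow> c i = 0" "v \<in> W c" "component 0 v \<noteq> 0"
    using assms by (rule weight_is_res) blast
  interpret T: Vector_Spaces.linear sc sc "component 0" by (rule linear_component)
  have v: "v \<noteq> 0" using c(4) T.zero by auto
  have "(\<forall>i. 0 \<le> coeff \<gamma> i) \<or> (\<forall>i. coeff \<gamma> i \<le> 0)"
  proof (cases "\<forall>i. 0 \<le> c i")
    case True
    then show ?thesis using res_lattice(2)[of c] c(1,2) by blast
  next
    case False
    then have "\<forall>i. 0 \<le> - c i" using W_nonzero_sign[OF c(3) v c(2)] by force
    then have le: "0 \<le> coeff (res (\<lambda>j. - c j)) i" for i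
      using res_lattice(2)[of "\<lambda>j. - c j" i] c(2) by simp
    have "coeff \<gamma> i \<le> 0" for i using le[of i] coeff_res_minus[of c i] c(1,2) by simp
    then show ?thesis by blast
  qed
  moreover have "- int s * D i \<le> coeff \<gamma> i \<and> coeff \<gamma> i \<le> int s * D i" for i
  proof -
    obtain x where x: "x \<in> wsp 0 \<gamma>" "x \<noteq> 0" using assms by (rule wtsE)
    have "x \<in> gr 0" using x(1) by (simp add: weight_space_def)
    then obtain j y where j: "0 < j" "j < s" "y \<in> gr j" "br x y \<noteq> 0"
      using centralizer_trivial[of x] x(2) by blast
    \<comment> \<open>The element \<open>y\<close> of \<open>gr j\<close> may be replaced by a
      weight vector, because these span \<open>gr j\<close>.\<close>
    have "\<exists>z\<in>{z. \<exists>c. (\<forall>i. i \<notin> I \<longrightarrow> c i = 0) \<and> z \<in> wsp j (res c)}. br x z \<noteq> 0"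
    proof (rule ccontr)
      assume "\<not> ?thesis"
      then have "br x y \<in> {0}"
        using linear_image_span[OF linear_ad span_gr[OF j(3)], of x "{0}"] by auto
      then show False using j(4) by blast
    qed
    then obtain z d where z: "z \<in> wsp j (res d)" "br x z \<noteq> 0" "\<And>i. i \<notin> I \<Longrightarrow> d i = 0" by blast
    have "br x z \<in> wsp j (\<lambda>h. \<gamma> h + res d h)"
      using x(1) z(1) gr_br[of x 0 z j]
      by (auto simp: weight_space_def br_derivation[of _ x z] br_scale_left br_scale_right scale_left_distrib)
    then have xz: "res (\<lambda>i. c i + d i) \<in> wts j"
      unfolding res_add c(1)[symmetric]
      by (rule wtsI[OF _ z(2)]) (use res_dual[of "\<lambda>i. c i + d i"] in \<open>simp add: res_add c(1)\<close>)
    have "z \<noteq> 0" using z(2) by auto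
    then have zd: "res d \<in> wts j" using wtsI[OF z(1) _ res_dual] by blast
    have "coeff (res (\<lambda>i. c i + d i)) i = coeff \<gamma> i + coeff (res d) i"
      using coeff_res_add[of c d i] c z(3) by simp
    then show ?thesis
      using weights_ge[OF j(1,2) xz, of i] weights_le[OF j(1,2) xz, of i]
        weights_ge[OF j(1,2) zd, of i] weights_le[OF j(1,2) zd, of i]
      by (simp add: algebra_simps)
  qed
  ultimately show ?thesis by blast
qed

end

section \<open>Contractions\<close>

text \<open>Spanning provides the existence half of the definite description in
  \<open>eigen_component\<close>; the uniqueness half is
  \<open>eigen_component_unique\<close>.\<close>

lemma eigen_component_properties:
  fixes sc :: "'k::field \<Rightarrow> 'g::ab_group_add \<Rightarrow> 'g"
  assumes lin: "Vector_Spaces.linear sc sc \<theta>" and prim: "primitive_root_of_unity m \<zeta>"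
    and span: "module.span sc (\<Union>i<m. eigenspace sc \<theta> (\<zeta> ^ i)) = UNIV"
  shows "\<And>x i. i < m \<Longrightarrow> eigen_component sc \<theta> m \<zeta> x i \<in> eigenspace sc \<theta> (\<zeta> ^ i)"
    and "\<And>x i. m \<le> i \<Longrightarrow> eigen_component sc \<theta> m \<zeta> x i = 0"
    and "\<And>x. x = (\<Sum>i<m. eigen_component sc \<theta> m \<zeta> x i)"
proof -
  interpret L: Vector_Spaces.linear sc sc \<theta> by fact
  let ?P = "\<lambda>x c. (\<forall>i<m. c i \<in> eigenspace sc \<theta> (\<zeta> ^ i)) \<and> (\<forall>i\<ge>m. c i = 0) \<and> x = (\<Sum>i<m. c i)"
  have "\<exists>c. ?P x c" for x
  proof -
    have "x \<in> L.vs1.span (\<Union>i<m. eigenspace sc \<theta> (\<zeta> ^ i))" using span by simp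
    then show ?thesis
    proof (induction rule: L.vs1.span_induct_alt)
      case base
      show ?case by (rule exI[of _ "\<lambda>_. 0"]) (simp add: eigenspace_def L.zero)
    next
      case (step a g y)
      then obtain c i where c: "?P y c" and i: "i < m" "g \<in> eigenspace sc \<theta> (\<zeta> ^ i)" by blast
      let ?c = "\<lambda>l. (if l = i then sc a g else 0) + c l"
      have "?c l \<in> eigenspace sc \<theta> (\<zeta> ^ l)" if "l < m" for l
      proof -
        have "sc a g \<in> eigenspace sc \<theta> (\<zeta> ^ i)"
          using i(2) by (simp add: eigenspace_def L.scale mult.commute)
        moreover have "c l \<in> eigenspace sc \<theta> (\<zeta> ^ l)" using c that by blast
        ultimately show ?thesis by (simp add: eigenspace_def L.add L.vs1.scale_right_distrib)
      qed
      moreover have "?c l = 0" if "m \<le> l" for l using c i that by simp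
      moreover have "sc a g + y = (\<Sum>l<m. ?c l)" using c i by (simp add: sum.distrib)
      ultimately show ?case by (intro exI[of _ ?c]) simp
    qed
  qed
  then have "?P x (eigen_component sc \<theta> m \<zeta> x)" for x
    using eigen_component_unique[OF lin prim] by metis
  then show "\<And>x i. i < m \<Longrightarrow> eigen_component sc \<theta> m \<zeta> x i \<in> eigenspace sc \<theta> (\<zeta> ^ i)"
    and "\<And>x i. m \<le> i \<Longrightarrow> eigen_component sc \<theta> m \<zeta> x i = 0"
    and "\<And>x. x = (\<Sum>i<m. eigen_component sc \<theta> m \<zeta> x i)"
    by blast+
qed

lemma linear_eigen_component:
  fixes sc :: "'k::field \<Rightarrow> 'g::ab_group_add \<Rightarrow> 'g"
  assumes lin: "Vector_Spaces.linear sc sc \<theta>" and prim: "primitive_root_of_unity m \<zeta>"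
    and span: "module.span sc (\<Union>i<m. eigenspace sc \<theta> (\<zeta> ^ i)) = UNIV"
  shows "Vector_Spaces.linear sc sc (\<lambda>x. eigen_component sc \<theta> m \<zeta> x i)"
proof -
  interpret L: Vector_Spaces.linear sc sc \<theta> by fact
  let ?e = "eigen_component sc \<theta> m \<zeta>"
  note P = eigen_component_properties[OF assms]
  have "?e (x + y) = (\<lambda>i. ?e x i + ?e y i)" for x y
  proof -
    have "x + y = (\<Sum>i<m. ?e x i + ?e y i)" using P(3)[of x] P(3)[of y] by (simp add: sum.distrib)
    moreover have "?e (\<Sum>i<m. ?e x i + ?e y i) = (\<lambda>i. ?e x i + ?e y i)"
      by (rule eigen_component_unique[OF lin prim])
        (use P(1,2) in \<open>auto simp: eigenspace_def L.add L.vs1.scale_right_distrib\<close>)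
    ultimately show ?thesis by simp
  qed
  moreover have "?e (sc a x) = (\<lambda>i. sc a (?e x i))" for a x
  proof -
    have "sc a x = (\<Sum>i<m. sc a (?e x i))" using P(3)[of x] by (metis L.vs1.scale_sum_right)
    moreover have "?e (\<Sum>i<m. sc a (?e x i)) = (\<lambda>i. sc a (?e x i))"
      by (rule eigen_component_unique[OF lin prim])
        (use P(1,2) in \<open>auto simp: eigenspace_def L.scale mult.commute\<close>)
    ultimately show ?thesis by simp
  qed
  ultimately show ?thesis by unfold_locales simp_all
qed

lemma (in lie_algebra) linear_contraction:
  assumes "Vector_Spaces.linear sc sc \<theta>" "primitive_root_of_unity m \<zeta>"
    and "span (\<Union>i<m. eigenspace sc \<theta> (\<zeta> ^ i)) = UNIV"
  shows "Vector_Spaces.linear sc sc (contraction sc br \<theta> m \<zeta> x)"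
    and "Vector_Spaces.linear sc sc (\<lambda>x. contraction sc br \<theta> m \<zeta> x y)"
proof -
  interpret E: Vector_Spaces.linear sc sc "\<lambda>x. eigen_component sc \<theta> m \<zeta> x i" for i
    by (rule linear_eigen_component[OF assms])
  show "Vector_Spaces.linear sc sc (contraction sc br \<theta> m \<zeta> x)"
    by unfold_locales
      (auto simp: contraction_def E.add E.scale br_add_right br_scale_right scale_sum_right
        simp flip: sum.distrib intro!: sum.cong)
  show "Vector_Spaces.linear sc sc (\<lambda>x. contraction sc br \<theta> m \<zeta> x y)"
    by unfold_locales
      (auto simp: contraction_def E.add E.scale br_add_left br_scale_left scale_sum_right
        simp flip: sum.distrib intro!: sum.cong)
qed

lemma (in vector_space) bilinear_eq_on_span:
  assumes "span A = UNIV"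
    and "\<And>x. Vector_Spaces.linear scale scale (P x)" "\<And>y. Vector_Spaces.linear scale scale (\<lambda>x. P x y)"
    and "\<And>x. Vector_Spaces.linear scale scale (Q x)" "\<And>y. Vector_Spaces.linear scale scale (\<lambda>x. Q x y)"
    and eq: "\<And>x y. x \<in> A \<Longrightarrow> y \<in> A \<Longrightarrow> P x y = Q x y"
  shows "P = Q"
proof -
  have eq_linear: "S x = T x"
    if "Vector_Spaces.linear scale scale S" "Vector_Spaces.linear scale scale T" "\<And>x. x \<in> A \<Longrightarrow> S x = T x" for S T x
  proof -
    interpret S: Vector_Spaces.linear scale scale S by fact
    interpret T: Vector_Spaces.linear scale scale T by fact
    have "x \<in> span A" using assms(1) by simp
    then show ?thesis
      by (induction rule: span_induct_alt)
        (simp_all add: S.add S.scale S.zero T.add T.scale T.zero that(3))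
  qed
  have "P x y = Q x y" if "y \<in> A" for x y
    by (rule eq_linear[OF assms(3,5)]) (rule eq[OF _ that])
  then have "P x y = Q x y" for x y
    by (rule eq_linear[OF assms(2,4)])
  then show ?thesis by blast
qed

text \<open>The degree of an affine weight with coordinates \<open>n\<close> in the grading that
  gives the \<open>i\<close>-th affine simple root degree \<open>p i\<close>.\<close>

definition pairing :: "nat \<Rightarrow> (nat \<Rightarrow> nat) \<Rightarrow> (nat \<Rightarrow> int) \<Rightarrow> int" where
  "pairing r p n = (\<Sum>i=0..r. n i * int (p i))"

lemma pairing_linear:
  "pairing r p (\<lambda>i. n i + k i) = pairing r p n + pairing r p k"
  "pairing r p (\<lambda>i. n i - k i) = pairing r p n - pairing r p k"
  "pairing r p (\<lambda>i. z * n i) = z * pairing r p n"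
  by (simp_all add: pairing_def algebra_simps sum.distrib sum_subtractf sum_distrib_left)

text \<open>The gap to the pairing with \<open>M\<close> is a sum of nonnegative terms. It closes
  only termwise, and a term with nonzero label vanishes exactly when \<open>n i = M i\<close>; the
  size of the label is irrelevant.\<close>

lemma pairing_bounds:
  assumes "\<And>i. 0 \<le> n i" "\<And>i. n i \<le> M i"
  shows "0 \<le> pairing r p n" "pairing r p n \<le> pairing r p M"
    "pairing r p n = pairing r p M \<longleftrightarrow> (\<forall>i\<in>{i \<in> {0..r}. p i \<noteq> 0}. n i = M i)"
proof -
  show "0 \<le> pairing r p n" "pairing r p n \<le> pairing r p M"
    unfolding pairing_def using assms by (auto intro!: sum_nonneg sum_mono mult_right_mono)
  have "pairing r p n = pairing r p M \<longleftrightarrow> (\<Sum>i=0..r. (M i - n i) * int (p i)) = 0"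
    by (auto simp: pairing_def sum_subtractf algebra_simps)
  also have "\<dots> \<longleftrightarrow> (\<forall>i\<in>{0..r}. (M i - n i) * int (p i) = 0)"
    by (rule sum_nonneg_eq_0_iff) (use assms in auto)
  finally show "pairing r p n = pairing r p M \<longleftrightarrow> (\<forall>i\<in>{i \<in> {0..r}. p i \<noteq> 0}. n i = M i)"
    by (auto simp: eq_commute[of "n _"])
qed

text \<open>The residues of \<open>d1\<close>, \<open>d2\<close> only differ from them at the upper end \<open>m\<close>, and whether
  \<open>pairing r p n = m\<close> is decided by the support of \<open>p\<close>.\<close>

lemma residue_sum_criterion:
  fixes d1 d2 d3 m k :: int
  assumes "0 \<le> d1" "d1 \<le> m" "0 \<le> d2" "d2 \<le> m" "0 \<le> d3" "d3 \<le> m" "0 < m" "d3 = d1 + d2 - k * m"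
  shows "d1 mod m + d2 mod m < m \<longleftrightarrow> d1 = m \<or> d2 = m \<or> k < 0 \<or> k = 0 \<and> d3 \<noteq> m"
proof -
  have mod: "d mod m = d" if "0 \<le> d" "d \<le> m" "d \<noteq> m" for d
    using that by simp
  show ?thesis
  proof (cases "d1 = m \<or> d2 = m")
    case True
    then show ?thesis using pos_mod_bound[OF assms(7)] assms(7) by auto
  next
    case False
    have "d1 mod m + d2 mod m = d1 + d2" using mod assms(1-4) False by simp
    \<comment> \<open>As \<open>d3\<close> lies between 0 and \<open>m\<close>, the sum
      \<open>d1 + d2\<close> is at least \<open>m\<close> for \<open>k\<close> > 0, at most 0 for
      \<open>k\<close> < 0, and equal to \<open>d3\<close> for \<open>k = 0\<close>.\<close>
    moreover have "m \<le> k * m" if "0 < k" using mult_right_mono[of 1 k m] that assms(7) by simp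
    moreover have "k * m \<le> - m" if "k < 0" using mult_right_mono[of k "- 1" m] that assms(7) by simp
    moreover have "k * m = 0" if "k = 0" using that by simp
    ultimately show ?thesis using assms False by linarith
  qed
qed

lemma residue_sum_depends_on_support:
  assumes n: "\<And>i. 0 \<le> n1 i \<and> n1 i \<le> M i" "\<And>i. 0 \<le> n2 i \<and> n2 i \<le> M i" "\<And>i. 0 \<le> n3 i \<and> n3 i \<le> M i"
    and n3: "\<And>i. n3 i = n1 i + n2 i - k * M i"
    and pos: "0 < pairing r p M" "0 < pairing r p' M"
    and supp: "{i \<in> {0..r}. p i \<noteq> 0} = {i \<in> {0..r}. p' i \<noteq> 0}"
  shows "pairing r p n1 mod pairing r p M + pairing r p n2 mod pairing r p M < pairing r p M \<longleftrightarrow>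
    pairing r p' n1 mod pairing r p' M + pairing r p' n2 mod pairing r p' M < pairing r p' M"
proof -
  have "n3 = (\<lambda>i. n1 i + n2 i - k * M i)" using n3 by blast
  then have e: "pairing r q n3 = pairing r q n1 + pairing r q n2 - k * pairing r q M" for q
    by (simp add: pairing_linear)
  have full: "pairing r p n' = pairing r p M \<longleftrightarrow> pairing r p' n' = pairing r p' M"
    if "\<And>i. 0 \<le> n' i \<and> n' i \<le> M i" for n'
  proof -
    have "pairing r q n' = pairing r q M \<longleftrightarrow> (\<forall>i\<in>{i \<in> {0..r}. q i \<noteq> 0}. n' i = M i)" for q
      using that by (intro pairing_bounds(3)) auto
    then show ?thesis by (simp only: supp)
  qed
  have crit: "pairing r q n1 mod pairing r q M + pairing r q n2 mod pairing r q M < pairing r q M \<longleftrightarrow>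
      pairing r q n1 = pairing r q M \<or> pairing r q n2 = pairing r q M \<or> k < 0 \<or>
      k = 0 \<and> pairing r q n3 \<noteq> pairing r q M" if "0 < pairing r q M" for q
    by (rule residue_sum_criterion[OF _ _ _ _ _ _ that e]) (use n in \<open>auto intro!: pairing_bounds\<close>)
  show ?thesis
    unfolding crit[OF pos(1)] crit[OF pos(2)] using full[OF n(1)] full[OF n(2)] full[OF n(3)] by simp
qed

section \<open>Contracted brackets of weight vectors\<close>

context kac_algebra
begin

text \<open>The coordinates of the affine weight belonging to \<open>\<gamma>\<close> and \<open>j\<close>; the zeroth one is the
  coefficient of the affine simple root \<open>- \<delta>\<close>. The vector \<open>M\<close> below is the imaginary root.\<close>

definition degree_vector :: "nat \<Rightarrow> ('g \<Rightarrow> 'k) \<Rightarrow> nat \<Rightarrow> int" where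
  "degree_vector j \<gamma> i = (if i = 0 then int j else coeff \<gamma> i + int j * D i)"

definition M :: "nat \<Rightarrow> int" where
  "M i = (if i = 0 then int s else int s * D i)"

lemma sum_from_0: "(\<Sum>i=0..r. u i) = u 0 + (\<Sum>i=1..r. u i)" for u :: "nat \<Rightarrow> int"
  using sum.atLeast_Suc_atMost[of 0 r u] by simp

lemma kac_degree_eq:
  assumes "\<gamma> \<in> lattice"
  shows "kac_degree r \<nu> \<delta> p j \<gamma> = pairing r p (degree_vector j \<gamma>)"
proof -
  have "coeff (\<lambda>h. \<gamma> h + of_nat j * \<delta> h) i = coeff \<gamma> i + int j * D i" for i
    using lattice_add(2)[OF assms lattice_scale(1)[OF delta_lattice, of "int j"], of i]
      lattice_scale(2)[OF delta_lattice, of "int j" i] by simp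
  then show ?thesis
    unfolding kac_degree_def pairing_def sum_from_0 degree_vector_def by simp
qed

lemma kac_order_eq: "kac_order s r \<nu> \<delta> p = pairing r p M"
  unfolding kac_order_def pairing_def sum_from_0 M_def kac_mark_def
  by (simp add: sum_distrib_left algebra_simps)

text \<open>A nonpositive weight of \<open>gr 0\<close> is shifted up by one imaginary root; all
  other weights are in range already. The shift changes the pairing with \<open>p\<close> by a
  multiple of the order and leaves the residue alone.\<close>

lemma degree_vector_normalised:
  assumes "\<gamma> \<in> wts j" "j < s"
  obtains n z where "\<And>i. 0 \<le> n i \<and> n i \<le> M i" "\<And>i. degree_vector j \<gamma> i = n i - z * M i"
proof (cases "j = 0")
  case False
  have "0 \<le> degree_vector j \<gamma> i \<and> degree_vector j \<gamma> i \<le> M i" for i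
    using weights_ge[of j \<gamma> i] weights_le[of j \<gamma> i] assms False
    by (auto simp: degree_vector_def M_def algebra_simps)
  then show ?thesis using that[of "degree_vector j \<gamma>" 0] by simp
next
  case True
  from weights0_bounds[of \<gamma>] assms(1) True
  consider "\<And>i. 0 \<le> coeff \<gamma> i \<and> coeff \<gamma> i \<le> int s * D i"
    | "\<And>i. - int s * D i \<le> coeff \<gamma> i \<and> coeff \<gamma> i \<le> 0" by blast
  then show ?thesis
  proof cases
    case 1
    then have "0 \<le> degree_vector j \<gamma> i \<and> degree_vector j \<gamma> i \<le> M i" for i
      by (simp add: degree_vector_def M_def True)
    then show ?thesis using that[of "degree_vector j \<gamma>" 0] by simp
  next
    case 2
    have "0 \<le> degree_vector j \<gamma> i + M i \<and> degree_vector j \<gamma> i + M i \<le> M i" if "i \<noteq> 0" for i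
      using 2[of i] that by (simp add: degree_vector_def M_def True)
    moreover have "degree_vector j \<gamma> 0 + M 0 = M 0" "0 \<le> M 0"
      by (simp_all add: degree_vector_def M_def True)
    ultimately have "0 \<le> degree_vector j \<gamma> i + M i \<and> degree_vector j \<gamma> i + M i \<le> M i" for i
      by (cases "i = 0") auto
    then show ?thesis using that[of "\<lambda>i. degree_vector j \<gamma> i + M i" 1] by simp
  qed
qed

abbreviation weight_vectors :: "'g set" where
  "weight_vectors \<equiv> {x. \<exists>j<s. \<exists>c. (\<forall>i. i \<notin> I \<longrightarrow> c i = 0) \<and> x \<in> wsp j (res c)}"

lemma kac_residue_eigenspace:
  assumes kac: "is_kac_automorphism sc br s (\<lambda>j. gr j) ts r \<nu> \<delta> p \<zeta> \<theta>"
    and prim: "primitive_root_of_unity m \<zeta>"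
    and x: "x \<in> wsp j \<gamma>" "j < s" "\<gamma> \<in> wts j"
  shows "x \<in> eigenspace sc \<theta> (\<zeta> ^ nat (pairing r p (degree_vector j \<gamma>) mod int m))"
proof -
  let ?d = "pairing r p (degree_vector j \<gamma>)"
  have m: "0 < m" "\<zeta> ^ m = 1" using prim by (simp_all add: primitive_root_of_unity_def)
  then have nz: "\<zeta> \<noteq> 0" by (auto simp: power_0_left)
  have "\<theta> x = sc (\<zeta> powi ?d) x"
    using kac x kac_degree_eq[OF weights_lattice[OF x(3)], of p j] by (auto simp: is_kac_automorphism_def)
  also have "\<zeta> powi ?d = \<zeta> powi (int m * (?d div int m)) * \<zeta> powi (?d mod int m)"
    using nz by (simp flip: power_int_add)
  also have "\<zeta> powi (int m * (?d div int m)) = 1"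
    using m(2) by (simp add: power_int_mult)
  also have "\<zeta> powi (?d mod int m) = \<zeta> ^ nat (?d mod int m)"
    using m(1) by (simp add: power_int_def)
  finally show ?thesis by (simp add: eigenspace_def)
qed

lemma kac_span_eigenspaces:
  assumes kac: "is_kac_automorphism sc br s (\<lambda>j. gr j) ts r \<nu> \<delta> p \<zeta> \<theta>"
    and prim: "primitive_root_of_unity m \<zeta>"
  shows "span (\<Union>i<m. eigenspace sc \<theta> (\<zeta> ^ i)) = UNIV"
proof -
  interpret \<theta>: Vector_Spaces.linear sc sc \<theta>
    using kac by (simp add: is_kac_automorphism_def lie_automorphism_def)
  have m: "0 < m" using prim by (simp add: primitive_root_of_unity_def)
  have "x \<in> (\<Union>i<m. eigenspace sc \<theta> (\<zeta> ^ i))" if x: "x \<in> weight_vectors" for x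
  proof (cases "x = 0")
    case True
    then show ?thesis using m by (auto simp: eigenspace_def \<theta>.zero)
  next
    case False
    obtain j c where j: "j < s" "x \<in> wsp j (res c)" using x by blast
    have "res c \<in> wts j" by (rule wtsI[OF j(2) False res_dual])
    from kac_residue_eigenspace[OF kac prim j(2,1) this]
    show ?thesis using m by (auto simp: nat_less_iff)
  qed
  then have "weight_vectors \<subseteq> (\<Union>i<m. eigenspace sc \<theta> (\<zeta> ^ i))" by blast
  from span_mono[OF this] show ?thesis using span_weight_vectors by auto
qed

lemma contraction_weight_vectors:
  assumes kac: "is_kac_automorphism sc br s (\<lambda>j. gr j) ts r \<nu> \<delta> p \<zeta> \<theta>"
    and prim: "primitive_root_of_unity m \<zeta>" and m: "int m = pairing r p M"
    and x: "x \<in> wsp j \<gamma>" "j < s" "\<gamma> \<in> wts j" and y: "y \<in> wsp k \<mu>" "k < s" "\<mu> \<in> wts k"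
  shows "contraction sc br \<theta> m \<zeta> x y =
    (if pairing r p (degree_vector j \<gamma>) mod pairing r p M + pairing r p (degree_vector k \<mu>) mod pairing r p M
      < pairing r p M then br x y else 0)"
proof -
  have m0: "0 < m" using prim by (simp add: primitive_root_of_unity_def)
  have lin: "Vector_Spaces.linear sc sc \<theta>"
    using kac by (simp add: is_kac_automorphism_def lie_automorphism_def)
  let ?i = "nat (pairing r p (degree_vector j \<gamma>) mod int m)"
  let ?k = "nat (pairing r p (degree_vector k \<mu>) mod int m)"
  have lt: "?i < m" "?k < m" using m0 by (simp_all add: nat_less_iff)
  have nn: "0 \<le> d mod int m" for d using m0 by simp
  \<comment> \<open>The subtraction is one of natural numbers, and 0 < \<open>m\<close> makes the
    condition a strict inequality.\<close>
  have "?i + ?k \<le> m - 1 \<longleftrightarrow> int ?i + int ?k < int m" using m0 by linarith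
  also have "\<dots> \<longleftrightarrow> pairing r p (degree_vector j \<gamma>) mod int m + pairing r p (degree_vector k \<mu>) mod int m < int m"
    using nn by simp
  finally have iff: "?i + ?k \<le> m - 1 \<longleftrightarrow> \<dots>" .
  have "contraction sc br \<theta> m \<zeta> x y = (if ?i + ?k \<le> m - 1 then br x y else 0)"
  proof (rule contraction_homogeneous[OF _ lin prim])
    show "lie_algebra sc br" by unfold_locales
    show "?i \<le> m - 1" "?k \<le> m - 1" using lt by linarith+
  qed (intro kac_residue_eigenspace[OF kac prim] x y)+
  from this[unfolded iff] show ?thesis unfolding m .
qed

lemma contractions_eq_on_weight_vectors:
  assumes kac: "is_kac_automorphism sc br s (\<lambda>j. gr j) ts r \<nu> \<delta> p \<zeta> \<theta>"
    and prim: "primitive_root_of_unity m \<zeta>" and m: "int m = pairing r p M"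
    and kac': "is_kac_automorphism sc br s (\<lambda>j. gr j) ts r \<nu> \<delta> p' \<zeta>' \<theta>'"
    and prim': "primitive_root_of_unity m' \<zeta>'" and m': "int m' = pairing r p' M"
    and supp: "{i \<in> {0..r}. p i \<noteq> 0} = {i \<in> {0..r}. p' i \<noteq> 0}"
    and x: "x \<in> weight_vectors" and y: "y \<in> weight_vectors"
  shows "contraction sc br \<theta> m \<zeta> x y = contraction sc br \<theta>' m' \<zeta>' x y"
proof -
  obtain j c where j: "j < s" "x \<in> wsp j (res c)" using x by blast
  obtain k d where k: "k < s" "y \<in> wsp k (res d)" using y by blast
  interpret C: Vector_Spaces.linear sc sc "contraction sc br \<theta> m \<zeta> x"
    by (rule linear_contraction(1)[OF _ prim kac_span_eigenspaces[OF kac prim]])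
      (use kac in \<open>simp add: is_kac_automorphism_def lie_automorphism_def\<close>)
  interpret C': Vector_Spaces.linear sc sc "contraction sc br \<theta>' m' \<zeta>' x"
    by (rule linear_contraction(1)[OF _ prim' kac_span_eigenspaces[OF kac' prim']])
      (use kac' in \<open>simp add: is_kac_automorphism_def lie_automorphism_def\<close>)
  interpret Cl: Vector_Spaces.linear sc sc "\<lambda>x. contraction sc br \<theta> m \<zeta> x y"
    by (rule linear_contraction(2)[OF _ prim kac_span_eigenspaces[OF kac prim]])
      (use kac in \<open>simp add: is_kac_automorphism_def lie_automorphism_def\<close>)
  interpret Cl': Vector_Spaces.linear sc sc "\<lambda>x. contraction sc br \<theta>' m' \<zeta>' x y"
    by (rule linear_contraction(2)[OF _ prim' kac_span_eigenspaces[OF kac' prim']])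
      (use kac' in \<open>simp add: is_kac_automorphism_def lie_automorphism_def\<close>)
  \<comment> \<open>The functionals \<open>res c\<close> and \<open>res d\<close> are known to be
    weights only if the vectors are nonzero.\<close>
  consider "x = 0" | "y = 0" | "x \<noteq> 0" "y \<noteq> 0" by blast
  then show ?thesis
  proof cases
    case 1
    then show ?thesis by (simp add: Cl.zero Cl'.zero)
  next
    case 2
    then show ?thesis by (simp add: C.zero C'.zero)
  next
    case 3
    let ?\<gamma> = "res c" and ?\<mu> = "res d"
    have wx: "?\<gamma> \<in> wts j" by (rule wtsI[OF j(2) 3(1) res_dual])
    have wy: "?\<mu> \<in> wts k" by (rule wtsI[OF k(2) 3(2) res_dual])
    note C = contraction_weight_vectors[OF kac prim m j(2,1) wx k(2,1) wy]
      contraction_weight_vectors[OF kac' prim' m' j(2,1) wx k(2,1) wy]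
    show ?thesis
    proof (cases "br x y = 0")
      case True
      then show ?thesis unfolding C by simp
    next
      case False
      \<comment> \<open>The bracket lies in \<open>gr (j + k)\<close>, which is
        \<open>gr ?l\<close>. The carry \<open>?q\<close> reappears below as a multiple of the
        imaginary root.\<close>
      let ?l = "(j + k) mod s" and ?q = "(j + k) div s"
      let ?\<kappa> = "\<lambda>h. ?\<gamma> h + ?\<mu> h"
      have "\<omega> ^ (?q * s) = 1"
        by (simp only: mult.commute[of ?q] power_mult omega_s power_one)
      moreover have "\<omega> ^ (j + k) = \<omega> ^ ?l * \<omega> ^ (?q * s)"
        by (simp only: mod_div_mult_eq flip: power_add)
      ultimately have "\<omega> ^ (j + k) = \<omega> ^ ?l" by (simp only: mult_1_right)
      moreover have "br x y \<in> gr (j + k)"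
        using j(2) k(2) by (intro gr_br) (simp_all add: weight_space_def)
      ultimately have "br x y \<in> gr ?l" by (simp only:)
      then have "br x y \<in> wsp ?l ?\<kappa>"
        using j(2) k(2) by (auto simp: weight_space_def br_derivation[of _ x y] br_scale_left
          br_scale_right scale_left_distrib)
      then have wxy: "?\<kappa> \<in> wts ?l"
        by (rule wtsI[OF _ False]) (use res_dual[of "\<lambda>i. c i + d i"] in \<open>simp add: res_add\<close>)
      have l: "?l < s" using s_pos by simp
      obtain n1 z1 where n1: "\<And>i. 0 \<le> n1 i \<and> n1 i \<le> M i" "\<And>i. degree_vector j ?\<gamma> i = n1 i - z1 * M i"
        using degree_vector_normalised[OF wx j(1)] by metis
      obtain n2 z2 where n2: "\<And>i. 0 \<le> n2 i \<and> n2 i \<le> M i" "\<And>i. degree_vector k ?\<mu> i = n2 i - z2 * M i"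
        using degree_vector_normalised[OF wy k(1)] by metis
      obtain n3 z3 where n3: "\<And>i. 0 \<le> n3 i \<and> n3 i \<le> M i" "\<And>i. degree_vector ?l ?\<kappa> i = n3 i - z3 * M i"
        using degree_vector_normalised[OF wxy l] by metis
      have l_eq: "int ?l = int j + int k - int ?q * int s"
      proof -
        have "int (j + k) = int (?l + ?q * s)" by (simp only: mod_div_mult_eq)
        then show ?thesis by (simp only: of_nat_add of_nat_mult)
      qed
      have dvl: "degree_vector ?l ?\<kappa> i = degree_vector j ?\<gamma> i + degree_vector k ?\<mu> i - int ?q * M i" for i
        unfolding degree_vector_def M_def l_eq
        using lattice_add(2)[OF weights_lattice[OF wx] weights_lattice[OF wy], of i]
        by (simp add: algebra_simps)
      \<comment> \<open>The integer in front of \<open>M i\<close> collects the three normalising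
        shifts and the carry. It is built from the weights alone and is therefore the same for
        \<open>p\<close> and \<open>p'\<close>.\<close>
      have n3_eq: "n3 i = n1 i + n2 i - (z1 + z2 + int ?q - z3) * M i" for i
        using dvl[of i] unfolding n1(2) n2(2) n3(2) by (simp add: algebra_simps)
      have pos: "0 < pairing r p M" "0 < pairing r p' M"
        using m m' prim prim' by (auto simp: primitive_root_of_unity_def simp flip: m m')
      have dv: "degree_vector j ?\<gamma> = (\<lambda>i. n1 i - z1 * M i)" "degree_vector k ?\<mu> = (\<lambda>i. n2 i - z2 * M i)"
        using n1(2) n2(2) by auto
      have red: "(u - z * v) mod v = u mod v" for u z v :: int
        using mod_mult_self1[of u "- z" v] by simp
      show ?thesis
        unfolding C dv pairing_linear red
        using residue_sum_depends_on_support[OF n1(1) n2(1) n3(1) n3_eq pos supp] by simp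
    qed
  qed
qed

end

theorem theorem5p2:
  fixes sc :: "'k::{alg_closed_field,field_char_0} \<Rightarrow> 'g::ab_group_add \<Rightarrow> 'g"
    and br :: "'g \<Rightarrow> 'g \<Rightarrow> 'g"
    and t b t\<sigma> b\<sigma> :: "'g set"
    and X :: dynkin_type
    and \<alpha> :: "nat \<Rightarrow> 'g \<Rightarrow> 'k"
    and e f :: "nat \<Rightarrow> 'g"
    and \<sigma> :: "'g \<Rightarrow> 'g"
    and \<omega> :: 'k
    and g :: "nat \<Rightarrow> 'g set"
    and r :: nat
    and \<nu> :: "nat \<Rightarrow> 'g \<Rightarrow> 'k"
    and \<delta> :: "'g \<Rightarrow> 'k"
    and p p' :: "nat \<Rightarrow> nat"
    and m m' :: nat
    and \<zeta> \<zeta>' :: 'k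
    and \<theta> \<theta>' :: "'g \<Rightarrow> 'g"
  assumes "simple_lie_algebra sc br"
    and "borel_subalgebra sc br b" and "cartan_subalgebra sc br t" and "t \<subseteq> b"
    and "outer_type X" and "chevalley_generators sc br t b X \<alpha> e f"
    and "nontrivial_diagram_automorphism sc br X e f \<sigma>"
    and "primitive_root_of_unity (aut_order \<sigma>) \<omega>"
    and "g = (\<lambda>j. eigenspace sc \<sigma> (\<omega> ^ j))"
    and "t\<sigma> = t \<inter> g 0" and "b\<sigma> = b \<inter> g 0"
    and "r = vector_space.dim sc t\<sigma>"
    and "bij_betw \<nu> {1..r} (simple_roots sc br (g 0) t\<sigma> b\<sigma>)"
    and "is_lowest_weight sc br (g 1) t\<sigma> r \<nu> (\<lambda>h. - \<delta> h)"
    and "kac_labels r p" and "int m = kac_order (aut_order \<sigma>) r \<nu> \<delta> p"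
    and "primitive_root_of_unity m \<zeta>"
    and "is_kac_automorphism sc br (aut_order \<sigma>) g t\<sigma> r \<nu> \<delta> p \<zeta> \<theta>"
    and "kac_labels r p'" and "int m' = kac_order (aut_order \<sigma>) r \<nu> \<delta> p'"
    and "primitive_root_of_unity m' \<zeta>'"
    and "is_kac_automorphism sc br (aut_order \<sigma>) g t\<sigma> r \<nu> \<delta> p' \<zeta>' \<theta>'"
    and "{i \<in> {0..r}. p i \<noteq> 0} = {i \<in> {0..r}. p' i \<noteq> 0}"
  shows "contraction sc br \<theta> m \<zeta> = contraction sc br \<theta>' m' \<zeta>'"
proof -
  have lie: "lie_algebra sc br" using assms(1) by (simp add: simple_lie_algebra_def)
  obtain \<pi> where \<pi>: "diagram_symmetry X \<pi>" "\<pi> \<noteq> id"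
    "\<And>i. i \<in> {1..dynkin_rank X} \<Longrightarrow> \<sigma> (e i) = e (\<pi> i)" "\<And>i. i \<in> {1..dynkin_rank X} \<Longrightarrow> \<sigma> (f i) = f (\<pi> i)"
    and \<sigma>: "lie_automorphism sc br \<sigma>"
    using assms(7) by (auto simp: nontrivial_diagram_automorphism_def)
  interpret lie_algebra sc br by (rule lie)
  interpret kac_algebra sc br t b X \<alpha> e f \<sigma> \<pi> \<omega> r \<nu> \<delta>
    by unfold_locales (use assms \<pi> \<sigma> in \<open>simp_all only: not_False_eq_True\<close>)
  have kac: "is_kac_automorphism sc br s (\<lambda>j. gr j) ts r \<nu> \<delta> p \<zeta> \<theta>"
    "is_kac_automorphism sc br s (\<lambda>j. gr j) ts r \<nu> \<delta> p' \<zeta>' \<theta>'"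
    using assms(9,10,18,22) by (simp_all only:)
  have m: "int m = pairing r p M" "int m' = pairing r p' M"
    using assms(16,20) by (simp_all only: kac_order_eq)
  have lin: "Vector_Spaces.linear sc sc \<theta>" "Vector_Spaces.linear sc sc \<theta>'"
    using kac by (simp_all add: is_kac_automorphism_def lie_automorphism_def)
  show ?thesis
    by (rule bilinear_eq_on_span[OF span_weight_vectors];
      (rule linear_contraction[OF lin(1) assms(17) kac_span_eigenspaces[OF kac(1) assms(17)]]
        | rule linear_contraction[OF lin(2) assms(21) kac_span_eigenspaces[OF kac(2) assms(21)]]
        | rule contractions_eq_on_weight_vectors[OF kac(1) assms(17) m(1) kac(2) assms(21) m(2) assms(23)]; assumption))
qed

end
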